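(* The free holomorphic automorphism group $\mathrm{Aut}(B(\mathcal H)^n_1)$ is a $\sigma$-compact, locally compact topological group with respect to the topology induced by the metric $d_{\mathcal E}$.
   Context: $n\ge1$ is an integer and $\mathcal H$ is a complex Hilbert space. $[B(\mathcal H)^n]_1=\{X\in B(\mathcal H)^n:\|\sum_iX_iX_i^*\|<1\}$ and $[B(\mathcal H)^n]_1^-=\{X\in B(\mathcal H)^n:\sum_iX_iX_i^*\le I\}$; an $n$-tuple is identified with the row operator $[X_1,\ldots,X_n]:\mathcal H^{(n)}\to\mathcal H$ and normed accordingly. A free holomorphic function (scalar coefficients) on $[B(\mathcal H)^n]_1$ is a map $X\mapsto\sum_{k\ge0}\sum_{|\alpha|=k}a_\alpha X_\alpha$, $a_\alpha\in\mathbb C$, norm convergent on $[B(\mathcal H)^n]_1$, where $\alpha$ runs over words in $n$ letters and $X_\alpha=X_{i_1}\cdots X_{i_k}$ for $\alpha=g_{i_1}\cdots g_{i_k}$. $\mathrm{Aut}(B(\mathcal H)^n_1)$ is the group, under composition, of bijections $\Psi$ of $[B(\mathcal H)^n]_1$ such that $\Psi$ and $\Psi^{-1}$ have free holomorphic components. It is known that these are exactly the maps $\Psi=\Phi_U\circ\Psi_\lambda$ with $U\in\mathcal U(\mathbb C^n)$ (unitary group) and $\lambda=\Psi^{-1}(0)\in\mathbb B_n$ (open unit ball of $\mathbb C^n$), where $\Phi_U(X)=[X_1,\ldots,X_n]U$ and $$\Psi_\lambda(X)=\lambda-\Delta_\lambda\Big(I-\sum_{i=1}^n\bar\lambda_iX_i\Big)^{-1}[X_1,\ldots,X_n]\Delta_{\lambda^*},$$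 $\Delta_\lambda=(1-\|\lambda\|_2^2)^{1/2}I$, $\Delta_{\lambda^*}=(I-\lambda^*\lambda)^{1/2}$ for the row $\lambda=[\lambda_1,\ldots,\lambda_n]$ (scalars/matrices are understood tensored with $I_{\mathcal H}$; $\Psi_0(X)=-X$). By the same formulas, each automorphism extends to a homeomorphism of $[B(\mathcal H)^n]_1^-$. The metric is $d_{\mathcal E}(\phi,\psi)=\|\phi-\psi\|_\infty+\|\phi^{-1}(0)-\psi^{-1}(0)\|$ for $\phi,\psi\in\mathrm{Aut}(B(\mathcal H)^n_1)$, where $\|\phi-\psi\|_\infty=\sup_X\|\phi(X)-\psi(X)\|$ over $X\in[B(\mathcal H)^n]_1$ (equivalently over $[B(\mathcal H)^n]_1^-$). *)

theory Defs
  imports "HOL-Analysis.Analysis" "HOL-Algebra.Bij"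
begin

section \<open>Complex Hilbert spaces and their bounded operators\<close>

text \<open>The inner product is linear in its first argument. The axiom \<open>scaleR_scaleC\<close> ties the real
  scaling inherited from \<^class>\<open>real_normed_vector\<close> to the complex one.\<close>

class complex_inner_space = real_normed_vector +
  fixes scaleC :: "complex \<Rightarrow> 'a \<Rightarrow> 'a"
    and cinner :: "'a \<Rightarrow> 'a \<Rightarrow> complex"
  assumes scaleC_add_right: "scaleC c (x + y) = scaleC c x + scaleC c y"
    and scaleC_add_left: "scaleC (c + d) x = scaleC c x + scaleC d x"
    and scaleC_scaleC: "scaleC c (scaleC d x) = scaleC (c * d) x"
    and scaleR_scaleC: "scaleR r x = scaleC (complex_of_real r) x"
    and cinner_commute: "cinner x y = cnj (cinner y x)"
    and cinner_add_left: "cinner (x + y) z = cinner x z + cinner y z"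
    and cinner_scaleC_left: "cinner (scaleC c x) y = c * cinner x y"
    and cinner_self_nonneg: "0 \<le> Re (cinner x x)"
    and norm_eq_sqrt_cinner: "norm x = sqrt (Re (cinner x x))"

class complex_hilbert_space = complex_inner_space + complete_space

lemma norm_scaleC: "norm (scaleC c x) = cmod c * norm (x :: 'h::complex_inner_space)"
proof -
  have "cinner (scaleC c x) (scaleC c x) = c * cnj (cinner (scaleC c x) x)"
    by (metis cinner_commute cinner_scaleC_left)
  also have "\<dots> = complex_of_real ((cmod c)\<^sup>2) * cnj (cinner x x)"
    by (simp only: cinner_scaleC_left complex_cnj_mult mult.assoc [symmetric] complex_norm_square)
  finally have "Re (cinner (scaleC c x) (scaleC c x)) = (cmod c)\<^sup>2 * Re (cinner x x)"
    by simp
  then show ?thesis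
    by (simp add: norm_eq_sqrt_cinner real_sqrt_mult)
qed

text \<open>\<open>B(H)\<close> is the set of complex linear elements of the type of bounded real linear operators;
  the norm of the latter is the operator norm.\<close>

definition bounded_ops :: "('h::complex_hilbert_space \<Rightarrow>\<^sub>L 'h) set" where
  "bounded_ops = {A. \<forall>c x. blinfun_apply A (scaleC c x) = scaleC c (blinfun_apply A x)}"

lift_definition scaleC_op ::
  "complex \<Rightarrow> ('h::complex_hilbert_space \<Rightarrow>\<^sub>L 'h) \<Rightarrow> ('h \<Rightarrow>\<^sub>L 'h)" is
  "\<lambda>c A x. scaleC c (A x)"
proof -
  fix c :: complex and A :: "'h \<Rightarrow> 'h"
  assume A: "bounded_linear A"
  have "bounded_linear (scaleC c :: 'h \<Rightarrow> 'h)"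
    by (rule bounded_linear_intro [where K = "cmod c"])
       (auto simp: scaleC_add_right scaleR_scaleC scaleC_scaleC norm_scaleC mult.commute)
  then show "bounded_linear (\<lambda>x. scaleC c (A x))"
    using A by (rule bounded_linear_compose)
qed

definition adj :: "('h::complex_hilbert_space \<Rightarrow>\<^sub>L 'h) \<Rightarrow> ('h \<Rightarrow>\<^sub>L 'h)" where
  "adj A = (THE B. \<forall>x y. cinner (blinfun_apply A x) y = cinner x (blinfun_apply B y))"

section \<open>Tuples of operators\<close>

text \<open>The Hilbert space direct sum \<open>H\<^sup>(\<^sup>n\<^sup>)\<close> is \<open>'h ^ 'n\<close>, whose norm is the \<open>\<ell>\<^sup>2\<close> norm, with
  \<open>n = CARD('n)\<close>. On tuples of operators the norm inherited from the type \<open>_ ^ 'n\<close> is \<^emph>\<open>not\<close> the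
  one used here: a tuple is normed as the row operator from \<open>H\<^sup>(\<^sup>n\<^sup>)\<close> to \<open>H\<close>.\<close>

type_synonym ('h, 'n) op_tuple = "('h \<Rightarrow>\<^sub>L 'h) ^ 'n"

definition row_op :: "('h::complex_hilbert_space, 'n::finite) op_tuple \<Rightarrow> (('h ^ 'n) \<Rightarrow>\<^sub>L 'h)" where
  "row_op X = (\<Sum>i\<in>UNIV. X $ i o\<^sub>L Blinfun (\<lambda>h. h $ i))"

lemma row_op_apply: "blinfun_apply (row_op X) h = (\<Sum>i\<in>UNIV. blinfun_apply (X $ i) (h $ i))"
  by (simp add: row_op_def blinfun.sum_left bounded_linear_Blinfun_apply bounded_linear_vec_nth)

definition row_norm :: "('h::complex_hilbert_space, 'n::finite) op_tuple \<Rightarrow> real" where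
  "row_norm X = norm (row_op X)"

definition op_ball :: "('h::complex_hilbert_space, 'n::finite) op_tuple set" where
  "op_ball = {X. (\<forall>i. X $ i \<in> bounded_ops) \<and> norm (\<Sum>i\<in>UNIV. X $ i o\<^sub>L adj (X $ i)) < 1}"

section \<open>Free holomorphic functions and automorphisms\<close>

text \<open>Words are lists of letters; the product \<open>X\<^sub>\<alpha>\<close> is taken from left to right.\<close>

definition word_op ::
  "('h::complex_hilbert_space, 'n::finite) op_tuple \<Rightarrow> 'n list \<Rightarrow> ('h \<Rightarrow>\<^sub>L 'h)" where
  "word_op X \<alpha> = foldr (\<lambda>i A. X $ i o\<^sub>L A) \<alpha> id_blinfun"

definition free_holomorphic ::
  "(('h::complex_hilbert_space, 'n::finite) op_tuple \<Rightarrow> ('h \<Rightarrow>\<^sub>L 'h)) \<Rightarrow> bool" where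
  "free_holomorphic f \<longleftrightarrow>
     (\<exists>a :: 'n list \<Rightarrow> complex. \<forall>X\<in>op_ball.
        (\<lambda>k. \<Sum>\<alpha> | length \<alpha> = k. scaleC_op (a \<alpha>) (word_op X \<alpha>)) sums f X)"

text \<open>Elements of \<^term>\<open>Bij S\<close> are bijections of \<open>S\<close> made unique as HOL functions by being
  \<^const>\<open>undefined\<close> outside \<open>S\<close>; multiplication in \<^term>\<open>BijGroup S\<close> is composition.\<close>

definition free_aut ::
  "(('h::complex_hilbert_space, 'n::finite) op_tuple \<Rightarrow> ('h, 'n) op_tuple) set" where
  "free_aut = {\<phi> \<in> Bij op_ball.
     (\<forall>i. free_holomorphic (\<lambda>X. \<phi> X $ i)) \<and>
     (\<forall>i. free_holomorphic (\<lambda>X. inv_into op_ball \<phi> X $ i))}"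

definition Aut_ball ::
  "(('h::complex_hilbert_space, 'n::finite) op_tuple \<Rightarrow> ('h, 'n) op_tuple) monoid" where
  "Aut_ball = (BijGroup op_ball)\<lparr>carrier := free_aut\<rparr>"

text \<open>The distance is set to \<open>0\<close> off \<open>free_aut\<close>, because \<^locale>\<open>Metric_space\<close> asks for
  nonnegativity on the whole type and a real supremum over an unbounded set is unspecified.\<close>

definition dist_E ::
  "(('h::complex_hilbert_space, 'n::finite) op_tuple \<Rightarrow> ('h, 'n) op_tuple) \<Rightarrow>
   (('h, 'n) op_tuple \<Rightarrow> ('h, 'n) op_tuple) \<Rightarrow> real" where
  "dist_E \<phi> \<psi> =
     (if \<phi> \<in> free_aut \<and> \<psi> \<in> free_aut
      then (SUP X\<in>op_ball. row_norm (\<phi> X - \<psi> X)) +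
           row_norm (inv_into op_ball \<phi> 0 - inv_into op_ball \<psi> 0)
      else 0)"

definition Aut_topology ::
  "(('h::complex_hilbert_space, 'n::finite) op_tuple \<Rightarrow> ('h, 'n) op_tuple) topology" where
  "Aut_topology = Metric_space.mtopology free_aut dist_E"

section \<open>Topological groups\<close>

definition topological_group :: "('a, 'b) monoid_scheme \<Rightarrow> 'a topology \<Rightarrow> bool" where
  "topological_group G T \<longleftrightarrow>
     group G \<and> topspace T = carrier G \<and>
     continuous_map (prod_topology T T) T (\<lambda>(x, y). x \<otimes>\<^bsub>G\<^esub> y) \<and>
     continuous_map T T (\<lambda>x. inv\<^bsub>G\<^esub> x)"

definition sigma_compact_space :: "'a topology \<Rightarrow> bool" where
  "sigma_compact_space T \<longleftrightarrow>
     (\<exists>K :: nat \<Rightarrow> 'a set. (\<forall>i. compactin T (K i)) \<and> (\<Union>i. K i) = topspace T)"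

end

theory Submission
  imports Defs "HOL-Complex_Analysis.Conformal_Mappings"
begin

text \<open>
  The theorem reduces to a finite-dimensional matrix group. Let \<open>U(1, n)\<close> be the group of complex
  matrices of size \<open>n + 1\<close> that preserve the form \<open>\<bar>z\<^sub>0\<bar>\<^sup>2 - \<bar>z\<^sub>1\<bar>\<^sup>2 - \<dots> - \<bar>z\<^sub>n\<bar>\<^sup>2\<close>. Such a matrix \<open>M\<close> acts on
  the operator ball by a linear fractional map: if \<open>[I, X] M = [p, q]\<close>, then \<open>X\<close> goes to \<open>p\<^sup>-\<^sup>1 q\<close>
  (\<open>lin_frac\<close>). In these homogeneous coordinates composition is multiplication of matrices, the ball is
  preserved because the form is, and Neumann's series for \<open>p\<^sup>-\<^sup>1\<close> shows that the map is free
  holomorphic.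

  The central fact is that every free automorphism \<open>\<phi>\<close> is of this form (\<open>free_aut_eq\<close>), for a Hilbert space
  of any dimension. The value of a free series at \<open>0\<close> is a scalar tuple, so a suitable \<open>M\<close> carries \<open>0\<close> to
  \<open>\<phi> 0\<close>. After composing with its inverse, the Schwarz lemma for the map and for its inverse shows
  that the derivative at \<open>0\<close> is isometric. It is given by a scalar matrix, which is therefore unitary,
  and so a second linear fractional map agrees with \<open>\<phi>\<close> up to first order. Cartan's uniqueness argument
  removes all higher terms: if \<open>\<phi>\<close> and the linear fractional map first differed in degree \<open>m\<close>, some
  self-map of the ball would have the form \<open>z X \<mapsto> z X + z\<^sup>m Q + \<dots>\<close> with \<open>Q \<noteq> 0\<close>, and the leading
  deviation \<open>n Q\<close> of its \<open>n\<close>-th iterate would be unbounded (\<open>iteration_forces_zero\<close>, \<open>Cartan_uniqueness\<close>).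
  Holomorphy enters this argument only along curves in the ball, as functions from the disc to operators
  that are local uniform limits of polynomials (\<open>hol_curve\<close>).

  For the topology, linear fractional maps are Lipschitz on the ball. Therefore composition and inversion are
  continuous in the supremum distance, and the additional term in the metric, which is a difference of
  values of the inverses at \<open>0\<close>, is dominated by a multiple of the supremum that depends on one of the two
  maps only (\<open>dist_E_le_sup_dist\<close>). The map from \<open>U(1, n)\<close> to automorphisms is continuous, and the
  matrices in \<open>U(1, n)\<close> with corner entry \<open>m\<close> of modulus at most \<open>R\<close> form a compact set. Their images are
  compact and exhaust the group, which is \<open>\<sigma>\<close>-compactness. Finally \<open>1 - 1/\<bar>m\<bar>\<^sup>2\<close> is the square of the norm
  of the point mapped to \<open>0\<close> (\<open>row_norm_inverse_zero\<close>), so metric balls of small radius stay inside one of these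
  compact sets.
\<close>

section \<open>Hilbert space preliminaries\<close>

instance complex_hilbert_space \<subseteq> banach ..

lemma scaleC_one [simp]: "scaleC 1 (x :: 'h::complex_inner_space) = x"
  by (metis of_real_1 scaleR_one scaleR_scaleC)

lemma scaleC_zero_left [simp]: "scaleC 0 (x :: 'h::complex_inner_space) = 0"
  by (metis of_real_0 scaleR_zero_left scaleR_scaleC)

lemma scaleC_zero_right [simp]: "scaleC c (0 :: 'h::complex_inner_space) = 0"
  by (metis add_cancel_right_right scaleC_add_right)

lemma scaleC_minus_right: "scaleC c (- (x :: 'h::complex_inner_space)) = - scaleC c x"
  by (metis add.right_inverse add_eq_0_iff scaleC_add_right scaleC_zero_right)

lemma scaleC_diff_right: "scaleC c (x - (y :: 'h::complex_inner_space)) = scaleC c x - scaleC c y"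
  by (metis diff_conv_add_uminus scaleC_add_right scaleC_minus_right)

lemma scaleC_sum_right: "scaleC c (\<Sum>i\<in>A. f i) = (\<Sum>i\<in>A. scaleC c (f i :: 'h::complex_inner_space))"
  by (induction A rule: infinite_finite_induct) (auto simp: scaleC_add_right)

lemma scaleC_sum_left: "scaleC (\<Sum>i\<in>A. f i) (x :: 'h::complex_inner_space) = (\<Sum>i\<in>A. scaleC (f i) x)"
  by (induction A rule: infinite_finite_induct) (auto simp: scaleC_add_left)

lemma scaleC_uminus_one: "scaleC (-1) (x :: 'h::complex_inner_space) = - x"
  by (metis of_real_1 of_real_minus scaleR_minus1_left scaleR_scaleC)

lemma cinner_add_right: "cinner x (y + z) = cinner x y + cinner (x :: 'h::complex_inner_space) z"
  by (metis cinner_add_left cinner_commute complex_cnj_add)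

lemma cinner_scaleC_right: "cinner x (scaleC c y) = cnj c * cinner (x :: 'h::complex_inner_space) y"
  by (metis cinner_commute cinner_scaleC_left complex_cnj_mult)

lemma cinner_zero_left [simp]: "cinner 0 (x :: 'h::complex_inner_space) = 0"
  by (metis cinner_scaleC_left mult_zero_left scaleC_zero_left)

lemma cinner_zero_right [simp]: "cinner (x :: 'h::complex_inner_space) 0 = 0"
  by (metis cinner_commute cinner_zero_left complex_cnj_zero)

lemma cinner_minus_left: "cinner (- x) (y :: 'h::complex_inner_space) = - cinner x y"
  by (metis add_eq_0_iff cinner_add_left cinner_zero_left right_minus)

lemma cinner_minus_right: "cinner (x :: 'h::complex_inner_space) (- y) = - cinner x y"
  by (metis cinner_commute cinner_minus_left complex_cnj_minus)

lemma cinner_diff_left: "cinner (x - y) (z :: 'h::complex_inner_space) = cinner x z - cinner y z"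
  by (metis add_uminus_conv_diff cinner_add_left cinner_minus_left)

lemma cinner_diff_right: "cinner (z :: 'h::complex_inner_space) (x - y) = cinner z x - cinner z y"
  by (metis add_uminus_conv_diff cinner_add_right cinner_minus_right)

lemma cinner_sum_left: "cinner (\<Sum>i\<in>A. f i) (y :: 'h::complex_inner_space) = (\<Sum>i\<in>A. cinner (f i) y)"
  by (induction A rule: infinite_finite_induct) (auto simp: cinner_add_left)

lemma cinner_sum_right: "cinner (y :: 'h::complex_inner_space) (\<Sum>i\<in>A. f i) = (\<Sum>i\<in>A. cinner y (f i))"
  by (induction A rule: infinite_finite_induct) (auto simp: cinner_add_right)

lemma cinner_self: "cinner x x = complex_of_real ((norm (x :: 'h::complex_inner_space))\<^sup>2)"
proof (rule complex_eqI)
  have "Im (cinner x x) = - Im (cinner x x)"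
    by (metis cinner_commute cnj.sel(2))
  then show "Im (cinner x x) = Im (complex_of_real ((norm x)\<^sup>2))" by simp
  show "Re (cinner x x) = Re (complex_of_real ((norm x)\<^sup>2))"
    using cinner_self_nonneg[of x] by (simp add: norm_eq_sqrt_cinner)
qed

lemma cinner_eq_zero_iff [simp]: "cinner x x = 0 \<longleftrightarrow> x = (0 :: 'h::complex_inner_space)"
  by (simp add: cinner_self)

lemma norm_diff_scaleC_sq:
  "(norm (x - scaleC c y))\<^sup>2 =
     (norm x)\<^sup>2 - 2 * Re (cnj c * cinner x y) + (cmod c)\<^sup>2 * (norm (y :: 'h::complex_inner_space))\<^sup>2"
proof -
  have "complex_of_real ((norm (x - scaleC c y))\<^sup>2) = cinner (x - scaleC c y) (x - scaleC c y)"
    by (simp add: cinner_self)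
  also have "\<dots> = cinner x x - (cnj c * cinner x y + cnj (cnj c * cinner x y)) + (c * cnj c) * cinner y y"
    using cinner_commute[of y x]
    by (simp add: cinner_diff_left cinner_diff_right cinner_scaleC_left cinner_scaleC_right algebra_simps)
  also have "\<dots> = complex_of_real ((norm x)\<^sup>2 - 2 * Re (cnj c * cinner x y) + (cmod c)\<^sup>2 * (norm y)\<^sup>2)"
    by (simp only: complex_add_cnj cinner_self complex_norm_square[symmetric] of_real_add of_real_diff of_real_mult)
  finally show ?thesis by (simp only: of_real_eq_iff)
qed

text \<open>Pythagoras for the projection of \<open>x\<close> to the line of \<open>y\<close>. The Cauchy-Schwarz inequality and the
  orthogonality in the Riesz representation both come from it.\<close>

lemma norm_sq_orthogonal_part:
  assumes y: "(y :: 'h::complex_inner_space) \<noteq> 0"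
  shows "(norm (x - scaleC (cinner x y / complex_of_real ((norm y)\<^sup>2)) y))\<^sup>2 =
           (norm x)\<^sup>2 - (cmod (cinner x y))\<^sup>2 / (norm y)\<^sup>2"
proof -
  define c where "c = cinner x y / complex_of_real ((norm y)\<^sup>2)"
  have cm: "(cmod c)\<^sup>2 * (norm y)\<^sup>2 = (cmod (cinner x y))\<^sup>2 / (norm y)\<^sup>2"
  proof -
    have "cmod c = cmod (cinner x y) / (norm y)\<^sup>2"
      by (simp add: c_def norm_divide norm_power)
    then show ?thesis using y by (simp add: power_divide power2_eq_square)
  qed
  have "cnj c * cinner x y = complex_of_real ((cmod (cinner x y))\<^sup>2 / (norm y)\<^sup>2)"
    by (simp add: c_def complex_norm_square mult.commute del: of_real_power)
  then have re: "Re (cnj c * cinner x y) = (cmod (cinner x y))\<^sup>2 / (norm y)\<^sup>2"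
    by simp
  show ?thesis
    unfolding c_def[symmetric] norm_diff_scaleC_sq re cm by simp
qed

lemma cinner_Cauchy_Schwarz: "cmod (cinner x y) \<le> norm x * norm (y :: 'h::complex_inner_space)"
proof (cases "y = 0")
  case False
  have "0 \<le> (norm x)\<^sup>2 - (cmod (cinner x y))\<^sup>2 / (norm y)\<^sup>2"
    unfolding norm_sq_orthogonal_part[OF False, symmetric] by simp
  then have "(cmod (cinner x y))\<^sup>2 \<le> (norm x * norm y)\<^sup>2"
    using False by (simp add: field_simps power_mult_distrib)
  then show ?thesis by (rule power2_le_imp_le) simp
qed simp

lemma parallelogram: 
  "(norm (x + y))\<^sup>2 + (norm (x - y))\<^sup>2 = 2 * (norm x)\<^sup>2 + 2 * (norm (y :: 'h::complex_inner_space))\<^sup>2"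
  using norm_diff_scaleC_sq[of x 1 y] norm_diff_scaleC_sq[of x "-1" y]
  by (simp add: scaleC_uminus_one)

text \<open>The affine hyperplane on which the functional takes the value 1 is closed and convex, so by the
  parallelogram law it has a point of least norm; a multiple of that point represents the functional.\<close>

lemma Riesz_representation:
  fixes f :: "'h::complex_hilbert_space \<Rightarrow> complex"
  assumes add: "\<And>x y. f (x + y) = f x + f y" and scale: "\<And>c x. f (scaleC c x) = c * f x"
    and bound: "\<And>x. cmod (f x) \<le> B * norm x"
  shows "\<exists>z. \<forall>x. f x = cinner x z"
proof (cases "\<forall>x. f x = 0")
  case True
  then show ?thesis by (metis cinner_zero_right)
next
  case False
  then obtain x0 where x0: "f x0 \<noteq> 0" by blast
  have f0: "f 0 = 0" using scale[of 0 0] by simp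
  have fdiff: "f (x - y) = f x - f y" for x y
    using add[of "x - y" y] by simp
  have bl: "bounded_linear f"
    by (rule bounded_linear_intro[where K=B])
       (auto simp: add scale scaleR_scaleC bound scaleR_conv_of_real mult.commute)
  define S where "S = {x. f x = 1}"
  define m where "m = Inf (norm ` S)"
  have S: "scaleC (1 / f x0) x0 \<in> S" using x0 by (simp add: S_def scale)
  have bdd: "bdd_below (norm ` S)" by (rule bdd_belowI[of _ 0]) auto
  have m_le: "m \<le> norm x" if "x \<in> S" for x
    unfolding m_def using that bdd by (simp add: cInf_lower)
  have m0: "0 \<le> m" unfolding m_def using S by (intro cInf_greatest) auto
  have "\<exists>x\<in>S. norm x < m + 1 / real (Suc n)" for n
  proof -
    have "\<exists>y\<in>norm ` S. y < m + 1 / real (Suc n)"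
      unfolding m_def using S bdd by (subst cInf_less_iff[symmetric]) auto
    then show ?thesis by blast
  qed
  then obtain s where sS: "\<And>n. s n \<in> S" and sm: "\<And>n. norm (s n) < m + 1 / real (Suc n)"
    by metis
  have near: "(norm (x - y))\<^sup>2 \<le> 4 * (2 * m * e + e\<^sup>2)"
    if "x \<in> S" "y \<in> S" "norm x \<le> m + e" "norm y \<le> m + e" "0 \<le> e" for x y e
  proof -
    (* The midpoint stays in the hyperplane, so the parallelogram law bounds the distance. *)
    have "scaleC (1/2) (x + y) \<in> S" using that by (simp add: S_def add scale)
    then have "m \<le> norm (scaleC (1/2) (x + y))" by (rule m_le)
    then have "2 * m \<le> norm (x + y)" by (simp add: norm_scaleC norm_divide)
    then have "(2 * m)\<^sup>2 \<le> (norm (x + y))\<^sup>2" using m0 by (intro power_mono) auto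
    moreover have "(norm x)\<^sup>2 \<le> (m + e)\<^sup>2" "(norm y)\<^sup>2 \<le> (m + e)\<^sup>2"
      using that by (auto intro!: power_mono)
    moreover note parallelogram[of x y]
    ultimately show ?thesis by (simp add: power2_eq_square algebra_simps)
  qed
  have "Cauchy s"
  proof (rule metric_CauchyI)
    fix e :: real assume e: "0 < e"
    have "(\<lambda>n. 4 * (2 * m * (1 / real (Suc n)) + (1 / real (Suc n))\<^sup>2)) \<longlonglongrightarrow> 4 * (2 * m * 0 + 0\<^sup>2)"
      by (intro tendsto_intros LIMSEQ_Suc[OF lim_1_over_n])
    then have "eventually (\<lambda>n. 4 * (2 * m * (1 / real (Suc n)) + (1 / real (Suc n))\<^sup>2) < e\<^sup>2) sequentially"
      using e by (intro order_tendstoD(2)) auto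
    then obtain N where N: "4 * (2 * m * (1 / real (Suc N)) + (1 / real (Suc N))\<^sup>2) < e\<^sup>2"
      by (auto simp: eventually_sequentially)
    have "dist (s i) (s j) < e" if "N \<le> i" "N \<le> j" for i j
    proof -
      have le: "norm (s k) \<le> m + 1 / real (Suc N)" if "N \<le> k" for k
      proof -
        have "1 / real (Suc k) \<le> 1 / real (Suc N)" using that by (simp add: frac_le)
        then show ?thesis using sm[of k] by linarith
      qed
      have "(norm (s i - s j))\<^sup>2 < e\<^sup>2"
        using near[OF sS sS le le, of i j] that N by fastforce
      then show ?thesis using e by (simp add: dist_norm power2_less_imp_less)
    qed
    then show "\<exists>M. \<forall>m\<ge>M. \<forall>n\<ge>M. dist (s m) (s n) < e" by blast
  qed
  then obtain p where p: "s \<longlonglongrightarrow> p" by (auto simp: Cauchy_convergent_iff convergent_def)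
  have "(\<lambda>n. f (s n)) \<longlonglongrightarrow> f p" by (rule bounded_linear.tendsto[OF bl p])
  moreover have "f (s n) = 1" for n using sS by (simp add: S_def)
  ultimately have fp: "f p = 1" by (simp add: LIMSEQ_const_iff)
  have pm: "norm p \<le> m"
  proof -
    have "(\<lambda>n. norm (s n)) \<longlonglongrightarrow> norm p" by (intro tendsto_intros p)
    moreover have "(\<lambda>n. m + 1 / real (Suc n)) \<longlonglongrightarrow> m + 0"
      by (intro tendsto_intros LIMSEQ_Suc[OF lim_1_over_n])
    ultimately have "norm p \<le> m + 0"
      by (rule LIMSEQ_le) (use sm less_imp_le in blast)
    then show ?thesis by simp
  qed
  have p0: "p \<noteq> 0" using fp f0 by auto
  (* Subtracting from p its projection to k stays in the hyperplane and must not decrease the norm. *)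
  have orth: "cinner k p = 0" if "f k = 0" for k
  proof (cases "k = 0")
    case False
    define c where "c = cinner p k / complex_of_real ((norm k)\<^sup>2)"
    have "p - scaleC c k \<in> S" using that fp by (simp add: S_def fdiff scale)
    then have "(norm p)\<^sup>2 \<le> (norm (p - scaleC c k))\<^sup>2"
      using m_le pm by (intro power_mono) (auto intro: order_trans)
    also have "\<dots> = (norm p)\<^sup>2 - (cmod (cinner p k))\<^sup>2 / (norm k)\<^sup>2"
      unfolding c_def by (rule norm_sq_orthogonal_part[OF False])
    finally have "(cmod (cinner p k))\<^sup>2 \<le> 0" using False by (simp add: field_simps)
    then show ?thesis using cinner_commute[of k p] by simp
  qed simp
  define z where "z = scaleC (complex_of_real (1 / (norm p)\<^sup>2)) p"
  have "f x = cinner x z" for x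
  proof -
    have "cinner (x - scaleC (f x) p) p = 0" by (rule orth) (simp add: fdiff scale fp)
    then have "cinner x p = f x * complex_of_real ((norm p)\<^sup>2)"
      by (simp add: cinner_diff_left cinner_scaleC_left cinner_self)
    then show ?thesis using p0 by (simp add: z_def cinner_scaleC_right)
  qed
  then show ?thesis by blast
qed

lemma cinner_right_cancel: "(\<And>x. cinner x y = cinner x z) \<Longrightarrow> y = (z :: 'h::complex_inner_space)"
  by (metis cinner_diff_right cinner_eq_zero_iff diff_self eq_iff_diff_eq_0)

lemma adj_exists:
  fixes A :: "'h::complex_hilbert_space \<Rightarrow>\<^sub>L 'h"
  assumes A: "A \<in> bounded_ops"
  shows "\<exists>B. \<forall>x y. cinner (blinfun_apply A x) y = cinner x (blinfun_apply B y)"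
proof -
  have Asc: "blinfun_apply A (scaleC c x) = scaleC c (blinfun_apply A x)" for c x
    using A by (simp add: bounded_ops_def)
  have "\<exists>z. \<forall>x. cinner (blinfun_apply A x) y = cinner x z" for y
  proof (rule Riesz_representation)
    fix x show "cmod (cinner (blinfun_apply A x) y) \<le> (norm A * norm y) * norm x"
      using cinner_Cauchy_Schwarz[of "blinfun_apply A x" y] norm_blinfun[of A x]
      by (smt (verit) mult.assoc mult.commute mult_right_mono norm_ge_zero)
  qed (auto simp: blinfun.bilinear_simps cinner_add_left Asc cinner_scaleC_left)
  then obtain b where b: "\<And>x y. cinner (blinfun_apply A x) y = cinner x (b y)" by metis
  have bl: "bounded_linear b"
  proof (rule bounded_linear_intro[where K="norm A"])
    show "b (x + y) = b x + b y" for x y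
      by (rule cinner_right_cancel) (simp add: b[symmetric] cinner_add_right)
    show "b (r *\<^sub>R x) = r *\<^sub>R b x" for r x
      by (rule cinner_right_cancel) (simp add: b[symmetric] scaleR_scaleC cinner_scaleC_right)
    show "norm (b x) \<le> norm x * norm A" for x
    proof -
      have "complex_of_real ((norm (b x))\<^sup>2) = cinner (blinfun_apply A (b x)) x"
        by (simp add: b cinner_self)
      then have "(norm (b x))\<^sup>2 = cmod (cinner (blinfun_apply A (b x)) x)"
        by (metis abs_of_nonneg norm_of_real zero_le_power2)
      also have "\<dots> \<le> norm A * norm (b x) * norm x"
        using cinner_Cauchy_Schwarz[of "blinfun_apply A (b x)" x] norm_blinfun[of A "b x"]
        by (smt (verit) mult_right_mono norm_ge_zero)
      finally show ?thesis
        by (cases "b x = 0") (auto simp: power2_eq_square algebra_simps)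
    qed
  qed
  show ?thesis
    by (rule exI[of _ "Blinfun b"]) (simp add: bounded_linear_Blinfun_apply[OF bl] b)
qed

text \<open>The adjoint is given by a definite description; the Riesz representation gives existence and
  \<open>cinner_right_cancel\<close> gives uniqueness.\<close>

lemma cinner_adj:
  fixes A :: "'h::complex_hilbert_space \<Rightarrow>\<^sub>L 'h"
  assumes A: "A \<in> bounded_ops"
  shows "cinner (blinfun_apply A x) y = cinner x (blinfun_apply (adj A) y)"
proof -
  have "\<exists>!B. \<forall>x y. cinner (blinfun_apply A x) y = cinner x (blinfun_apply B y)"
  proof (rule ex_ex1I[OF adj_exists[OF A]])
    fix B C :: "'h \<Rightarrow>\<^sub>L 'h"
    assume "\<forall>x y. cinner (blinfun_apply A x) y = cinner x (blinfun_apply B y)"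
      and "\<forall>x y. cinner (blinfun_apply A x) y = cinner x (blinfun_apply C y)"
    then show "B = C" by (intro blinfun_eqI cinner_right_cancel) auto
  qed
  from theI'[OF this] show ?thesis unfolding adj_def by blast
qed

section \<open>Row operators\<close>

lemma norm_vec_sq: "(norm (v :: 'a::real_normed_vector ^ 'n::finite))\<^sup>2 = (\<Sum>i\<in>UNIV. (norm (v $ i))\<^sup>2)"
  by (simp add: norm_vec_def L2_set_def sum_nonneg)

lemma row_op_diff: "row_op (X - Y) = row_op X - row_op Y"
  by (rule blinfun_eqI) (simp add: row_op_apply blinfun.bilinear_simps sum_subtractf)

lemma row_op_add: "row_op (X + Y) = row_op X + row_op Y"
  by (rule blinfun_eqI) (simp add: row_op_apply blinfun.bilinear_simps sum.distrib)

lemma row_op_zero [simp]: "row_op 0 = 0"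
  by (rule blinfun_eqI) (simp add: row_op_apply)

lemma row_norm_nonneg [simp]: "0 \<le> row_norm X" by (simp add: row_norm_def)

lemma row_norm_zero [simp]: "row_norm 0 = 0" by (simp add: row_norm_def)

lemma row_norm_triangle: "row_norm (X + Y) \<le> row_norm X + row_norm Y"
  by (simp add: row_norm_def row_op_add norm_triangle_ineq)

lemma row_norm_minus_commute: "row_norm (X - Y) = row_norm (Y - X)"
  by (simp add: row_norm_def row_op_diff norm_minus_commute)

lemma row_norm_triangle_diff: "row_norm (X - Z) \<le> row_norm (X - Y) + row_norm (Y - Z)"
  using row_norm_triangle[of "X - Y" "Y - Z"] by simp

lemma norm_row_op_apply: "norm (\<Sum>i\<in>UNIV. blinfun_apply (X $ i) (h $ i)) \<le> row_norm X * norm h"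
  using norm_blinfun[of "row_op X" h] by (simp add: row_op_apply row_norm_def)

lemma row_norm_leI:
  "0 \<le> c \<Longrightarrow> (\<And>h. norm (\<Sum>i\<in>UNIV. blinfun_apply (X $ i) (h $ i)) \<le> c * norm h) \<Longrightarrow> row_norm X \<le> c"
  unfolding row_norm_def by (rule norm_blinfun_bound) (auto simp: row_op_apply)

lemma norm_axis: "norm (axis i x :: 'a::real_normed_vector ^ 'n::finite) = norm x"
proof -
  have "(norm (axis i x :: 'a ^ 'n))\<^sup>2 = (\<Sum>j\<in>UNIV. if j = i then (norm x)\<^sup>2 else 0)"
    unfolding norm_vec_sq by (rule sum.cong) (auto simp: axis_def)
  then show ?thesis by simp
qed

lemma row_norm_component: "norm (X $ i) \<le> row_norm X"
proof (rule norm_blinfun_bound)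
  fix x
  have "(\<Sum>j\<in>UNIV. blinfun_apply (X $ j) ((axis i x) $ j)) = blinfun_apply (X $ i) x"
    by (subst sum.remove[of _ i]) (auto simp: axis_def intro!: sum.neutral)
  then show "norm (blinfun_apply (X $ i) x) \<le> row_norm X * norm x"
    using norm_row_op_apply[of X "axis i x"] by (simp only: norm_axis)
qed simp

lemma row_norm_le_sum: "row_norm X \<le> (\<Sum>i\<in>UNIV. norm (X $ i))"
proof (rule row_norm_leI)
  fix h
  have "norm (\<Sum>i\<in>UNIV. blinfun_apply (X $ i) (h $ i)) \<le> (\<Sum>i\<in>UNIV. norm (X $ i) * norm h)"
    by (intro sum_norm_le order_trans[OF norm_blinfun] mult_left_mono Finite_Cartesian_Product.norm_nth_le) auto
  then show "norm (\<Sum>i\<in>UNIV. blinfun_apply (X $ i) (h $ i)) \<le> (\<Sum>i\<in>UNIV. norm (X $ i)) * norm h"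
    by (simp add: sum_distrib_right)
qed (simp add: sum_nonneg)

lemma row_norm_eq_zero_iff: "row_norm X = 0 \<longleftrightarrow> X = 0"
proof
  assume "row_norm X = 0"
  then show "X = 0" using row_norm_component[of X] by (simp add: vec_eq_iff)
qed simp

text \<open>Put \<open>R = \<Sum> X\<^sub>i X\<^sub>i\<^sup>*\<close> and let \<open>v h\<close> be the column \<open>(X\<^sub>i\<^sup>* h)\<^sub>i\<close>, which is the adjoint of the row operator
  applied to \<open>h\<close>. Then \<open>R h\<close> is the row operator applied to \<open>v h\<close>, and \<open>\<langle>R h, h\<rangle>\<close> is the square of
  the norm of \<open>v h\<close>; both inequalities follow from these two identities and Cauchy-Schwarz.\<close>

lemma row_norm_sq:
  fixes X :: "('h::complex_hilbert_space, 'n::finite) op_tuple"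
  assumes X: "\<And>i. X $ i \<in> bounded_ops"
  shows "norm (\<Sum>i\<in>UNIV. X $ i o\<^sub>L adj (X $ i)) = (row_norm X)\<^sup>2"
proof -
  define R where "R = (\<Sum>i\<in>UNIV. X $ i o\<^sub>L adj (X $ i))"
  define v :: "'h \<Rightarrow> 'h ^ 'n" where "v h = (\<chi> i. blinfun_apply (adj (X $ i)) h)" for h
  have Rv: "blinfun_apply R h = blinfun_apply (row_op X) (v h)" for h
    by (simp add: R_def v_def row_op_apply blinfun.sum_left)
  have ip: "cinner (blinfun_apply (row_op X) g) h = (\<Sum>i\<in>UNIV. cinner (g $ i) (v h $ i))" for g h
    by (simp add: row_op_apply cinner_sum_left cinner_adj[OF X] v_def)
  have vh: "complex_of_real ((norm (v h))\<^sup>2) = cinner (blinfun_apply R h) h" for h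
    by (simp add: Rv ip cinner_self norm_vec_sq)
  have vh': "(norm (v h))\<^sup>2 = cmod (cinner (blinfun_apply R h) h)" for h
    using arg_cong[OF vh[of h], of cmod] by (simp add: norm_power)
  have CS: "cmod (cinner (blinfun_apply (row_op X) g) h) \<le> norm g * norm (v h)" for g h
  proof -
    have "cmod (cinner (blinfun_apply (row_op X) g) h) \<le> (\<Sum>i\<in>UNIV. norm (g $ i) * norm (v h $ i))"
      unfolding ip by (intro sum_norm_le cinner_Cauchy_Schwarz)
    also have "\<dots> \<le> norm g * norm (v h)"
      unfolding norm_vec_def using L2_set_mult_ineq[of "\<lambda>i. norm (g $ i)" "\<lambda>i. norm (v h $ i)" UNIV] by simp
    finally show ?thesis .
  qed
  have v_le: "norm (v h) \<le> row_norm X * norm h" for h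
  proof -
    have "(norm (v h))\<^sup>2 \<le> norm (blinfun_apply (row_op X) (v h)) * norm h"
      unfolding vh' Rv by (rule cinner_Cauchy_Schwarz)
    also have "\<dots> \<le> (row_norm X * norm (v h)) * norm h"
      unfolding row_norm_def by (intro mult_right_mono norm_blinfun) auto
    finally show ?thesis
      by (cases "v h = 0") (auto simp: power2_eq_square algebra_simps)
  qed
  have "norm R \<le> (row_norm X)\<^sup>2"
  proof (rule norm_blinfun_bound)
    fix h
    have "norm (blinfun_apply R h) \<le> row_norm X * norm (v h)"
      unfolding Rv row_norm_def by (rule norm_blinfun)
    also have "\<dots> \<le> row_norm X * (row_norm X * norm h)"
      by (intro mult_left_mono v_le) auto
    finally show "norm (blinfun_apply R h) \<le> (row_norm X)\<^sup>2 * norm h"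
      by (simp add: power2_eq_square)
  qed simp
  moreover have "row_norm X \<le> sqrt (norm R)"
    unfolding row_norm_def
  proof (rule norm_blinfun_bound)
    fix g
    define y where "y = blinfun_apply (row_op X) g"
    have "(norm (v y))\<^sup>2 \<le> norm R * (norm y)\<^sup>2"
    proof -
      have "(norm (v y))\<^sup>2 \<le> norm (blinfun_apply R y) * norm y"
        unfolding vh' by (rule cinner_Cauchy_Schwarz)
      also have "\<dots> \<le> (norm R * norm y) * norm y" by (intro mult_right_mono norm_blinfun) auto
      finally show ?thesis by (simp add: power2_eq_square mult.assoc)
    qed
    then have vy: "norm (v y) \<le> sqrt (norm R) * norm y"
      by (metis abs_norm_cancel real_sqrt_abs real_sqrt_le_mono real_sqrt_mult)
    have "(norm y)\<^sup>2 = cmod (cinner y y)" by (simp add: cinner_self norm_power)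
    also have "\<dots> \<le> norm g * norm (v y)" using CS[of g y] by (simp add: y_def)
    also have "\<dots> \<le> norm g * (sqrt (norm R) * norm y)" by (intro mult_left_mono vy) auto
    finally have "norm y \<le> sqrt (norm R) * norm g"
      by (cases "y = 0") (auto simp: power2_eq_square algebra_simps)
    then show "norm (blinfun_apply (row_op X) g) \<le> sqrt (norm R) * norm g" by (simp add: y_def)
  qed simp
  then have "(row_norm X)\<^sup>2 \<le> norm R"
    by (metis norm_ge_zero power_mono real_sqrt_pow2 row_norm_nonneg)
  ultimately show ?thesis by (simp add: R_def)
qed

text \<open>A description of the ball that does not mention adjoints; everything below uses this one.\<close>

lemma op_ball_iff: "X \<in> op_ball \<longleftrightarrow> (\<forall>i. X $ i \<in> bounded_ops) \<and> row_norm X < 1"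
proof -
  have "(row_norm X)\<^sup>2 < 1 \<longleftrightarrow> row_norm X < 1"
    by (metis abs_of_nonneg abs_square_less_1 row_norm_nonneg)
  then show ?thesis unfolding op_ball_def by (auto simp: row_norm_sq)
qed

section \<open>The algebra of bounded operators\<close>

lemma bounded_opsD: "A \<in> bounded_ops \<Longrightarrow> blinfun_apply A (scaleC c x) = scaleC c (blinfun_apply A x)"
  by (simp add: bounded_ops_def)

lemma scaleC_op_apply [simp]: "blinfun_apply (scaleC_op c A) x = scaleC c (blinfun_apply A x)"
  by (simp add: scaleC_op.rep_eq)

lemma norm_id_blinfun_le: "norm (id_blinfun :: 'a::real_normed_vector \<Rightarrow>\<^sub>L 'a) \<le> 1"
  by (rule norm_blinfun_bound) auto

lemma norm_scaleC_op: "norm (scaleC_op c A) = cmod c * norm A"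
proof -
  have le: "norm (scaleC_op c A) \<le> cmod c * norm A" for c and A :: "'a \<Rightarrow>\<^sub>L 'a"
    by (rule norm_blinfun_bound)
       (auto simp: norm_scaleC mult.assoc intro!: mult_left_mono norm_blinfun)
  show ?thesis
  proof (cases "c = 0")
    case True
    then show ?thesis using le[of 0 A] by simp
  next
    case False
    have "A = scaleC_op (1 / c) (scaleC_op c A)"
      using False by (intro blinfun_eqI) (simp add: scaleC_scaleC)
    then have "norm A \<le> cmod (1 / c) * norm (scaleC_op c A)" by (metis le)
    then have "cmod c * norm A \<le> norm (scaleC_op c A)"
      using False by (simp add: norm_divide field_simps)
    then show ?thesis using le[of c A] by simp
  qed
qed

lemma bounded_bilinear_scaleC_op: "bounded_bilinear scaleC_op"
proof
  show "\<exists>K. \<forall>a b. norm (scaleC_op a b) \<le> norm a * norm b * K"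
    by (rule exI[of _ 1]) (simp add: norm_scaleC_op)
qed (auto intro!: blinfun_eqI simp: blinfun.bilinear_simps scaleC_add_left scaleC_add_right
      scaleR_scaleC scaleC_scaleC scaleR_conv_of_real mult.commute)

lemma scaleC_op_scaleC_op: "scaleC_op c (scaleC_op d A) = scaleC_op (c * d) A"
  by (rule blinfun_eqI) (simp add: scaleC_scaleC)

lemma scaleC_op_one [simp]: "scaleC_op 1 A = A"
  by (rule blinfun_eqI) simp

lemmas scaleC_op_zero_left [simp] = bounded_bilinear.zero_left[OF bounded_bilinear_scaleC_op]
lemmas scaleC_op_zero_right [simp] = bounded_bilinear.zero_right[OF bounded_bilinear_scaleC_op]
lemmas scaleC_op_add_left = bounded_bilinear.add_left[OF bounded_bilinear_scaleC_op]
lemmas scaleC_op_add_right = bounded_bilinear.add_right[OF bounded_bilinear_scaleC_op]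
lemmas scaleC_op_diff_left = bounded_bilinear.diff_left[OF bounded_bilinear_scaleC_op]
lemmas scaleC_op_diff_right = bounded_bilinear.diff_right[OF bounded_bilinear_scaleC_op]
lemmas scaleC_op_sum_left = bounded_bilinear.sum_left[OF bounded_bilinear_scaleC_op]
lemmas scaleC_op_sum_right = bounded_bilinear.sum_right[OF bounded_bilinear_scaleC_op]
lemmas scaleC_op_minus_left = bounded_bilinear.minus_left[OF bounded_bilinear_scaleC_op]
lemmas scaleC_op_minus_right = bounded_bilinear.minus_right[OF bounded_bilinear_scaleC_op]
lemmas tendsto_scaleC_op = bounded_bilinear.tendsto[OF bounded_bilinear_scaleC_op]

lemmas comp_add_left = bounded_bilinear.add_left[OF bounded_bilinear_blinfun_compose]
lemmas comp_add_right = bounded_bilinear.add_right[OF bounded_bilinear_blinfun_compose]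
lemmas comp_diff_left = bounded_bilinear.diff_left[OF bounded_bilinear_blinfun_compose]
lemmas comp_diff_right = bounded_bilinear.diff_right[OF bounded_bilinear_blinfun_compose]
lemmas comp_sum_left = bounded_bilinear.sum_left[OF bounded_bilinear_blinfun_compose]
lemmas comp_sum_right = bounded_bilinear.sum_right[OF bounded_bilinear_blinfun_compose]
lemmas tendsto_comp = bounded_bilinear.tendsto[OF bounded_bilinear_blinfun_compose]

lemma comp_assoc: "(A o\<^sub>L B) o\<^sub>L C = A o\<^sub>L (B o\<^sub>L C)"
  by (rule blinfun_eqI) simp

lemma comp_id [simp]: "A o\<^sub>L id_blinfun = A" "id_blinfun o\<^sub>L A = A"
  by (rule blinfun_eqI, simp)+

lemma comp_zero [simp]: "A o\<^sub>L 0 = 0" "0 o\<^sub>L A = 0"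
  by (rule blinfun_eqI, simp add: blinfun.bilinear_simps)+

lemma comp_scaleC_left: "scaleC_op c A o\<^sub>L B = scaleC_op c (A o\<^sub>L B)"
  by (rule blinfun_eqI) simp

lemma comp_scaleC_right: "A \<in> bounded_ops \<Longrightarrow> A o\<^sub>L scaleC_op c B = scaleC_op c (A o\<^sub>L B)"
  by (rule blinfun_eqI) (simp add: bounded_opsD)

lemma bounded_ops_zero [simp]: "0 \<in> bounded_ops"
  by (simp add: bounded_ops_def)

lemma bounded_ops_id [simp]: "id_blinfun \<in> bounded_ops"
  by (simp add: bounded_ops_def)

lemma bounded_ops_add: "A \<in> bounded_ops \<Longrightarrow> B \<in> bounded_ops \<Longrightarrow> A + B \<in> bounded_ops"
  by (simp add: bounded_ops_def blinfun.bilinear_simps scaleC_add_right)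

lemma bounded_ops_diff: "A \<in> bounded_ops \<Longrightarrow> B \<in> bounded_ops \<Longrightarrow> A - B \<in> bounded_ops"
  by (simp add: bounded_ops_def blinfun.bilinear_simps scaleC_diff_right)

lemma bounded_ops_scaleC: "A \<in> bounded_ops \<Longrightarrow> scaleC_op c A \<in> bounded_ops"
  by (simp add: bounded_ops_def scaleC_scaleC mult.commute)

lemma bounded_ops_comp: "A \<in> bounded_ops \<Longrightarrow> B \<in> bounded_ops \<Longrightarrow> A o\<^sub>L B \<in> bounded_ops"
  by (simp add: bounded_ops_def)

lemma bounded_ops_sum: "(\<And>i. i \<in> S \<Longrightarrow> f i \<in> bounded_ops) \<Longrightarrow> sum f S \<in> bounded_ops"
  by (induction S rule: infinite_finite_induct) (auto intro: bounded_ops_add)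

definition op_power :: "('h::complex_hilbert_space \<Rightarrow>\<^sub>L 'h) \<Rightarrow> nat \<Rightarrow> ('h \<Rightarrow>\<^sub>L 'h)" where
  "op_power T k = ((\<lambda>A. T o\<^sub>L A) ^^ k) id_blinfun"

lemma op_power_0 [simp]: "op_power T 0 = id_blinfun"
  and op_power_Suc: "op_power T (Suc k) = T o\<^sub>L op_power T k"
  by (simp_all add: op_power_def)

lemma op_power_Suc2: "op_power T (Suc k) = op_power T k o\<^sub>L T"
proof (induction k)
  case (Suc k)
  have "op_power T (Suc (Suc k)) = T o\<^sub>L op_power T (Suc k)" by (rule op_power_Suc)
  also have "\<dots> = (T o\<^sub>L op_power T k) o\<^sub>L T" by (simp only: Suc comp_assoc)
  finally show ?case by (simp only: op_power_Suc)
qed (simp add: op_power_Suc)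

lemma norm_op_power: "norm T \<le> t \<Longrightarrow> norm (op_power T k) \<le> t ^ k"
proof (induction k)
  case 0
  then show ?case by (simp add: norm_id_blinfun_le)
next
  case (Suc k)
  have "norm (op_power T (Suc k)) \<le> norm T * norm (op_power T k)"
    unfolding op_power_Suc by (rule norm_blinfun_compose)
  also have "\<dots> \<le> t * t ^ k" using Suc by (intro mult_mono) (auto intro: order_trans[OF norm_ge_zero])
  finally show ?case by simp
qed

text \<open>The two-sided inverse, which is unique when it exists; otherwise the choice is arbitrary.\<close>

definition op_inv :: "('h::complex_hilbert_space \<Rightarrow>\<^sub>L 'h) \<Rightarrow> ('h \<Rightarrow>\<^sub>L 'h)" where
  "op_inv p = (SOME q. p o\<^sub>L q = id_blinfun \<and> q o\<^sub>L p = id_blinfun)"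

definition op_invertible :: "('h::complex_hilbert_space \<Rightarrow>\<^sub>L 'h) \<Rightarrow> bool" where
  "op_invertible p \<longleftrightarrow> p \<in> bounded_ops \<and> (\<exists>q. p o\<^sub>L q = id_blinfun \<and> q o\<^sub>L p = id_blinfun)"

lemma op_inv:
  assumes "op_invertible p"
  shows "p o\<^sub>L op_inv p = id_blinfun" "op_inv p o\<^sub>L p = id_blinfun"
  using assms someI_ex[of "\<lambda>q. p o\<^sub>L q = id_blinfun \<and> q o\<^sub>L p = id_blinfun"]
  unfolding op_inv_def op_invertible_def by blast+

lemma op_inv_eqI: 
  assumes "p \<in> bounded_ops" "p o\<^sub>L q = id_blinfun" "q o\<^sub>L p = id_blinfun"
  shows "op_invertible p" "op_inv p = q"
proof -
  show 1: "op_invertible p" using assms by (auto simp: op_invertible_def)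
  have "op_inv p = (q o\<^sub>L p) o\<^sub>L op_inv p" using assms by simp
  also have "\<dots> = q" by (simp add: comp_assoc op_inv[OF 1])
  finally show "op_inv p = q" .
qed

lemma op_inv_bounded_ops: 
  assumes "op_invertible p"
  shows "op_inv p \<in> bounded_ops"
  unfolding bounded_ops_def
proof (intro CollectI allI)
  fix c x
  have pb: "p \<in> bounded_ops" using assms by (simp add: op_invertible_def)
  have 1: "blinfun_apply p (blinfun_apply (op_inv p) y) = y" 
    and 2: "blinfun_apply (op_inv p) (blinfun_apply p y) = y" for y
    by (metis op_inv[OF assms] blinfun_apply_blinfun_compose blinfun_apply_id_blinfun id_apply)+
  have "blinfun_apply (op_inv p) (scaleC c x) = blinfun_apply (op_inv p) (blinfun_apply p (scaleC c (blinfun_apply (op_inv p) x)))"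
    by (simp add: bounded_opsD[OF pb] 1)
  then show "blinfun_apply (op_inv p) (scaleC c x) = scaleC c (blinfun_apply (op_inv p) x)"
    by (simp add: 2)
qed

lemma Neumann_series:
  fixes T :: "'h::complex_hilbert_space \<Rightarrow>\<^sub>L 'h"
  assumes T: "T \<in> bounded_ops" and nT: "norm T \<le> t" and t: "t < 1"
  shows "op_invertible (id_blinfun - T)"
    and "op_power T sums op_inv (id_blinfun - T)"
    and "norm (op_inv (id_blinfun - T)) \<le> 1 / (1 - t)"
proof -
  have t0: "0 \<le> t" using nT norm_ge_zero order_trans by blast
  have "summable (op_power T)"
    by (rule summable_comparison_test'[where g="\<lambda>k. t ^ k" and N=0])
       (use t t0 nT norm_op_power in \<open>auto intro: summable_geometric\<close>)
  then obtain q where q: "op_power T sums q" by blast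
  have l: "bounded_linear (\<lambda>A. T o\<^sub>L A)" and r: "bounded_linear (\<lambda>A. A o\<^sub>L T)"
    by (rule bounded_bilinear.bounded_linear_right bounded_bilinear.bounded_linear_left,
        rule bounded_bilinear_blinfun_compose)+
  have s: "(\<lambda>k. op_power T (Suc k)) sums (q - id_blinfun)"
    using q by (subst sums_Suc_iff) simp
  have Tq: "T o\<^sub>L q = q - id_blinfun"
    using bounded_linear.sums[OF l q] s unfolding op_power_Suc by (rule sums_unique2)
  have qT: "q o\<^sub>L T = q - id_blinfun"
    using bounded_linear.sums[OF r q] s unfolding op_power_Suc2 by (rule sums_unique2)
  have "id_blinfun - T \<in> bounded_ops" "(id_blinfun - T) o\<^sub>L q = id_blinfun" "q o\<^sub>L (id_blinfun - T) = id_blinfun"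
    by (simp_all add: bounded_ops_diff T comp_diff_left comp_diff_right Tq qT)
  note op_inv_eqI[OF this]
  moreover have "norm q \<le> 1 / (1 - t)"
  proof -
    have "q = id_blinfun + (T o\<^sub>L q)" by (simp add: Tq)
    then have "norm q \<le> norm (id_blinfun :: 'h \<Rightarrow>\<^sub>L 'h) + norm (T o\<^sub>L q)" by (metis norm_triangle_ineq)
    also have "\<dots> \<le> 1 + t * norm q"
      using norm_blinfun_compose[of T q] mult_right_mono[OF nT, of "norm q"] norm_id_blinfun_le[where 'a='h]
      by fastforce
    finally show ?thesis using t by (simp add: field_simps)
  qed
  ultimately show "op_invertible (id_blinfun - T)" "op_power T sums op_inv (id_blinfun - T)"
    "norm (op_inv (id_blinfun - T)) \<le> 1 / (1 - t)" using q by auto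
qed

lemma op_inv_scaleC:
  assumes "op_invertible p" "c \<noteq> 0"
  shows "op_invertible (scaleC_op c p)" "op_inv (scaleC_op c p) = scaleC_op (1 / c) (op_inv p)"
proof -
  have "p \<in> bounded_ops" using assms by (simp add: op_invertible_def)
  then have "scaleC_op c p \<in> bounded_ops" "scaleC_op c p o\<^sub>L scaleC_op (1 / c) (op_inv p) = id_blinfun"
    "scaleC_op (1 / c) (op_inv p) o\<^sub>L scaleC_op c p = id_blinfun"
    using assms by (simp_all add: bounded_ops_scaleC comp_scaleC_left 
       comp_scaleC_right op_inv_bounded_ops scaleC_op_scaleC_op op_inv)
  from op_inv_eqI[OF this]
  show "op_invertible (scaleC_op c p)" "op_inv (scaleC_op c p) = scaleC_op (1 / c) (op_inv p)" .
qed

text \<open>At a vector \<open>h\<close> the linear combination is the row operator applied to the column \<open>(c\<^sub>i h)\<^sub>i\<close>.\<close>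

lemma norm_linear_combination:
  fixes X :: "('h::complex_hilbert_space, 'n::finite) op_tuple"
  assumes X: "\<And>i. X $ i \<in> bounded_ops"
  shows "norm (\<Sum>i\<in>UNIV. scaleC_op (c i) (X $ i)) \<le> sqrt (\<Sum>i\<in>UNIV. (cmod (c i))\<^sup>2) * row_norm X"
proof (rule norm_blinfun_bound)
  fix h :: 'h
  define v where "v = (\<chi> i. scaleC (c i) h)"
  have "(norm v)\<^sup>2 = (\<Sum>i\<in>UNIV. (cmod (c i))\<^sup>2) * (norm h)\<^sup>2"
    by (simp add: norm_vec_sq v_def norm_scaleC power_mult_distrib sum_distrib_right)
  then have v: "norm v = sqrt (\<Sum>i\<in>UNIV. (cmod (c i))\<^sup>2) * norm h"
    by (metis abs_norm_cancel real_sqrt_abs real_sqrt_mult)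
  have "blinfun_apply (\<Sum>i\<in>UNIV. scaleC_op (c i) (X $ i)) h = (\<Sum>i\<in>UNIV. blinfun_apply (X $ i) (v $ i))"
    by (simp add: blinfun.sum_left v_def bounded_opsD[OF X])
  then show "norm (blinfun_apply (\<Sum>i\<in>UNIV. scaleC_op (c i) (X $ i)) h)
      \<le> sqrt (\<Sum>i\<in>UNIV. (cmod (c i))\<^sup>2) * row_norm X * norm h"
    using norm_row_op_apply[of X v] by (simp add: v mult_ac)
qed (simp add: sum_nonneg)

section \<open>Pseudo-unitary matrices\<close>

lemma sum_option: "(\<Sum>a\<in>UNIV. f a) = f None + (\<Sum>i\<in>(UNIV::'n::finite set). f (Some i))"
  by (simp add: UNIV_option_conv sum.reindex)

text \<open>The index \<^const>\<open>None\<close> stands for the additional homogeneous coordinate.\<close>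

type_synonym 'n ext_matrix = "complex ^ ('n option) ^ ('n option)"

definition sgnJ :: "'n option \<Rightarrow> complex" where
  "sgnJ a = (case a of None \<Rightarrow> 1 | Some _ \<Rightarrow> -1)"

lemma sgnJ_simps [simp]: "sgnJ None = 1" "sgnJ (Some i) = -1"
  "sgnJ a * sgnJ a = 1" "cnj (sgnJ a) = sgnJ a" "sgnJ a * (sgnJ a * z) = z"
  by (auto simp: sgnJ_def split: option.splits)

text \<open>With \<open>J = diag(1, -1, \<dots>, -1)\<close> the next two definitions say \<open>M\<^sup>* J M = J\<close>, which is membership in
  \<open>U(1, n)\<close>, and \<open>J M\<^sup>* J\<close>.\<close>

definition J_unitary :: "'n::finite ext_matrix \<Rightarrow> bool" where
  "J_unitary M \<longleftrightarrow>
     (\<forall>a b. (\<Sum>c\<in>UNIV. sgnJ c * cnj (M $ c $ a) * M $ c $ b) = (if a = b then sgnJ a else 0))"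

definition J_inv :: "'n::finite ext_matrix \<Rightarrow> 'n ext_matrix" where
  "J_inv M = (\<chi> a b. sgnJ a * cnj (M $ b $ a) * sgnJ b)"

lemma J_unitary_one: "J_unitary (mat 1)"
proof -
  have "(\<Sum>c\<in>UNIV. sgnJ c * cnj ((mat 1 :: 'a ext_matrix) $ c $ a) * (mat 1 :: 'a ext_matrix) $ c $ b)
     = (\<Sum>c\<in>UNIV. if c = a then if a = b then sgnJ a else 0 else 0)" for a b :: "'a option"
    by (rule sum.cong) (auto simp: mat_def)
  then show ?thesis by (simp add: J_unitary_def)
qed

lemma J_inv_left: 
  assumes "J_unitary M" shows "J_inv M ** M = mat 1"
proof -
  have "(J_inv M ** M) $ a $ b = (mat 1 :: 'a ext_matrix) $ a $ b" for a b
  proof -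
    have "(J_inv M ** M) $ a $ b = sgnJ a * (\<Sum>c\<in>UNIV. sgnJ c * cnj (M $ c $ a) * M $ c $ b)"
      by (simp add: matrix_matrix_mult_def J_inv_def sum_distrib_left mult_ac)
    also have "\<dots> = (mat 1 :: 'a ext_matrix) $ a $ b"
      using assms by (simp add: J_unitary_def mat_def)
    finally show ?thesis .
  qed
  then show ?thesis by (simp add: vec_eq_iff)
qed

lemma J_inv_right: "J_unitary M \<Longrightarrow> M ** J_inv M = mat 1"
  using J_inv_left matrix_left_right_inverse by blast

lemma J_unitary_rows:
  assumes "J_unitary M"
  shows "(\<Sum>c\<in>UNIV. M $ a $ c * sgnJ c * cnj (M $ b $ c)) = (if a = b then sgnJ a else 0)"
proof -
  have "(\<Sum>c\<in>UNIV. M $ a $ c * sgnJ c * cnj (M $ b $ c)) * sgnJ b = (M ** J_inv M) $ a $ b"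
    by (simp add: matrix_matrix_mult_def J_inv_def sum_distrib_left sum_distrib_right mult_ac)
  also have "\<dots> = (if a = b then 1 else 0)" by (simp add: J_inv_right[OF assms] mat_def)
  finally have "(\<Sum>c\<in>UNIV. M $ a $ c * sgnJ c * cnj (M $ b $ c)) * sgnJ b * sgnJ b = (if a = b then 1 else 0) * sgnJ b"
    by simp
  then show ?thesis by (simp only: mult.assoc sgnJ_simps) simp
qed

lemma J_unitary_J_inv: "J_unitary M \<Longrightarrow> J_unitary (J_inv M)"
proof -
  assume M: "J_unitary M"
  have "(\<Sum>c\<in>UNIV. sgnJ c * cnj (J_inv M $ c $ a) * J_inv M $ c $ b) = 
     sgnJ a * sgnJ b * (\<Sum>c\<in>UNIV. M $ a $ c * sgnJ c * cnj (M $ b $ c))" for a b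
    by (simp add: J_inv_def sum_distrib_left mult_ac)
  then show ?thesis using J_unitary_rows[OF M] by (auto simp: J_unitary_def)
qed

lemma J_unitary_mult:
  assumes M: "J_unitary M" and N: "J_unitary N"
  shows "J_unitary (M ** N)"
proof -
  have "(\<Sum>c\<in>UNIV. sgnJ c * cnj ((M ** N) $ c $ a) * (M ** N) $ c $ b) = (if a = b then sgnJ a else 0)" for a b
  proof -
    have "(\<Sum>c\<in>UNIV. sgnJ c * cnj ((M ** N) $ c $ a) * (M ** N) $ c $ b)
      = (\<Sum>c\<in>UNIV. \<Sum>d\<in>UNIV. \<Sum>e\<in>UNIV. sgnJ c * (cnj (M $ c $ d) * cnj (N $ d $ a)) * (M $ c $ e * N $ e $ b))"
      by (simp only: matrix_matrix_mult_def vec_lambda_beta cnj_sum complex_cnj_mult sum_distrib_left sum_distrib_right)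
         (rule sum.cong[OF refl], rule sum.swap)
    also have "\<dots> = (\<Sum>d\<in>UNIV. \<Sum>e\<in>UNIV. \<Sum>c\<in>UNIV. sgnJ c * (cnj (M $ c $ d) * cnj (N $ d $ a)) * (M $ c $ e * N $ e $ b))"
      by (subst sum.swap, rule sum.cong[OF refl], rule sum.swap)
    also have "\<dots> = (\<Sum>d\<in>UNIV. \<Sum>e\<in>UNIV. cnj (N $ d $ a) * N $ e $ b * (\<Sum>c\<in>UNIV. sgnJ c * cnj (M $ c $ d) * M $ c $ e))"
      by (simp add: sum_distrib_left mult_ac)
    also have "\<dots> = (\<Sum>d\<in>UNIV. \<Sum>e\<in>UNIV. if d = e then sgnJ d * cnj (N $ d $ a) * N $ d $ b else 0)"
      using M by (intro sum.cong) (auto simp: J_unitary_def)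
    also have "\<dots> = (if a = b then sgnJ a else 0)" using N by (simp add: J_unitary_def)
    finally show ?thesis .
  qed
  then show ?thesis by (simp add: J_unitary_def)
qed

lemma J_unitary_column_None:
  assumes "J_unitary M"
  shows "(cmod (M $ None $ None))\<^sup>2 = 1 + (\<Sum>i\<in>UNIV. (cmod (M $ Some i $ None))\<^sup>2)"
proof -
  have "(\<Sum>c\<in>UNIV. sgnJ c * cnj (M $ c $ None) * M $ c $ None) = 1"
    using assms by (simp add: J_unitary_def)
  then have "complex_of_real ((cmod (M $ None $ None))\<^sup>2 - (\<Sum>i\<in>UNIV. (cmod (M $ Some i $ None))\<^sup>2)) = 1"
    by (simp add: sum_option complex_norm_square mult.commute sum_negf del: of_real_power)
  then show ?thesis by (metis diff_add_cancel of_real_eq_1_iff)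
qed

lemma J_unitary_row_None:
  assumes "J_unitary M"
  shows "(cmod (M $ None $ None))\<^sup>2 = 1 + (\<Sum>i\<in>UNIV. (cmod (M $ None $ Some i))\<^sup>2)"
  using J_unitary_column_None[OF J_unitary_J_inv[OF assms]] by (simp add: J_inv_def)

lemma J_unitary_row_Some:
  assumes "J_unitary M"
  shows "(\<Sum>j\<in>UNIV. (cmod (M $ Some i $ Some j))\<^sup>2) = 1 + (cmod (M $ Some i $ None))\<^sup>2"
proof -
  have "complex_of_real ((cmod (M $ Some i $ None))\<^sup>2 - (\<Sum>j\<in>UNIV. (cmod (M $ Some i $ Some j))\<^sup>2)) = -1"
    using J_unitary_rows[OF assms, of "Some i" "Some i"]
    by (simp add: sum_option complex_norm_square mult.commute sum_negf del: of_real_power)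
  then have "(cmod (M $ Some i $ None))\<^sup>2 - (\<Sum>j\<in>UNIV. (cmod (M $ Some i $ Some j))\<^sup>2) = -1"
    by (metis of_real_1 of_real_eq_iff of_real_minus)
  then show ?thesis by simp
qed

lemma J_unitary_corner_ge_1: "J_unitary M \<Longrightarrow> 1 \<le> cmod (M $ None $ None)"
proof -
  assume "J_unitary M"
  then have "1\<^sup>2 \<le> (cmod (M $ None $ None))\<^sup>2"
    by (simp add: J_unitary_column_None sum_nonneg)
  then show ?thesis by (rule power2_le_imp_le) simp
qed

text \<open>The corner entry controls its own row and column by the two relations for \<^const>\<open>None\<close>, and the column
  controls the remaining rows. So a bound on one entry is enough for compactness.\<close>

lemma J_unitary_entry_le: 
  assumes M: "J_unitary M"
  shows "cmod (M $ a $ b) \<le> cmod (M $ None $ None)"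
proof -
  have le_sum: "f (i::'a) \<le> (\<Sum>i\<in>UNIV. f i)" if "\<And>i. 0 \<le> f i" for f :: "'a \<Rightarrow> real" and i
    by (rule member_le_sum) (use that in auto)
  have col: "(cmod (M $ Some i $ None))\<^sup>2 \<le> (cmod (M $ None $ None))\<^sup>2 - 1" for i
    using le_sum[of "\<lambda>i. (cmod (M $ Some i $ None))\<^sup>2" i] J_unitary_column_None[OF M] by simp
  have "(cmod (M $ a $ b))\<^sup>2 \<le> (cmod (M $ None $ None))\<^sup>2"
  proof (cases a)
    case None
    then show ?thesis
      using le_sum[of "\<lambda>i. (cmod (M $ None $ Some i))\<^sup>2" "the b"] J_unitary_row_None[OF M] by (cases b) auto
  next
    case (Some i)
    have "(cmod (M $ Some i $ Some j))\<^sup>2 \<le> 1 + (cmod (M $ Some i $ None))\<^sup>2" for j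
      unfolding J_unitary_row_Some[OF M, symmetric] by (rule le_sum) simp
    then show ?thesis
      using col[of i] Some by (cases b) (simp only:, smt (verit) zero_le_power2)+
  qed
  then show ?thesis by (rule power2_le_imp_le) simp
qed

text \<open>\<open>M \<otimes> I\<close> preserves the indefinite form on vectors with entries in the Hilbert space, as one sees by
  expanding both sides into scalar products of the entries.\<close>

lemma J_unitary_isometry:
  fixes x :: "'n::finite option \<Rightarrow> 'h::complex_hilbert_space"
  assumes M: "J_unitary M"
  defines "y \<equiv> \<lambda>a. \<Sum>b\<in>UNIV. scaleC (M $ a $ b) (x b)"
  shows "(norm (y None))\<^sup>2 - (\<Sum>i\<in>UNIV. (norm (y (Some i)))\<^sup>2) =
         (norm (x None))\<^sup>2 - (\<Sum>i\<in>UNIV. (norm (x (Some i)))\<^sup>2)"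
proof -
  have "(\<Sum>a\<in>UNIV. sgnJ a * cinner (y a) (y a)) =
     (\<Sum>a\<in>UNIV. \<Sum>b\<in>UNIV. \<Sum>c\<in>UNIV. sgnJ a * (M $ a $ c * (cnj (M $ a $ b) * cinner (x c) (x b))))"
    by (simp add: y_def cinner_sum_left cinner_sum_right cinner_scaleC_left cinner_scaleC_right sum_distrib_left mult_ac)
  also have "\<dots> = (\<Sum>b\<in>UNIV. \<Sum>c\<in>UNIV. \<Sum>a\<in>UNIV. sgnJ a * (M $ a $ c * (cnj (M $ a $ b) * cinner (x c) (x b))))"
    by (subst sum.swap, rule sum.cong[OF refl], rule sum.swap)
  also have "\<dots> = (\<Sum>b\<in>UNIV. \<Sum>c\<in>UNIV. cinner (x c) (x b) * (\<Sum>a\<in>UNIV. sgnJ a * cnj (M $ a $ b) * M $ a $ c))"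
    by (simp add: sum_distrib_left mult_ac)
  also have "\<dots> = (\<Sum>b\<in>UNIV. \<Sum>c\<in>UNIV. if b = c then sgnJ b * cinner (x b) (x b) else 0)"
    using M by (intro sum.cong) (auto simp: J_unitary_def)
  also have "\<dots> = (\<Sum>b\<in>UNIV. sgnJ b * cinner (x b) (x b))" by simp
  finally have "complex_of_real ((norm (y None))\<^sup>2 - (\<Sum>i\<in>UNIV. (norm (y (Some i)))\<^sup>2)) =
         complex_of_real ((norm (x None))\<^sup>2 - (\<Sum>i\<in>UNIV. (norm (x (Some i)))\<^sup>2))"
    by (simp add: sum_option cinner_self sum_negf)
  then show ?thesis by (simp only: of_real_eq_iff)
qed

section \<open>Linear fractional maps of the ball\<close>

text \<open>A tuple \<open>X\<close> has the homogeneous coordinates \<open>[I, X\<^sub>1, \<dots>, X\<^sub>n]\<close>. A matrix acts on them from the right,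
  \<open>[I, X] M = [p, q]\<close>, and dehomogenizing from the left gives the map \<open>X \<mapsto> p\<^sup>-\<^sup>1 q\<close>.\<close>

definition hom_coord :: "('h::complex_hilbert_space, 'n::finite) op_tuple \<Rightarrow> 'n option \<Rightarrow> ('h \<Rightarrow>\<^sub>L 'h)" where
  "hom_coord X a = (case a of None \<Rightarrow> id_blinfun | Some i \<Rightarrow> X $ i)"

definition lin_form :: "'n::finite ext_matrix \<Rightarrow> ('h::complex_hilbert_space, 'n) op_tuple \<Rightarrow> 'n option \<Rightarrow> ('h \<Rightarrow>\<^sub>L 'h)" where
  "lin_form M X b = (\<Sum>a\<in>UNIV. scaleC_op (M $ a $ b) (hom_coord X a))"

definition lin_frac :: "'n::finite ext_matrix \<Rightarrow> ('h::complex_hilbert_space, 'n) op_tuple \<Rightarrow> ('h, 'n) op_tuple" where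
  "lin_frac M X = (\<chi> j. op_inv (lin_form M X None) o\<^sub>L lin_form M X (Some j))"

lemma hom_coord_simps [simp]: "hom_coord X None = id_blinfun" "hom_coord X (Some i) = X $ i"
  by (simp_all add: hom_coord_def)

lemma lin_form_alt:
  "lin_form M X b = scaleC_op (M $ None $ b) id_blinfun + (\<Sum>i\<in>UNIV. scaleC_op (M $ Some i $ b) (X $ i))"
  by (simp add: lin_form_def sum_option)

lemma hom_coord_bounded_ops: "(\<And>i. X $ i \<in> bounded_ops) \<Longrightarrow> hom_coord X a \<in> bounded_ops"
  by (cases a) auto

lemma lin_form_bounded_ops: "(\<And>i. X $ i \<in> bounded_ops) \<Longrightarrow> lin_form M X b \<in> bounded_ops"
  unfolding lin_form_def by (intro bounded_ops_sum bounded_ops_scaleC hom_coord_bounded_ops)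

lemma op_ballD: "X \<in> op_ball \<Longrightarrow> X $ i \<in> bounded_ops" "X \<in> op_ball \<Longrightarrow> row_norm X < 1"
  by (auto simp: op_ball_iff)

lemma zero_in_op_ball [simp]: "0 \<in> op_ball"
  by (simp add: op_ball_iff)

text \<open>The denominator is \<open>m\<close> times \<open>I - T\<close>, where \<open>m\<close> is the corner entry and the coefficients of the
  linear form \<open>T\<close> have Euclidean norm \<open>sqrt (1 - 1/\<bar>m\<bar>\<^sup>2)\<close>.\<close>

definition denominator_part :: "'n::finite ext_matrix \<Rightarrow> ('h::complex_hilbert_space, 'n) op_tuple \<Rightarrow> ('h \<Rightarrow>\<^sub>L 'h)" where
  "denominator_part M X = (\<Sum>i\<in>UNIV. scaleC_op (- (M $ Some i $ None) / (M $ None $ None)) (X $ i))"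

lemma denominator_part:
  assumes M: "J_unitary M" and X: "X \<in> op_ball"
  shows "lin_form M X None = scaleC_op (M $ None $ None) (id_blinfun - denominator_part M X)"
    and "denominator_part M X \<in> bounded_ops"
    and "norm (denominator_part M X) \<le> sqrt (1 - 1 / (cmod (M $ None $ None))\<^sup>2)"
    and "M $ None $ None \<noteq> 0"
    and "sqrt (1 - 1 / (cmod (M $ None $ None))\<^sup>2) < 1"
proof -
  define m where "m = M $ None $ None"
  have m1: "1 \<le> cmod m" unfolding m_def by (rule J_unitary_corner_ge_1[OF M])
  show m0: "M $ None $ None \<noteq> 0" using m1 by (auto simp: m_def)
  show "lin_form M X None = scaleC_op (M $ None $ None) (id_blinfun - denominator_part M X)"
    using m0 by (simp add: lin_form_alt denominator_part_def scaleC_op_add_right scaleC_op_diff_right scaleC_op_sum_right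
        scaleC_op_scaleC_op sum_negf scaleC_op_minus_left scaleC_op_minus_right)
  show "denominator_part M X \<in> bounded_ops"
    unfolding denominator_part_def by (intro bounded_ops_sum bounded_ops_scaleC op_ballD[OF X])
  have "(\<Sum>i\<in>UNIV. (cmod (- (M $ Some i $ None) / m))\<^sup>2) = ((cmod m)\<^sup>2 - 1) / (cmod m)\<^sup>2"
    using J_unitary_column_None[OF M] by (simp add: norm_divide power_divide sum_divide_distrib[symmetric] m_def)
  also have "\<dots> = 1 - 1 / (cmod m)\<^sup>2" using m1 by (subst diff_divide_distrib) auto
  finally have c: "(\<Sum>i\<in>UNIV. (cmod (- (M $ Some i $ None) / m))\<^sup>2) = 1 - 1 / (cmod m)\<^sup>2" .
  have "norm (denominator_part M X) \<le> sqrt (1 - 1 / (cmod m)\<^sup>2) * row_norm X"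
    unfolding denominator_part_def m_def[symmetric] c[symmetric]
    by (rule norm_linear_combination[OF op_ballD(1)[OF X]])
  also have "\<dots> \<le> sqrt (1 - 1 / (cmod m)\<^sup>2) * 1"
    using op_ballD(2)[OF X] c by (intro mult_left_mono) (auto intro!: sum_nonneg simp: c[symmetric])
  finally show "norm (denominator_part M X) \<le> sqrt (1 - 1 / (cmod (M $ None $ None))\<^sup>2)"
    by (simp add: m_def)
  show "sqrt (1 - 1 / (cmod (M $ None $ None))\<^sup>2) < 1"
    using m1 m0 by (simp add: m_def)
qed

text \<open>The constant: if \<open>t\<^sup>2 = 1 - 1/\<bar>m\<bar>\<^sup>2\<close>, then the Neumann bound \<open>1 / (\<bar>m\<bar> (1 - t))\<close> equals \<open>\<bar>m\<bar> (1 + t)\<close>.\<close>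

lemma denominator_invertible:
  assumes M: "J_unitary M" and X: "X \<in> op_ball"
  shows "op_invertible (lin_form M X None)"
    and "norm (op_inv (lin_form M X None)) \<le> 2 * cmod (M $ None $ None)"
    and "op_inv (lin_form M X None) = scaleC_op (1 / M $ None $ None) (op_inv (id_blinfun - denominator_part M X))"
proof -
  define g where "g = cmod (M $ None $ None)"
  define t where "t = sqrt (1 - 1 / g\<^sup>2)"
  note d = denominator_part[OF M X, folded g_def, folded t_def]
  note N = Neumann_series[OF d(2,3,5)]
  show "op_invertible (lin_form M X None)"
    and eq: "op_inv (lin_form M X None) = scaleC_op (1 / M $ None $ None) (op_inv (id_blinfun - denominator_part M X))"
    using op_inv_scaleC[OF N(1) d(4)] by (simp_all add: d(1))
  have g1: "1 \<le> g" unfolding g_def by (rule J_unitary_corner_ge_1[OF M])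
  have t0: "0 \<le> t" using g1 by (simp add: t_def)
  have "t\<^sup>2 = 1 - 1 / g\<^sup>2" using g1 by (simp add: t_def)
  then have "(1 - t) * (1 + t) = 1 / g\<^sup>2" by (simp add: power2_eq_square algebra_simps)
  then have "(1 - t) * (g\<^sup>2 * (1 + t)) = 1 / g\<^sup>2 * g\<^sup>2" by (metis mult.assoc mult.commute)
  then have "(1 - t) * (g\<^sup>2 * (1 + t)) = 1" using g1 by simp
  then have "1 / (1 - t) = g\<^sup>2 * (1 + t)" using d(5) by (subst divide_eq_eq) (simp add: mult.commute)
  also have "\<dots> \<le> g\<^sup>2 * 2" using d(5) by (intro mult_left_mono) auto
  finally have "norm (op_inv (id_blinfun - denominator_part M X)) \<le> g\<^sup>2 * 2"
    using N(3) by linarith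
  then have "norm (op_inv (lin_form M X None)) \<le> (1 / g) * (g\<^sup>2 * 2)"
    unfolding eq norm_scaleC_op norm_divide g_def by (intro mult_mono) auto
  then show "norm (op_inv (lin_form M X None)) \<le> 2 * cmod (M $ None $ None)"
    using g1 by (simp add: g_def[symmetric] power2_eq_square)
qed

lemma lin_form_lin_frac:
  assumes M: "J_unitary M" and X: "X \<in> op_ball"
  shows "lin_form M X None o\<^sub>L (lin_frac M X $ j) = lin_form M X (Some j)"
  by (simp add: lin_frac_def comp_assoc[symmetric] op_inv[OF denominator_invertible(1)[OF M X]])

lemma lin_frac_bounded_ops:
  assumes "J_unitary M" "X \<in> op_ball"
  shows "lin_frac M X $ j \<in> bounded_ops"
  using assms by (simp add: lin_frac_def bounded_ops_comp op_inv_bounded_ops denominator_invertible(1)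
      lin_form_bounded_ops op_ballD)

text \<open>If the row \<open>lin_frac M X\<close> maps \<open>g\<close> to \<open>k\<close>, then the matrix \<open>M\<close> maps \<open>(-k, g)\<close> to a vector \<open>(u, w)\<close> with
  \<open>u + X w = 0\<close>. As \<open>X\<close> is a strict contraction, \<open>(u, w)\<close> is negative for the indefinite form, which
  \<open>M\<close> preserves; so \<open>(-k, g)\<close> is negative, too.\<close>

lemma lin_frac_in_op_ball:
  fixes X :: "('h::complex_hilbert_space, 'n::finite) op_tuple"
  assumes M: "J_unitary M" and X: "X \<in> op_ball"
  shows "lin_frac M X \<in> op_ball"
proof -
  define r where "r = row_norm X"
  have r: "0 \<le> r" "r < 1" using op_ballD(2)[OF X] by (auto simp: r_def)
  then have r2: "r\<^sup>2 < 1" by (simp add: power_less_one_iff)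
  (* K bounds the inverse of M, so that norm g <= K * norm w below; this makes the contraction strict. *)
  define K where "K = 1 + (\<Sum>j\<in>(UNIV::'n set). \<Sum>a\<in>UNIV. cmod (J_inv M $ Some j $ a))"
  have K: "1 \<le> K" by (simp add: K_def sum_nonneg)
  define s where "s = sqrt (1 - (1 - r\<^sup>2) / K\<^sup>2)"
  have K2: "1 \<le> K\<^sup>2" using K by simp
  have frac: "0 < (1 - r\<^sup>2) / K\<^sup>2" "(1 - r\<^sup>2) / K\<^sup>2 \<le> 1"
  proof -
    show "0 < (1 - r\<^sup>2) / K\<^sup>2" using r2 K2 by (intro divide_pos_pos) linarith+
    have "1 - r\<^sup>2 \<le> K\<^sup>2" using K2 zero_le_power2[of r] by linarith
    then show "(1 - r\<^sup>2) / K\<^sup>2 \<le> 1" using K2 by (subst divide_le_eq_1) linarith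
  qed
  have s: "0 \<le> s" "s < 1" "s\<^sup>2 = 1 - (1 - r\<^sup>2) / K\<^sup>2"
    using frac by (auto simp: s_def)
  have "norm (\<Sum>j\<in>UNIV. blinfun_apply (lin_frac M X $ j) (g $ j)) \<le> s * norm g" for g
  proof -
    define k where "k = (\<Sum>j\<in>UNIV. blinfun_apply (lin_frac M X $ j) (g $ j))"
    define x :: "'n option \<Rightarrow> 'h" where "x b = (case b of None \<Rightarrow> - k | Some j \<Rightarrow> g $ j)" for b
    define y where "y a = (\<Sum>b\<in>UNIV. scaleC (M $ a $ b) (x b))" for a
    define w :: "'h ^ 'n" where "w = (\<chi> i. y (Some i))"
    have "(\<Sum>a\<in>UNIV. blinfun_apply (hom_coord X a) (y a)) = (\<Sum>b\<in>UNIV. blinfun_apply (lin_form M X b) (x b))"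
      unfolding y_def lin_form_def blinfun.sum_right blinfun.sum_left
      by (subst sum.swap)
         (simp add: bounded_opsD[OF hom_coord_bounded_ops[OF op_ballD(1)[OF X]]])
    also have "\<dots> = blinfun_apply (lin_form M X None) (- k) + (\<Sum>j\<in>UNIV. blinfun_apply (lin_form M X None o\<^sub>L lin_frac M X $ j) (g $ j))"
      by (simp add: sum_option x_def lin_form_lin_frac[OF M X])
    also have "\<dots> = 0" by (simp add: k_def blinfun.bilinear_simps blinfun.sum_right)
    finally have "y None = - (\<Sum>i\<in>UNIV. blinfun_apply (X $ i) (w $ i))"
      by (simp add: sum_option w_def eq_neg_iff_add_eq_0)
    then have y0: "norm (y None) \<le> r * norm w"
      using norm_row_op_apply[of X w] by (simp add: r_def)
    have yw: "norm (y a) \<le> norm w" for a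
    proof (cases a)
      case None
      have "r * norm w \<le> 1 * norm w" using r by (intro mult_right_mono) auto
      then show ?thesis using y0 None by simp
    next
      case (Some i)
      then show ?thesis using Finite_Cartesian_Product.norm_nth_le[of w i] by (simp add: w_def)
    qed
    have xy: "x b = (\<Sum>a\<in>UNIV. scaleC (J_inv M $ b $ a) (y a))" for b
    proof -
      have "(\<Sum>a\<in>UNIV. scaleC (J_inv M $ b $ a) (y a)) = (\<Sum>c\<in>UNIV. scaleC ((J_inv M ** M) $ b $ c) (x c))"
        unfolding y_def scaleC_sum_right matrix_matrix_mult_def
        by (subst sum.swap) (simp add: scaleC_scaleC scaleC_sum_left)
      also have "\<dots> = (\<Sum>c\<in>UNIV. if b = c then x b else 0)"
        unfolding J_inv_left[OF M] by (intro sum.cong) (auto simp: mat_def)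
      finally show ?thesis by simp
    qed
    have gw: "norm g \<le> K * norm w"
    proof -
      have "norm g \<le> (\<Sum>j\<in>UNIV. norm (g $ j))"
        unfolding norm_vec_def by (rule L2_set_le_sum) simp
      also have "\<dots> \<le> (\<Sum>j\<in>UNIV. \<Sum>a\<in>UNIV. cmod (J_inv M $ Some j $ a) * norm w)"
      proof (intro sum_mono)
        fix j
        have "g $ j = (\<Sum>a\<in>UNIV. scaleC (J_inv M $ Some j $ a) (y a))" using xy[of "Some j"] by (simp add: x_def)
        then show "norm (g $ j) \<le> (\<Sum>a\<in>UNIV. cmod (J_inv M $ Some j $ a) * norm w)"
          by (auto intro!: sum_norm_le mult_left_mono yw simp: norm_scaleC)
      qed
      also have "\<dots> = (K - 1) * norm w" by (simp add: K_def sum_distrib_right)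
      also have "\<dots> \<le> K * norm w" by (intro mult_right_mono) auto
      finally show ?thesis .
    qed
    have "(norm (y None))\<^sup>2 - (norm w)\<^sup>2 = (norm k)\<^sup>2 - (norm g)\<^sup>2"
      using J_unitary_isometry[OF M, of x] by (simp add: y_def w_def norm_vec_sq x_def)
    moreover have "(norm (y None))\<^sup>2 \<le> r\<^sup>2 * (norm w)\<^sup>2"
      using power_mono[OF y0, of 2] by (simp add: power_mult_distrib)
    ultimately have k: "(norm k)\<^sup>2 \<le> (norm g)\<^sup>2 - (1 - r\<^sup>2) * (norm w)\<^sup>2"
      by (simp add: algebra_simps)
    have "(norm g)\<^sup>2 \<le> K\<^sup>2 * (norm w)\<^sup>2"
      using power_mono[OF gw, of 2] by (simp add: power_mult_distrib)
    then have "(norm g)\<^sup>2 / K\<^sup>2 \<le> (norm w)\<^sup>2" using K2 by (simp add: divide_le_eq mult.commute)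
    then have "(1 - r\<^sup>2) * ((norm g)\<^sup>2 / K\<^sup>2) \<le> (1 - r\<^sup>2) * (norm w)\<^sup>2"
      using r2 by (intro mult_left_mono) auto
    with k have "(norm k)\<^sup>2 \<le> (1 - (1 - r\<^sup>2) / K\<^sup>2) * (norm g)\<^sup>2"
      by (simp add: algebra_simps)
    also have "\<dots> = (s * norm g)\<^sup>2" by (simp add: power_mult_distrib s(3))
    finally have "norm k \<le> s * norm g" by (rule power2_le_imp_le) (use s in simp)
    then show ?thesis by (simp add: k_def)
  qed
  then have "row_norm (lin_frac M X) \<le> s" by (rule row_norm_leI[OF s(1)])
  then show ?thesis using s(2) by (auto simp: op_ball_iff lin_frac_bounded_ops[OF M X])
qed

lemma lin_frac_one: 
  assumes X: "X \<in> op_ball" shows "lin_frac (mat 1) X = X"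
proof -
  have lf: "lin_form (mat 1) X b = hom_coord X b" for b
  proof -
    have "lin_form (mat 1) X b = (\<Sum>a\<in>UNIV. if a = b then hom_coord X b else 0)"
      unfolding lin_form_def by (rule sum.cong) (auto simp: mat_def)
    then show ?thesis by simp
  qed
  have "op_inv id_blinfun = (id_blinfun :: 'a \<Rightarrow>\<^sub>L 'a)" by (rule op_inv_eqI) auto
  then show ?thesis by (simp add: lin_frac_def lf vec_eq_iff)
qed

text \<open>The homogeneous coordinates of \<open>lin_frac M X\<close> are those of \<open>X\<close> multiplied by \<open>M\<close> from the right and by
  the inverse of the denominator from the left; hence composition of maps is multiplication of matrices.\<close>

lemma lin_frac_lin_frac:
  fixes X :: "('h::complex_hilbert_space, 'n::finite) op_tuple"
  assumes M: "J_unitary M" and N: "J_unitary N" and X: "X \<in> op_ball"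
  shows "lin_frac N (lin_frac M X) = lin_frac (M ** N) X"
proof -
  define p where "p = lin_form M X None"
  have inv: "op_invertible p" unfolding p_def by (rule denominator_invertible(1)[OF M X])
  have ib: "op_inv p \<in> bounded_ops" by (rule op_inv_bounded_ops[OF inv])
  have hc: "hom_coord (lin_frac M X) a = op_inv p o\<^sub>L lin_form M X a" for a
    by (cases a) (simp_all add: lin_frac_def p_def op_inv[OF inv[unfolded p_def]])
  have lf: "lin_form N (lin_frac M X) b = op_inv p o\<^sub>L lin_form (M ** N) X b" for b
  proof -
    have "lin_form N (lin_frac M X) b = op_inv p o\<^sub>L (\<Sum>a\<in>UNIV. scaleC_op (N $ a $ b) (lin_form M X a))"
      by (simp add: lin_form_def[of N] hc comp_sum_right comp_scaleC_right[OF ib])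
    also have "(\<Sum>a\<in>UNIV. scaleC_op (N $ a $ b) (lin_form M X a)) = lin_form (M ** N) X b"
      unfolding lin_form_def scaleC_op_sum_right matrix_matrix_mult_def
      by (subst sum.swap) (simp add: scaleC_op_scaleC_op scaleC_op_sum_left mult.commute)
    finally show ?thesis .
  qed
  define q where "q = lin_form (M ** N) X None"
  have invq: "op_invertible q" unfolding q_def
    by (rule denominator_invertible(1)[OF J_unitary_mult[OF M N] X])
  have "op_inv (op_inv p o\<^sub>L q) = op_inv q o\<^sub>L p"
  proof (rule op_inv_eqI(2))
    have "q \<in> bounded_ops" using invq by (simp add: op_invertible_def)
    then show "op_inv p o\<^sub>L q \<in> bounded_ops" by (intro bounded_ops_comp ib)
    have "(op_inv p o\<^sub>L q) o\<^sub>L (op_inv q o\<^sub>L p) = op_inv p o\<^sub>L ((q o\<^sub>L op_inv q) o\<^sub>L p)" by (simp only: comp_assoc)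
    then show "(op_inv p o\<^sub>L q) o\<^sub>L (op_inv q o\<^sub>L p) = id_blinfun"
      by (simp add: op_inv[OF inv] op_inv[OF invq])
    have "(op_inv q o\<^sub>L p) o\<^sub>L (op_inv p o\<^sub>L q) = op_inv q o\<^sub>L ((p o\<^sub>L op_inv p) o\<^sub>L q)" by (simp only: comp_assoc)
    then show "(op_inv q o\<^sub>L p) o\<^sub>L (op_inv p o\<^sub>L q) = id_blinfun"
      by (simp add: op_inv[OF inv] op_inv[OF invq])
  qed
  moreover have "(op_inv q o\<^sub>L p) o\<^sub>L (op_inv p o\<^sub>L A) = op_inv q o\<^sub>L A" for A :: "'h \<Rightarrow>\<^sub>L 'h"
  proof -
    have "(op_inv q o\<^sub>L p) o\<^sub>L (op_inv p o\<^sub>L A) = op_inv q o\<^sub>L ((p o\<^sub>L op_inv p) o\<^sub>L A)" by (simp only: comp_assoc)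
    then show ?thesis by (simp add: op_inv[OF inv])
  qed
  ultimately show ?thesis
    unfolding lin_frac_def[of N] lin_frac_def[of "M ** N"] lf q_def by simp
qed

lemma lin_frac_J_inv:
  assumes "J_unitary M" "X \<in> op_ball"
  shows "lin_frac (J_inv M) (lin_frac M X) = X" "lin_frac M (lin_frac (J_inv M) X) = X"
  using assms by (simp_all add: lin_frac_lin_frac J_unitary_J_inv J_inv_left J_inv_right lin_frac_one)

lemma bij_betw_lin_frac: "J_unitary M \<Longrightarrow> bij_betw (lin_frac M) op_ball op_ball"
  by (rule bij_betw_byWitness[where f' = "lin_frac (J_inv M)"])
     (auto simp: lin_frac_J_inv intro: lin_frac_in_op_ball J_unitary_J_inv)

text \<open>Clearing denominators makes the difference of two values linear in the difference of the data.
  All continuity properties of linear fractional maps rest on this identity.\<close>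

lemma lin_frac_diff:
  assumes M: "J_unitary M" and X: "X \<in> op_ball" and N: "J_unitary N" and Y: "Y \<in> op_ball"
  shows "lin_frac M X $ j - lin_frac N Y $ j = op_inv (lin_form M X None) o\<^sub>L
     ((lin_form M X (Some j) - lin_form N Y (Some j)) - ((lin_form M X None - lin_form N Y None) o\<^sub>L (lin_frac N Y $ j)))"
proof -
  have "(lin_form M X (Some j) - lin_form N Y (Some j)) - ((lin_form M X None - lin_form N Y None) o\<^sub>L (lin_frac N Y $ j))
    = lin_form M X (Some j) - (lin_form M X None o\<^sub>L lin_frac N Y $ j)"
    by (simp add: comp_diff_left lin_form_lin_frac[OF N Y])
  also have "op_inv (lin_form M X None) o\<^sub>L \<dots> = lin_frac M X $ j - lin_frac N Y $ j"
    unfolding comp_diff_right comp_assoc[symmetric] op_inv(2)[OF denominator_invertible(1)[OF M X]]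
    by (simp add: lin_frac_def)
  finally show ?thesis by simp
qed

lemma row_norm_lin_frac_diff:
  assumes M: "J_unitary M" and X: "X \<in> op_ball" and N: "J_unitary N" and Y: "Y \<in> op_ball"
    and bd: "\<And>b. norm (lin_form M X b - lin_form N Y b) \<le> e"
  shows "row_norm (lin_frac M X - lin_frac N Y :: ('h::complex_hilbert_space, 'n::finite) op_tuple)
     \<le> real CARD('n) * (2 * cmod (M $ None $ None) * (2 * e))"
proof -
  have e: "0 \<le> e" using bd[of None] norm_ge_zero order_trans by blast
  have W: "norm (lin_frac N Y $ j) \<le> 1" for j
    using row_norm_component[of "lin_frac N Y" j] op_ballD(2)[OF lin_frac_in_op_ball[OF N Y]] by linarith
  have "row_norm (lin_frac M X - lin_frac N Y) \<le> (\<Sum>j\<in>UNIV. norm ((lin_frac M X - lin_frac N Y) $ j))"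
    by (rule row_norm_le_sum)
  also have "\<dots> \<le> (\<Sum>j\<in>(UNIV::'n set). 2 * cmod (M $ None $ None) * (2 * e))"
  proof (rule sum_mono)
    fix j
    have "norm ((lin_form M X None - lin_form N Y None) o\<^sub>L (lin_frac N Y $ j)) \<le> e * 1"
      by (rule order_trans[OF norm_blinfun_compose]) (use bd W e in \<open>intro mult_mono; simp\<close>)
    then have "norm ((lin_form M X (Some j) - lin_form N Y (Some j)) - ((lin_form M X None - lin_form N Y None) o\<^sub>L (lin_frac N Y $ j))) \<le> 2 * e"
      using bd[of "Some j"] norm_triangle_ineq4 order_trans by (smt (verit))
    then show "norm ((lin_frac M X - lin_frac N Y) $ j) \<le> 2 * cmod (M $ None $ None) * (2 * e)"
      unfolding vector_minus_component lin_frac_diff[OF M X N Y]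
      by (intro order_trans[OF norm_blinfun_compose] mult_mono denominator_invertible(2)[OF M X]) auto
  qed
  finally show ?thesis by simp
qed

lemma lin_form_diff: "lin_form M X b - lin_form M Y b = (\<Sum>i\<in>UNIV. scaleC_op (M $ Some i $ b) ((X - Y) $ i))"
  by (simp add: lin_form_alt scaleC_op_diff_right sum_subtractf)

lemma lin_frac_Lipschitz:
  fixes M :: "'n::finite ext_matrix"
  assumes M: "J_unitary M"
  shows "\<exists>L>0. \<forall>X\<in>op_ball. \<forall>Y\<in>(op_ball :: ('h::complex_hilbert_space, 'n) op_tuple set).
     row_norm (lin_frac M X - lin_frac M Y) \<le> L * row_norm (X - Y)"
proof -
  define K where "K = (\<Sum>b\<in>UNIV. \<Sum>i\<in>UNIV. cmod (M $ Some i $ b))"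
  have K0: "0 \<le> K" unfolding K_def by (intro sum_nonneg) auto
  have bd: "norm (lin_form M X b - lin_form M Y b) \<le> K * row_norm (X - Y)" for X Y :: "('h, 'n) op_tuple" and b
  proof -
    have "norm (lin_form M X b - lin_form M Y b) \<le> (\<Sum>i\<in>UNIV. cmod (M $ Some i $ b) * row_norm (X - Y))"
      unfolding lin_form_diff
      by (auto intro!: sum_norm_le mult_left_mono row_norm_component[of "X - Y", simplified] simp: norm_scaleC_op)
    also have "\<dots> = (\<Sum>i\<in>UNIV. cmod (M $ Some i $ b)) * row_norm (X - Y)" by (simp add: sum_distrib_right)
    also have "\<dots> \<le> K * row_norm (X - Y)"
      unfolding K_def by (intro mult_right_mono member_le_sum[where f="\<lambda>b. \<Sum>i\<in>UNIV. cmod (M $ Some i $ b)"]) (auto intro: sum_nonneg)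
    finally show ?thesis .
  qed
  define L where "L = real CARD('n) * (2 * cmod (M $ None $ None) * (2 * K)) + 1"
  have "row_norm (lin_frac M X - lin_frac M Y) \<le> L * row_norm (X - Y)"
    if "X \<in> op_ball" "Y \<in> op_ball" for X Y :: "('h, 'n) op_tuple"
  proof -
    have "row_norm (lin_frac M X - lin_frac M Y) \<le> real CARD('n) * (2 * cmod (M $ None $ None) * (2 * (K * row_norm (X - Y))))"
      by (rule row_norm_lin_frac_diff[OF M that(1) M that(2) bd])
    also have "\<dots> \<le> L * row_norm (X - Y)" by (simp add: L_def algebra_simps)
    finally show ?thesis .
  qed
  moreover have "0 < L" using K0 by (auto simp: L_def intro!: add_nonneg_pos)
  ultimately show ?thesis by blast
qed

lemma lin_frac_Lipschitz_in_matrix: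
  fixes M N :: "'n::finite ext_matrix"
  assumes M: "J_unitary M" and N: "J_unitary N" and X: "X \<in> (op_ball :: ('h::complex_hilbert_space, 'n) op_tuple set)"
  shows "row_norm (lin_frac M X - lin_frac N X) \<le> 
    real CARD('n) * (2 * cmod (M $ None $ None) * (2 * (real CARD('n option) * norm (M - N))))"
proof (rule row_norm_lin_frac_diff[OF M X N X])
  fix b
  have "lin_form M X b - lin_form N X b = (\<Sum>a\<in>UNIV. scaleC_op ((M - N) $ a $ b) (hom_coord X a))"
    by (simp add: lin_form_def scaleC_op_diff_left sum_subtractf)
  moreover have "norm (scaleC_op ((M - N) $ a $ b) (hom_coord X a)) \<le> norm (M - N)" for a
  proof -
    have "norm (hom_coord X a) \<le> 1"
      using row_norm_component[of X] op_ballD(2)[OF X] norm_id_blinfun_le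
      by (cases a) (auto intro: order_trans less_imp_le)
    moreover have "cmod ((M - N) $ a $ b) \<le> norm (M - N)"
      by (meson Finite_Cartesian_Product.norm_nth_le order_trans)
    ultimately have "cmod ((M - N) $ a $ b) * norm (hom_coord X a) \<le> norm (M - N) * 1"
      by (intro mult_mono) auto
    then show ?thesis by (simp add: norm_scaleC_op)
  qed
  ultimately have "norm (lin_form M X b - lin_form N X b) \<le> (\<Sum>a\<in>(UNIV::'n option set). norm (M - N))"
    by (simp only:) (rule sum_norm_le, simp)
  then show "norm (lin_form M X b - lin_form N X b) \<le> real CARD('n option) * norm (M - N)"
    by simp
qed

section \<open>Homogeneous free polynomials\<close>

definition free_poly :: "('n::finite list \<Rightarrow> complex) \<Rightarrow> nat \<Rightarrow> ('h::complex_hilbert_space, 'n) op_tuple \<Rightarrow> ('h \<Rightarrow>\<^sub>L 'h)" where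
  "free_poly a k X = (\<Sum>\<alpha> | length \<alpha> = k. scaleC_op (a \<alpha>) (word_op X \<alpha>))"

lemma word_op_simps [simp]: "word_op X [] = id_blinfun" "word_op X (i # \<alpha>) = X $ i o\<^sub>L word_op X \<alpha>"
  by (simp_all add: word_op_def)

lemma words_Suc: "{\<alpha> :: 'n::finite list. length \<alpha> = Suc k} = (\<lambda>(i, \<beta>). i # \<beta>) ` (UNIV \<times> {\<beta>. length \<beta> = k})"
  by (auto simp: length_Suc_conv image_iff)

lemma free_poly_0 [simp]: "free_poly a 0 X = scaleC_op (a []) id_blinfun"
  by (simp add: free_poly_def)

lemma free_poly_Suc:
  fixes X :: "('h::complex_hilbert_space, 'n::finite) op_tuple"
  shows "free_poly a (Suc k) X = 
   (\<Sum>i\<in>UNIV. \<Sum>\<beta> | length \<beta> = k. scaleC_op (a (i # \<beta>)) (X $ i o\<^sub>L word_op X \<beta>))"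
proof -
  have "inj_on (\<lambda>(i :: 'n, \<beta>). i # \<beta>) (UNIV \<times> {\<beta>. length \<beta> = k})" by (auto simp: inj_on_def)
  then show ?thesis
    unfolding free_poly_def words_Suc sum.cartesian_product
    by (subst sum.reindex) (auto intro!: sum.cong)
qed

lemma free_poly_1: "free_poly a (Suc 0) X = (\<Sum>i\<in>UNIV. scaleC_op (a [i]) (X $ i))"
  by (simp add: free_poly_Suc)

lemma free_holomorphicE:
  assumes "free_holomorphic f"
  obtains a where "\<And>X. X \<in> op_ball \<Longrightarrow> (\<lambda>k. free_poly a k X) sums f X"
  using assms unfolding free_holomorphic_def free_poly_def by blast

text \<open>Expanding the inverse of the denominator in its Neumann series \<open>\<Sum> T\<^sup>k\<close> and multiplying by the normalized numerator
  \<open>d + Q\<close> gives the constant term \<open>d\<close>, the linear term \<open>T d + Q\<close>, and from then on each homogeneous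
  term is \<open>T\<close> times the one before it; the recursion for the coefficients expresses this.\<close>

fun geometric_coeff :: "('n \<Rightarrow> complex) \<Rightarrow> complex \<Rightarrow> ('n \<Rightarrow> complex) \<Rightarrow> 'n list \<Rightarrow> complex" where
  "geometric_coeff c d0 d [] = d0"
| "geometric_coeff c d0 d [i] = c i * d0 + d i"
| "geometric_coeff c d0 d (i # j # \<alpha>) = c i * geometric_coeff c d0 d (j # \<alpha>)"

lemma geometric_coeff_series:
  fixes X :: "('h::complex_hilbert_space, 'n::finite) op_tuple" and c d :: "'n \<Rightarrow> complex" and d0 :: complex
  assumes X: "\<And>i. X $ i \<in> bounded_ops"
  defines "T \<equiv> \<Sum>i\<in>UNIV. scaleC_op (c i) (X $ i)"
  assumes T: "norm T \<le> t" "t < 1"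
  shows "(\<lambda>k. free_poly (geometric_coeff c d0 d) k X) sums
     (op_inv (id_blinfun - T) o\<^sub>L (scaleC_op d0 id_blinfun + (\<Sum>i\<in>UNIV. scaleC_op (d i) (X $ i))))"
proof -
  define a where "a = geometric_coeff c d0 d"
  define Q where "Q = (\<Sum>i\<in>UNIV. scaleC_op (d i) (X $ i))"
  define q where "q = op_inv (id_blinfun - T)"
  have Tb: "T \<in> bounded_ops" unfolding T_def by (intro bounded_ops_sum bounded_ops_scaleC X)
  note N = Neumann_series[OF Tb T]
  have step: "free_poly a (Suc (Suc k)) X = T o\<^sub>L free_poly a (Suc k) X" for k
  proof -
    have "free_poly a (Suc (Suc k)) X = (\<Sum>i\<in>UNIV. \<Sum>\<beta> | length \<beta> = Suc k. scaleC_op (c i) (X $ i o\<^sub>L scaleC_op (a \<beta>) (word_op X \<beta>)))"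
      unfolding free_poly_Suc
      by (intro sum.cong refl) (auto simp: a_def length_Suc_conv comp_scaleC_right[OF X] scaleC_op_scaleC_op mult_ac)
    also have "\<dots> = T o\<^sub>L free_poly a (Suc k) X"
      by (simp add: T_def free_poly_def comp_sum_left comp_sum_right comp_scaleC_left scaleC_op_sum_right) (rule sum.swap)
    finally show ?thesis .
  qed
  have one: "free_poly a (Suc 0) X = scaleC_op d0 T + Q"
    by (simp add: free_poly_1 a_def T_def Q_def scaleC_op_add_left scaleC_op_sum_right scaleC_op_scaleC_op sum.distrib mult.commute)
  have "free_poly a (Suc k) X = op_power T k o\<^sub>L (scaleC_op d0 T + Q)" for k
  proof (induction k)
    case (Suc k)
    then show ?case by (simp only: step op_power_Suc comp_assoc)
  qed (simp add: one)
  moreover have "(\<lambda>k. op_power T k o\<^sub>L (scaleC_op d0 T + Q)) sums (q o\<^sub>L (scaleC_op d0 T + Q))"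
    unfolding q_def
    by (rule bounded_linear.sums[OF bounded_bilinear.bounded_linear_left[OF bounded_bilinear_blinfun_compose] N(2)])
  ultimately have "(\<lambda>k. free_poly a (Suc k) X) sums (q o\<^sub>L (scaleC_op d0 T + Q))" by simp
  then have "(\<lambda>k. free_poly a k X) sums ((q o\<^sub>L (scaleC_op d0 T + Q)) + scaleC_op d0 id_blinfun)"
    by (subst (asm) sums_Suc_iff) (simp add: a_def)
  moreover have "(q o\<^sub>L (scaleC_op d0 T + Q)) + scaleC_op d0 id_blinfun = q o\<^sub>L (scaleC_op d0 id_blinfun + Q)"
  proof -
    have "q \<in> bounded_ops" unfolding q_def by (rule op_inv_bounded_ops[OF N(1)])
    then have "(q o\<^sub>L scaleC_op d0 id_blinfun) - (q o\<^sub>L scaleC_op d0 T) = scaleC_op d0 (q o\<^sub>L (id_blinfun - T))"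
      by (simp add: comp_scaleC_right scaleC_op_diff_right comp_diff_right)
    also have "\<dots> = scaleC_op d0 id_blinfun" using op_inv(2)[OF N(1)] by (simp add: q_def)
    finally show ?thesis by (simp add: comp_add_right algebra_simps)
  qed
  ultimately show ?thesis by (simp add: a_def Q_def q_def)
qed

lemma free_holomorphic_lin_frac:
  fixes M :: "'n::finite ext_matrix"
  assumes M: "J_unitary M"
  shows "free_holomorphic (\<lambda>X :: ('h::complex_hilbert_space, 'n) op_tuple. lin_frac M X $ j)"
proof -
  define c where "c i = - (M $ Some i $ None) / (M $ None $ None)" for i
  define d0 where "d0 = M $ None $ Some j / M $ None $ None"
  define d where "d i = M $ Some i $ Some j / M $ None $ None" for i
  have "(\<lambda>k. free_poly (geometric_coeff c d0 d) k X) sums (lin_frac M X $ j)"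
    if X: "X \<in> op_ball" for X :: "('h, 'n) op_tuple"
  proof -
    note den = denominator_part[OF M X]
    have ib: "op_inv (id_blinfun - denominator_part M X) \<in> bounded_ops"
      by (rule op_inv_bounded_ops[OF Neumann_series(1)[OF den(2,3,5)]])
    have "lin_frac M X $ j = op_inv (id_blinfun - denominator_part M X) o\<^sub>L scaleC_op (1 / M $ None $ None) (lin_form M X (Some j))"
      by (simp add: lin_frac_def denominator_invertible(3)[OF M X] comp_scaleC_left comp_scaleC_right[OF ib])
    also have "scaleC_op (1 / M $ None $ None) (lin_form M X (Some j)) = scaleC_op d0 id_blinfun + (\<Sum>i\<in>UNIV. scaleC_op (d i) (X $ i))"
      by (simp add: lin_form_alt scaleC_op_add_right scaleC_op_sum_right scaleC_op_scaleC_op d0_def d_def)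
    finally show ?thesis
      using geometric_coeff_series[OF op_ballD(1)[OF X], of c _ d0 d, OF den(3,5)[unfolded denominator_part_def c_def[symmetric]]]
      by (simp add: denominator_part_def c_def)
  qed
  then show ?thesis unfolding free_holomorphic_def free_poly_def by blast
qed

section \<open>Scalar holomorphic functions on the disc\<close>

lemma Schwarz_bounded:
  fixes w :: "complex \<Rightarrow> complex"
  assumes hol: "w holomorphic_on ball 0 1" and bound: "\<And>z. cmod z < 1 \<Longrightarrow> cmod (w z) \<le> B"
    and w0: "w 0 = 0" and z: "cmod z < 1"
  shows "cmod (w z) \<le> B * cmod z" "cmod (deriv w 0) \<le> B"
proof -
  have B: "0 \<le> B" using order_trans[OF norm_ge_zero bound[of 0]] by simp
  (* The Schwarz lemma wants strict bounds, so B is approached from above. *)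
  have *: "cmod (w z) \<le> B' * cmod z \<and> cmod (deriv w 0) \<le> B'" if B': "B < B'" for B'
  proof -
    define v where "v z = w z / complex_of_real B'" for z
    have vB: "cmod (v y) < 1" if "cmod y < 1" for y
    proof -
      have "cmod (w y) < B'" using bound[OF that] B' by linarith
      then show ?thesis using B B' by (simp add: v_def norm_divide)
    qed
    have B0: "complex_of_real B' \<noteq> 0" using B B' by simp
    have hv: "v holomorphic_on ball 0 1" unfolding v_def by (rule holomorphic_on_divide[OF hol]) (use B0 in auto)
    have dw: "w field_differentiable at 0"
      using hol by (rule holomorphic_on_imp_differentiable_at) auto
    have "deriv v 0 = deriv w 0 / complex_of_real B'"
      unfolding v_def by (rule deriv_cdivide_right[OF dw])
    moreover have v0: "v 0 = 0" by (simp add: v_def w0)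
    have "cmod (v z) \<le> cmod z" "cmod (deriv v 0) \<le> 1"
      by (rule Schwarz_Lemma(1,2)[OF hv v0]; use vB z in blast)+
    ultimately have "cmod (w z) / B' \<le> cmod z" "cmod (deriv w 0) / B' \<le> 1"
      using B B' by (simp_all add: v_def norm_divide)
    then show ?thesis using B B' by (simp add: pos_divide_le_eq mult.commute)
  qed
  have "cmod (w z) \<le> B * cmod z + e" if "0 < e" for e
  proof -
    have "cmod (w z) \<le> (B + e) * cmod z" using *[of "B + e"] that by simp
    also have "\<dots> \<le> B * cmod z + e" using z that by (simp add: distrib_right mult_left_le)
    finally show ?thesis .
  qed
  then show "cmod (w z) \<le> B * cmod z" by (rule field_le_epsilon)
  have "cmod (deriv w 0) \<le> B + e" if "0 < e" for e using *[of "B + e"] that by simp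
  then show "cmod (deriv w 0) \<le> B" by (rule field_le_epsilon)
qed

text \<open>Only the limit at \<open>0\<close> is assumed, not a power series: dividing by \<open>z\<close> keeps the bound \<open>B\<close> by the Schwarz
  lemma, and after \<open>k\<close> divisions the coefficient is the value at \<open>0\<close>.\<close>

lemma bounded_holomorphic_leading_coeff:
  fixes w :: "complex \<Rightarrow> complex"
  assumes "w holomorphic_on ball 0 1" and "\<And>z. cmod z < 1 \<Longrightarrow> cmod (w z) \<le> B"
    and "((\<lambda>z. w z / z ^ k) \<longlongrightarrow> \<beta>) (at 0)"
  shows "cmod \<beta> \<le> B"
  using assms
proof (induction k arbitrary: w)
  case 0
  have ev: "eventually (\<lambda>z. cmod (w z) \<le> B) (at 0)"
    using eventually_at_ball[OF zero_less_one, of 0 UNIV] by eventually_elim (use 0 in auto)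
  show ?case by (rule tendsto_upperbound[OF tendsto_norm[OF 0(3)[simplified]] ev]) simp
next
  case (Suc k)
  have cont: "isCont w 0"
    using holomorphic_on_imp_continuous_on[OF Suc.prems(1)] by (simp add: continuous_on_eq_continuous_at)
  have "((\<lambda>z. w z / z ^ Suc k * z ^ Suc k) \<longlongrightarrow> \<beta> * 0 ^ Suc k) (at 0)"
    by (intro tendsto_intros Suc.prems)
  then have lim: "((\<lambda>z. w z / z ^ Suc k * z ^ Suc k) \<longlongrightarrow> 0) (at 0)" by simp
  have "(w \<longlongrightarrow> 0) (at 0)"
    by (rule Lim_transform_eventually[OF lim]) (auto simp: eventually_at_filter)
  then have w0: "w 0 = 0" using cont LIM_unique unfolding isCont_def by blast
  obtain h where h: "h holomorphic_on ball 0 1" "\<And>z. norm z < 1 \<Longrightarrow> w z = z * h z" "deriv w 0 = h 0"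
    using Schwarz3[OF Suc.prems(1) w0] by metis
  have hB: "cmod (h z) \<le> B" if z: "cmod z < 1" for z
  proof (cases "z = 0")
    case True
    then show ?thesis using Schwarz_bounded(2)[OF Suc.prems(1,2) w0, of 0] h(3) by simp
  next
    case False
    then show ?thesis using Schwarz_bounded(1)[OF Suc.prems(1,2) w0 z] h(2)[OF z] by (simp add: norm_mult)
  qed
  have "((\<lambda>z. h z / z ^ k) \<longlongrightarrow> \<beta>) (at 0)"
  proof (rule Lim_transform_eventually[OF Suc.prems(3)])
    show "eventually (\<lambda>z. w z / z ^ Suc k = h z / z ^ k) (at 0)"
      using eventually_at_ball'[OF zero_less_one, of 0 UNIV] by eventually_elim (auto simp: h(2))
  qed
  with Suc.IH[of h] h(1) hB show ?case by blast
qed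

text \<open>Cauchy's inequality on the circles of radius \<open>r < 1\<close>, in the limit \<open>r \<longlongrightarrow> 1\<close>.\<close>

lemma power_series_coeff_bound:
  fixes c :: "nat \<Rightarrow> complex"
  assumes sums: "\<And>z. cmod z < 1 \<Longrightarrow> (\<lambda>k. c k * z ^ k) sums w z"
    and bound: "\<And>z. cmod z < 1 \<Longrightarrow> cmod (w z) \<le> B"
  shows "cmod (c k) \<le> B"
proof -
  have hol: "w holomorphic_on ball 0 1"
    by (rule power_series_holomorphic[where a=c]) (use sums in auto)
  have "w has_fps_expansion Abs_fps c"
    by (rule has_fps_expansionI, rule eventually_nhds_in_open[of "ball 0 1", THEN eventually_mono])
       (use sums in auto)
  from fps_nth_fps_expansion[OF this, of k] have ck: "(deriv ^^ k) w 0 = fact k * c k" by simp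
  have "cmod (c k) * r ^ k \<le> B" if r: "0 < r" "r < 1" for r
  proof -
    have "cmod ((deriv ^^ k) w 0) \<le> fact k * B / r ^ k"
    proof (rule Cauchy_inequality)
      show "w holomorphic_on ball 0 r" using hol r by (rule_tac holomorphic_on_subset) auto
      show "continuous_on (cball 0 r) w"
        by (rule continuous_on_subset[OF holomorphic_on_imp_continuous_on[OF hol]]) (use r in auto)
    qed (use r bound in auto)
    then show ?thesis unfolding ck using r by (simp add: norm_mult field_simps)
  qed
  then have ev: "eventually (\<lambda>r. cmod (c k) * r ^ k \<le> B) (at_left (1::real))"
    using eventually_at_left_real[of 0 1] by (auto elim: eventually_mono)
  have "((\<lambda>r. cmod (c k) * r ^ k) \<longlongrightarrow> cmod (c k) * 1 ^ k) (at_left (1::real))"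
    by (intro tendsto_intros)
  then show ?thesis using ev by (intro tendsto_upperbound[of "\<lambda>r. cmod (c k) * r ^ k" "cmod (c k)"]) auto
qed

section \<open>Holomorphic operator-valued curves\<close>

inductive op_polynomial :: "(complex \<Rightarrow> ('h::complex_hilbert_space \<Rightarrow>\<^sub>L 'h)) \<Rightarrow> bool" where
  monom: "A \<in> bounded_ops \<Longrightarrow> op_polynomial (\<lambda>z. scaleC_op (z ^ k) A)"
| add: "op_polynomial f \<Longrightarrow> op_polynomial g \<Longrightarrow> op_polynomial (\<lambda>z. f z + g z)"

lemma op_polynomial_comp:
  assumes "op_polynomial f" "op_polynomial g"
  shows "op_polynomial (\<lambda>z. f z o\<^sub>L g z)"
  using assms
proof (induction f rule: op_polynomial.induct)
  case (monom A k)
  from monom(2) show ?case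
  proof (induction g rule: op_polynomial.induct)
    case (monom B j)
    have "op_polynomial (\<lambda>z. scaleC_op (z ^ (k + j)) (A o\<^sub>L B))"
      by (intro op_polynomial.monom bounded_ops_comp monom \<open>A \<in> bounded_ops\<close>)
    then show ?case
      by (simp add: comp_scaleC_left comp_scaleC_right[OF \<open>A \<in> bounded_ops\<close>] scaleC_op_scaleC_op power_add)
  next
    case (add f g)
    then show ?case by (simp only: comp_add_right op_polynomial.add)
  qed
next
  case (add f g)
  then show ?case by (simp add: comp_add_left op_polynomial.add)
qed

lemma op_polynomial_bounded: 
  assumes "op_polynomial f"
  shows "\<exists>B>0. \<forall>z. cmod z \<le> 1 \<longrightarrow> norm (f z) \<le> B"
  using assms
proof (induction rule: op_polynomial.induct)
  case (monom A k)
  have "norm (scaleC_op (z ^ k) A) \<le> norm A + 1" if "cmod z \<le> 1" for z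
  proof -
    have "cmod z ^ k * norm A \<le> 1 * norm A" using that by (intro mult_right_mono power_le_one) auto
    then show ?thesis by (simp add: norm_scaleC_op norm_power)
  qed
  then show ?case by (intro exI[of _ "norm A + 1"]) (auto intro: add_nonneg_pos)
next
  case (add f g)
  then obtain B C where "B > 0" "C > 0" "\<forall>z. cmod z \<le> 1 \<longrightarrow> norm (f z) \<le> B" "\<forall>z. cmod z \<le> 1 \<longrightarrow> norm (g z) \<le> C"
    by blast
  then show ?case by (intro exI[of _ "B + C"]) (auto intro!: norm_triangle_le add_mono)
qed

lemma op_polynomial_continuous: "op_polynomial f \<Longrightarrow> continuous_on S f"
  by (induction rule: op_polynomial.induct)
     (intro continuous_intros bounded_bilinear.continuous_on[OF bounded_bilinear_scaleC_op] | assumption)+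

lemma op_polynomial_holomorphic: "op_polynomial f \<Longrightarrow> (\<lambda>z. cinner (blinfun_apply (f z) h) g) holomorphic_on S"
  by (induction rule: op_polynomial.induct)
     (auto simp: cinner_scaleC_left blinfun.bilinear_simps cinner_add_left intro!: holomorphic_intros)

text \<open>Local uniform limits of operator polynomials are closed under products and under further limits;
  this makes them more convenient than functions that are differentiable in the operator norm.\<close>

definition hol_curve :: "(complex \<Rightarrow> ('h::complex_hilbert_space \<Rightarrow>\<^sub>L 'h)) \<Rightarrow> bool" where
  "hol_curve f \<longleftrightarrow> (\<forall>r<1. \<forall>e>0. \<exists>g. op_polynomial g \<and> (\<forall>z. cmod z \<le> r \<longrightarrow> norm (f z - g z) < e))"

lemma hol_curveD:
  assumes "hol_curve f" "r < 1" "0 < e"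
  obtains g where "op_polynomial g" "\<And>z. cmod z \<le> r \<Longrightarrow> norm (f z - g z) < e"
  using assms unfolding hol_curve_def by blast

lemma hol_curve_polynomial: "op_polynomial f \<Longrightarrow> hol_curve f"
  unfolding hol_curve_def by (intro allI impI exI[of _ f]) auto

lemma hol_curve_const: "A \<in> bounded_ops \<Longrightarrow> hol_curve (\<lambda>z. A)"
  using op_polynomial.monom[of A 0] by (intro hol_curve_polynomial) simp

lemma hol_curve_line: "A \<in> bounded_ops \<Longrightarrow> hol_curve (\<lambda>z. scaleC_op z A)"
  using op_polynomial.monom[of A 1] by (intro hol_curve_polynomial) simp

lemma hol_curve_uniform_limit:
  assumes "\<And>r e. r < 1 \<Longrightarrow> 0 < e \<Longrightarrow> \<exists>g. hol_curve g \<and> (\<forall>z. cmod z \<le> r \<longrightarrow> norm (f z - g z) < e)"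
  shows "hol_curve f"
  unfolding hol_curve_def
proof (intro allI impI)
  fix r e :: real assume r: "r < 1" and e: "0 < e"
  obtain g where g: "hol_curve g" "\<And>z. cmod z \<le> r \<Longrightarrow> norm (f z - g z) < e / 2"
    using assms[OF r, of "e/2"] e by auto
  obtain p where p: "op_polynomial p" "\<And>z. cmod z \<le> r \<Longrightarrow> norm (g z - p z) < e / 2"
    using hol_curveD[OF g(1) r, of "e/2"] e by auto
  have "norm (f z - p z) < e" if "cmod z \<le> r" for z
    using g(2)[OF that] p(2)[OF that] norm_triangle_ineq[of "f z - g z" "g z - p z"] by simp
  then show "\<exists>p. op_polynomial p \<and> (\<forall>z. cmod z \<le> r \<longrightarrow> norm (f z - p z) < e)" using p(1) by blast
qed

lemma hol_curve_add:
  assumes "hol_curve f" "hol_curve g" shows "hol_curve (\<lambda>z. f z + g z)"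
  unfolding hol_curve_def
proof (intro allI impI)
  fix r e :: real assume r: "r < 1" and e: "0 < e"
  obtain p where p: "op_polynomial p" "\<And>z. cmod z \<le> r \<Longrightarrow> norm (f z - p z) < e / 2"
    using hol_curveD[OF assms(1) r, of "e/2"] e by auto
  obtain q where q: "op_polynomial q" "\<And>z. cmod z \<le> r \<Longrightarrow> norm (g z - q z) < e / 2"
    using hol_curveD[OF assms(2) r, of "e/2"] e by auto
  have "norm ((f z + g z) - (p z + q z)) < e" if "cmod z \<le> r" for z
    using p(2)[OF that] q(2)[OF that] norm_triangle_ineq[of "f z - p z" "g z - q z"] by (simp add: algebra_simps)
  then show "\<exists>p. op_polynomial p \<and> (\<forall>z. cmod z \<le> r \<longrightarrow> norm ((f z + g z) - p z) < e)"
    using op_polynomial.add[OF p(1) q(1)] by blast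
qed

lemma hol_curve_bounded:
  assumes "hol_curve f" "r < 1"
  shows "\<exists>B>0. \<forall>z. cmod z \<le> r \<longrightarrow> norm (f z) \<le> B"
proof -
  obtain p where p: "op_polynomial p" "\<And>z. cmod z \<le> r \<Longrightarrow> norm (f z - p z) < 1"
    using hol_curveD[OF assms, of 1] by auto
  obtain B where B: "B > 0" "\<forall>z. cmod z \<le> 1 \<longrightarrow> norm (p z) \<le> B" using op_polynomial_bounded[OF p(1)] by blast
  have "norm (f z) \<le> B + 1" if "cmod z \<le> r" for z
  proof -
    have "cmod z \<le> 1" using that assms(2) by simp
    then show ?thesis using p(2)[OF that] B(2) norm_triangle_ineq[of "f z - p z" "p z"] by fastforce
  qed
  then show ?thesis using B(1) by (intro exI[of _ "B + 1"]) auto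
qed

lemma hol_curve_comp:
  assumes f: "hol_curve f" and g: "hol_curve g" shows "hol_curve (\<lambda>z. f z o\<^sub>L g z)"
  unfolding hol_curve_def
proof (intro allI impI)
  fix r e :: real assume r: "r < 1" and e: "0 < e"
  obtain B where B: "B > 0" "\<And>z. cmod z \<le> r \<Longrightarrow> norm (g z) \<le> B" using hol_curve_bounded[OF g r] by blast
  obtain p where p: "op_polynomial p" "\<And>z. cmod z \<le> r \<Longrightarrow> norm (f z - p z) < e / (2 * B)"
    using hol_curveD[OF f r, of "e / (2 * B)"] e B by auto
  obtain C where C: "C > 0" "\<And>z. cmod z \<le> r \<Longrightarrow> norm (p z) \<le> C" using hol_curve_bounded[OF hol_curve_polynomial[OF p(1)] r] by blast
  obtain q where q: "op_polynomial q" "\<And>z. cmod z \<le> r \<Longrightarrow> norm (g z - q z) < e / (2 * C)"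
    using hol_curveD[OF g r, of "e / (2 * C)"] e C by auto
  have "norm ((f z o\<^sub>L g z) - (p z o\<^sub>L q z)) < e" if z: "cmod z \<le> r" for z
  proof -
    have "(f z o\<^sub>L g z) - (p z o\<^sub>L q z) = ((f z - p z) o\<^sub>L g z) + (p z o\<^sub>L (g z - q z))"
      by (simp add: comp_diff_left comp_diff_right)
    then have "norm ((f z o\<^sub>L g z) - (p z o\<^sub>L q z)) \<le> norm (f z - p z) * norm (g z) + norm (p z) * norm (g z - q z)"
      by (metis norm_triangle_le add_mono norm_blinfun_compose)
    also have "norm (f z - p z) * norm (g z) \<le> e / (2 * B) * B"
      using p(2)[OF z] B e z by (intro mult_mono) auto
    also have "e / (2 * B) * B = e / 2" using B by simp
    also have "norm (p z) * norm (g z - q z) < e / 2"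
    proof -
      have "norm (p z) * norm (g z - q z) \<le> C * norm (g z - q z)" using C z by (intro mult_right_mono) auto
      also have "\<dots> < C * (e / (2 * C))" using q(2)[OF z] C by (intro mult_strict_left_mono) auto
      finally show ?thesis using C by simp
    qed
    finally show ?thesis by simp
  qed
  then show "\<exists>p. op_polynomial p \<and> (\<forall>z. cmod z \<le> r \<longrightarrow> norm ((f z o\<^sub>L g z) - p z) < e)"
    using op_polynomial_comp[OF p(1) q(1)] by blast
qed

lemma hol_curve_scaleC: 
  assumes "hol_curve f" shows "hol_curve (\<lambda>z. scaleC_op c (f z))"
  using hol_curve_comp[OF hol_curve_const assms, of "scaleC_op c id_blinfun"]
  by (simp add: comp_scaleC_left bounded_ops_scaleC)

lemma hol_curve_sum: 
  "(\<And>i. i \<in> S \<Longrightarrow> hol_curve (f i)) \<Longrightarrow> hol_curve (\<lambda>z. \<Sum>i\<in>S. f i z)"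
  by (induction S rule: infinite_finite_induct) (auto intro: hol_curve_add hol_curve_const)

lemma hol_curve_uniform_sequence:
  assumes "hol_curve f" "r < 1"
  obtains g where "\<And>n. op_polynomial (g n)" "uniform_limit (cball 0 r) g f sequentially"
proof -
  have "\<exists>g. op_polynomial g \<and> (\<forall>z. cmod z \<le> r \<longrightarrow> norm (f z - g z) < 1 / real (Suc n))" for n
    using assms unfolding hol_curve_def by auto
  then obtain g where g: "\<And>n. op_polynomial (g n)" "\<And>n z. cmod z \<le> r \<Longrightarrow> norm (f z - g n z) < 1 / real (Suc n)"
    by metis
  have "uniform_limit (cball 0 r) g f sequentially"
  proof (rule uniform_limitI)
    fix e :: real assume "0 < e"
    then obtain N where N: "1 / real (Suc N) < e" using nat_approx_posE by metis
    have "\<forall>z\<in>cball 0 r. dist (g n z) (f z) < e" if "N \<le> n" for n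
    proof
      fix z :: complex assume "z \<in> cball 0 r"
      then have "norm (f z - g n z) < 1 / real (Suc n)" by (intro g(2)) simp
      also have "\<dots> \<le> 1 / real (Suc N)" using that by (simp add: frac_le)
      finally show "dist (g n z) (f z) < e" using N by (simp add: dist_norm norm_minus_commute)
    qed
    then show "\<forall>\<^sub>F n in sequentially. \<forall>z\<in>cball 0 r. dist (g n z) (f z) < e"
      unfolding eventually_sequentially by blast
  qed
  with g(1) show ?thesis by (rule that)
qed

lemma hol_curve_continuous:
  assumes "hol_curve f" "r < 1" shows "continuous_on (cball 0 r) f"
proof -
  obtain g where g: "\<And>n. op_polynomial (g n)" "uniform_limit (cball 0 r) g f sequentially"
    using hol_curve_uniform_sequence[OF assms] by blast
  show ?thesis
    by (rule uniform_limit_theorem[OF _ g(2)]) (auto simp: op_polynomial_continuous[OF g(1)])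
qed

lemma hol_curve_holomorphic:
  assumes f: "hol_curve f"
  shows "(\<lambda>z. cinner (blinfun_apply (f z) h) k) holomorphic_on ball 0 1"
proof -
  have "(\<lambda>z. cinner (blinfun_apply (f z) h) k) holomorphic_on ball 0 r" if r: "r < 1" for r
  proof -
    obtain g where g: "\<And>n. op_polynomial (g n)" "uniform_limit (cball 0 r) g f sequentially"
      using hol_curve_uniform_sequence[OF f r] by blast
    have "uniform_limit (cball 0 r) (\<lambda>n z. cinner (blinfun_apply (g n z) h) k) (\<lambda>z. cinner (blinfun_apply (f z) h) k) sequentially"
    proof (rule uniform_limitI)
      fix e :: real assume e: "0 < e"
      define K where "K = norm h * norm k + 1"
      have K: "0 < K" unfolding K_def by (intro add_nonneg_pos) auto
      have "\<forall>\<^sub>F n in sequentially. \<forall>z\<in>cball 0 r. dist (g n z) (f z) < e / K"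
        using g(2) e K by (auto simp: uniform_limit_iff)
      then show "\<forall>\<^sub>F n in sequentially. \<forall>z\<in>cball 0 r. dist (cinner (blinfun_apply (g n z) h) k) (cinner (blinfun_apply (f z) h) k) < e"
      proof eventually_elim
        case (elim n)
        show ?case
        proof
          fix z :: complex assume z: "z \<in> cball 0 r"
          have "dist (cinner (blinfun_apply (g n z) h) k) (cinner (blinfun_apply (f z) h) k) = cmod (cinner (blinfun_apply (g n z - f z) h) k)"
            by (simp add: dist_norm cinner_diff_left blinfun.bilinear_simps)
          also have "\<dots> \<le> norm (g n z - f z) * norm h * norm k"
            by (rule order_trans[OF cinner_Cauchy_Schwarz]) (intro mult_right_mono norm_blinfun norm_ge_zero)
          also have "\<dots> \<le> norm (g n z - f z) * K" by (simp add: K_def algebra_simps)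
          also have "\<dots> < e" using elim z K by (simp add: dist_norm field_simps)
          finally show "dist (cinner (blinfun_apply (g n z) h) k) (cinner (blinfun_apply (f z) h) k) < e" .
        qed
      qed
    qed
    note lim = this
    have ev: "\<forall>\<^sub>F n in sequentially. continuous_on (cball 0 r) (\<lambda>z. cinner (blinfun_apply (g n z) h) k) \<and>
        (\<lambda>z. cinner (blinfun_apply (g n z) h) k) holomorphic_on ball 0 r"
      by (intro always_eventually allI conjI holomorphic_on_imp_continuous_on op_polynomial_holomorphic g(1))
    show ?thesis
      by (rule holomorphic_uniform_limit[OF ev lim sequentially_bot])
  qed
  then have "(\<lambda>z. cinner (blinfun_apply (f z) h) k) holomorphic_on (\<Union>r\<in>{..<1}. ball 0 r)"
    by (intro holomorphic_on_UN_open) auto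
  moreover have "ball (0::complex) 1 = (\<Union>r\<in>{..<1}. ball 0 r)"
  proof (intro equalityI subsetI)
    fix z :: complex assume "z \<in> ball 0 1"
    then obtain r where "cmod z < r" "r < 1" using dense[of "cmod z" 1] by auto
    then show "z \<in> (\<Union>r\<in>{..<1}. ball 0 r)" by auto
  qed auto
  ultimately show ?thesis by simp
qed

section \<open>Scaling of tuples and Cauchy estimates\<close>

definition scale_tuple :: "complex \<Rightarrow> ('h::complex_hilbert_space, 'n::finite) op_tuple \<Rightarrow> ('h, 'n) op_tuple" where
  "scale_tuple z X = (\<chi> i. scaleC_op z (X $ i))"

lemma scale_tuple_nth [simp]: "scale_tuple z X $ i = scaleC_op z (X $ i)"
  by (simp add: scale_tuple_def)

lemma scale_tuple_scale_tuple: "scale_tuple z (scale_tuple w X) = scale_tuple (z * w) X"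
  by (simp add: vec_eq_iff scaleC_op_scaleC_op)

lemma scale_tuple_one [simp]: "scale_tuple 1 X = X"
  by (simp add: vec_eq_iff)

lemma scale_tuple_zero [simp]: "scale_tuple 0 X = 0" "scale_tuple z 0 = 0"
  by (simp_all add: vec_eq_iff)

lemma scale_tuple_diff: "scale_tuple z (X - Y) = scale_tuple z X - scale_tuple z Y"
  by (simp add: vec_eq_iff scaleC_op_diff_right)

lemma row_norm_scale_tuple: "row_norm (scale_tuple z X) = cmod z * row_norm X"
proof -
  have le: "row_norm (scale_tuple z X) \<le> cmod z * row_norm X" for z and X :: "('a, 'b) op_tuple"
  proof (rule row_norm_leI)
    fix h
    have "(\<Sum>i\<in>UNIV. blinfun_apply (scale_tuple z X $ i) (h $ i)) = scaleC z (\<Sum>i\<in>UNIV. blinfun_apply (X $ i) (h $ i))"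
      by (simp add: scaleC_sum_right)
    then show "norm (\<Sum>i\<in>UNIV. blinfun_apply (scale_tuple z X $ i) (h $ i)) \<le> cmod z * row_norm X * norm h"
      using norm_row_op_apply[of X h] by (simp add: norm_scaleC mult_left_mono mult.assoc)
  qed simp
  show ?thesis
  proof (cases "z = 0")
    case False
    have "row_norm X = row_norm (scale_tuple (1 / z) (scale_tuple z X))"
      using False by (simp add: scale_tuple_scale_tuple)
    also have "\<dots> \<le> cmod (1 / z) * row_norm (scale_tuple z X)" by (rule le)
    finally have "cmod z * row_norm X \<le> row_norm (scale_tuple z X)"
      using False by (simp add: norm_divide field_simps)
    then show ?thesis using le[of z X] by simp
  qed simp
qed

lemma scale_tuple_bounded_ops: "(\<And>i. X $ i \<in> bounded_ops) \<Longrightarrow> scale_tuple z X $ i \<in> bounded_ops"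
  by (simp add: bounded_ops_scaleC)

lemma scale_tuple_in_op_ball: "X \<in> op_ball \<Longrightarrow> cmod z \<le> 1 \<Longrightarrow> scale_tuple z X \<in> op_ball"
  using mult_right_mono[of "cmod z" 1 "row_norm X"]
  by (auto simp: op_ball_iff scale_tuple_bounded_ops row_norm_scale_tuple simp del: scale_tuple_nth)

lemma word_op_scale:
  assumes X: "\<And>i. X $ i \<in> bounded_ops"
  shows "word_op (scale_tuple z X) \<alpha> = scaleC_op (z ^ length \<alpha>) (word_op X \<alpha>)"
  by (induction \<alpha>) (auto simp: comp_scaleC_left comp_scaleC_right[OF X] scaleC_op_scaleC_op)

lemma free_poly_scale:
  assumes X: "\<And>i. X $ i \<in> bounded_ops"
  shows "free_poly a k (scale_tuple z X) = scaleC_op (z ^ k) (free_poly a k X)"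
  unfolding free_poly_def scaleC_op_sum_right
  by (rule sum.cong) (auto simp: word_op_scale[OF X] scaleC_op_scaleC_op mult.commute)

lemma free_poly_zero: "0 < k \<Longrightarrow> free_poly a k 0 = 0"
  by (cases k) (simp_all add: free_poly_Suc)

lemma free_poly_tendsto:
  assumes "(Y \<longlongrightarrow> X) F"
  shows "((\<lambda>z. free_poly a k (Y z)) \<longlongrightarrow> free_poly a k X) F"
proof -
  have "((\<lambda>z. word_op (Y z) \<alpha>) \<longlongrightarrow> word_op X \<alpha>) F" for \<alpha>
    by (induction \<alpha>) (auto intro!: tendsto_comp tendsto_vec_nth assms)
  then show ?thesis unfolding free_poly_def by (intro tendsto_sum tendsto_scaleC_op tendsto_const)
qed

lemma bounded_linear_cinner_apply:
  "bounded_linear (\<lambda>A :: 'h::complex_hilbert_space \<Rightarrow>\<^sub>L 'h. cinner (blinfun_apply A h) g)"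
proof (rule bounded_linear_intro[where K="norm h * norm g"])
  fix A :: "'h \<Rightarrow>\<^sub>L 'h" and r :: real
  show "norm (cinner (blinfun_apply A h) g) \<le> norm A * (norm h * norm g)"
    using order_trans[OF cinner_Cauchy_Schwarz mult_right_mono[OF norm_blinfun norm_ge_zero]]
    by (simp add: mult.assoc)
  show "cinner (blinfun_apply (r *\<^sub>R A) h) g = r *\<^sub>R cinner (blinfun_apply A h) g"
    by (simp add: blinfun.bilinear_simps scaleR_scaleC cinner_scaleC_left scaleR_conv_of_real)
qed (simp add: blinfun.bilinear_simps cinner_add_left)

text \<open>Along the disc \<open>z \<mapsto> z X\<close> the homogeneous terms are the coefficients of a power series.\<close>

lemma free_poly_Cauchy_estimate:
  fixes X :: "('h::complex_hilbert_space, 'n::finite) op_tuple"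
    and f :: "('h, 'n) op_tuple \<Rightarrow> ('h \<Rightarrow>\<^sub>L 'h)"
  assumes sums: "\<And>X. X \<in> op_ball \<Longrightarrow> (\<lambda>k. free_poly a k X) sums f X"
    and bound: "\<And>X. X \<in> op_ball \<Longrightarrow> norm (f X) \<le> 1" and X: "X \<in> op_ball"
  shows "norm (free_poly a k X) \<le> 1"
proof (rule norm_blinfun_bound)
  fix h
  define g where "g = blinfun_apply (free_poly a k X) h"
  have "cmod (cinner (blinfun_apply (free_poly a k X) h) g) \<le> norm h * norm g"
  proof (rule power_series_coeff_bound)
    fix z :: complex assume z: "cmod z < 1"
    then have zX: "scale_tuple z X \<in> op_ball" by (intro scale_tuple_in_op_ball X) simp
    show "(\<lambda>k. cinner (blinfun_apply (free_poly a k X) h) g * z ^ k) sums cinner (blinfun_apply (f (scale_tuple z X)) h) g"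
      using bounded_linear.sums[OF bounded_linear_cinner_apply sums[OF zX]]
      by (simp add: free_poly_scale[OF op_ballD(1)[OF X]] cinner_scaleC_left mult.commute)
    have "norm (blinfun_apply (f (scale_tuple z X)) h) \<le> 1 * norm h"
      by (rule order_trans[OF norm_blinfun]) (intro mult_right_mono bound zX norm_ge_zero)
    then show "cmod (cinner (blinfun_apply (f (scale_tuple z X)) h) g) \<le> norm h * norm g"
      using cinner_Cauchy_Schwarz order_trans mult_right_mono norm_ge_zero by (metis mult_1)
  qed
  then have "norm g * norm g \<le> norm h * norm g"
    by (simp add: g_def[symmetric] cinner_self norm_power power2_eq_square[symmetric])
  then show "norm (blinfun_apply (free_poly a k X) h) \<le> 1 * norm h"
    by (cases "g = 0") (auto simp: g_def[symmetric])
qed simp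

lemma free_poly_bound:
  fixes X :: "('h::complex_hilbert_space, 'n::finite) op_tuple"
    and f :: "('h, 'n) op_tuple \<Rightarrow> ('h \<Rightarrow>\<^sub>L 'h)"
  assumes sums: "\<And>X. X \<in> op_ball \<Longrightarrow> (\<lambda>k. free_poly a k X) sums f X"
    and bound: "\<And>X. X \<in> op_ball \<Longrightarrow> norm (f X) \<le> 1"
    and X: "\<And>i. X $ i \<in> bounded_ops" "row_norm X < s"
  shows "norm (free_poly a k X) \<le> s ^ k"
proof -
  have s: "0 < s" using X(2) row_norm_nonneg[of X] by linarith
  define Y where "Y = scale_tuple (complex_of_real (1 / s)) X"
  have Y: "Y \<in> op_ball"
    using s X by (auto simp: op_ball_iff Y_def row_norm_scale_tuple bounded_ops_scaleC norm_divide)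
  have "X = scale_tuple (complex_of_real s) Y" using s by (simp add: Y_def scale_tuple_scale_tuple del: of_real_divide flip: of_real_mult)
  then have "norm (free_poly a k X) = s ^ k * norm (free_poly a k Y)"
    using s by (simp add: free_poly_scale[OF op_ballD(1)[OF Y]] norm_scaleC_op norm_power)
  also have "\<dots> \<le> s ^ k * 1" using s by (intro mult_left_mono free_poly_Cauchy_estimate[OF sums bound Y]) auto
  finally show ?thesis by simp
qed

lemma free_poly_tail_bound:
  fixes X :: "('h::complex_hilbert_space, 'n::finite) op_tuple"
    and f :: "('h, 'n) op_tuple \<Rightarrow> ('h \<Rightarrow>\<^sub>L 'h)"
  assumes sums: "\<And>X. X \<in> op_ball \<Longrightarrow> (\<lambda>k. free_poly a k X) sums f X"
    and bound: "\<And>X. X \<in> op_ball \<Longrightarrow> norm (f X) \<le> 1"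
    and X: "X \<in> op_ball" "row_norm X < s" and s: "s < 1"
  shows "norm (f X - (\<Sum>k<m. free_poly a k X)) \<le> s ^ m / (1 - s)"
proof -
  have s0: "0 < s" using X(2) row_norm_nonneg[of X] by linarith
  have b: "norm (free_poly a k X) \<le> s ^ k" for k
    by (rule free_poly_bound[OF sums bound op_ballD(1)[OF X(1)] X(2)])
  have t: "(\<lambda>k. free_poly a (k + m) X) sums (f X - (\<Sum>k<m. free_poly a k X))"
    using sums_split_initial_segment[OF sums[OF X(1)]] by simp
  have g: "(\<lambda>k. s ^ (k + m)) sums (s ^ m / (1 - s))"
    using sums_mult[OF geometric_sums[of s], of "s ^ m"] s s0 by (simp add: power_add mult.commute)
  have "norm (suminf (\<lambda>k. free_poly a (k + m) X)) \<le> suminf (\<lambda>k. s ^ (k + m))"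
    using b by (intro norm_suminf_le sums_summable[OF g]) auto
  then show ?thesis using sums_unique[OF t] sums_unique[OF g] by simp
qed

section \<open>Curves in the ball and the Schwarz lemma\<close>

lemma tendsto_row_norm:
  assumes "(Y \<longlongrightarrow> X) F" shows "((\<lambda>z. row_norm (Y z)) \<longlongrightarrow> row_norm X) F"
  unfolding row_norm_def row_op_def
  by (intro tendsto_norm tendsto_sum tendsto_comp tendsto_const tendsto_vec_nth assms)

definition ball_curve :: "(complex \<Rightarrow> ('h::complex_hilbert_space, 'n::finite) op_tuple) \<Rightarrow> bool" where
  "ball_curve \<gamma> \<longleftrightarrow> (\<forall>i. hol_curve (\<lambda>z. \<gamma> z $ i)) \<and> (\<forall>z. cmod z < 1 \<longrightarrow> \<gamma> z \<in> op_ball)"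

lemma ball_curve_compact_bound:
  assumes \<gamma>: "ball_curve \<gamma>" and r: "r < 1"
  shows "\<exists>s<1. \<forall>z. cmod z \<le> r \<longrightarrow> row_norm (\<gamma> z) < s"
proof (cases "r < 0")
  case True
  then show ?thesis by (intro exI[of _ 0]) (auto dest: order_trans[OF norm_ge_zero])
next
  case False
  have "continuous_on (cball 0 r) (\<lambda>z. row_norm (\<gamma> z))"
    unfolding continuous_on_def
  proof
    fix z :: complex assume z: "z \<in> cball 0 r"
    show "((\<lambda>z. row_norm (\<gamma> z)) \<longlongrightarrow> row_norm (\<gamma> z)) (at z within cball 0 r)"
    proof (intro tendsto_row_norm vec_tendstoI)
      fix i
      show "((\<lambda>z. \<gamma> z $ i) \<longlongrightarrow> \<gamma> z $ i) (at z within cball 0 r)"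
        using hol_curve_continuous[OF _ r, of "\<lambda>z. \<gamma> z $ i"] \<gamma> z by (auto simp: ball_curve_def continuous_on_def)
    qed
  qed
  from continuous_attains_sup[OF _ _ this] False obtain z0 where
    z0: "cmod z0 \<le> r" "\<And>z. cmod z \<le> r \<Longrightarrow> row_norm (\<gamma> z) \<le> row_norm (\<gamma> z0)" by auto
  have "row_norm (\<gamma> z0) < 1" using \<gamma> z0(1) r by (auto simp: ball_curve_def intro: op_ballD)
  then obtain s where "row_norm (\<gamma> z0) < s" "s < 1" using dense by blast
  then show ?thesis using z0(2) by (intro exI[of _ s]) force
qed

lemma hol_curve_free_poly:
  assumes "\<And>i. hol_curve (\<lambda>z. \<gamma> z $ i)"
  shows "hol_curve (\<lambda>z. free_poly a k (\<gamma> z))"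
proof -
  have "hol_curve (\<lambda>z. word_op (\<gamma> z) \<alpha>)" for \<alpha>
    by (induction \<alpha>) (auto intro: hol_curve_comp hol_curve_const assms)
  then show ?thesis unfolding free_poly_def by (intro hol_curve_sum hol_curve_scaleC)
qed

text \<open>The Cauchy estimates make the series of homogeneous terms converge uniformly on every smaller ball.\<close>

lemma hol_curve_free_holomorphic:
  assumes f: "free_holomorphic f" and bound: "\<And>X. X \<in> op_ball \<Longrightarrow> norm (f X) \<le> 1" and \<gamma>: "ball_curve \<gamma>"
  shows "hol_curve (\<lambda>z. f (\<gamma> z))"
proof -
  obtain a where sums: "\<And>X. X \<in> op_ball \<Longrightarrow> (\<lambda>k. free_poly a k X) sums f X"
    using free_holomorphicE[OF f] by blast
  show ?thesis
  proof (rule hol_curve_uniform_limit)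
    fix r e :: real assume r: "r < 1" and e: "0 < e"
    obtain s0 where s0: "s0 < 1" "\<And>z. cmod z \<le> r \<Longrightarrow> row_norm (\<gamma> z) < s0"
      using ball_curve_compact_bound[OF \<gamma> r] by blast
    define s where "s = max s0 0"
    have s: "0 \<le> s" "s < 1" "\<And>z. cmod z \<le> r \<Longrightarrow> row_norm (\<gamma> z) < s"
      using s0 by (auto simp: s_def less_max_iff_disj)
    have "(\<lambda>m. s ^ m / (1 - s)) \<longlonglongrightarrow> 0 / (1 - s)"
      using s by (intro tendsto_intros LIMSEQ_power_zero) auto
    then have "eventually (\<lambda>m. s ^ m / (1 - s) < e) sequentially" using e by (intro order_tendstoD) auto
    then obtain m where m: "s ^ m / (1 - s) < e" by (auto simp: eventually_sequentially)
    have "norm (f (\<gamma> z) - (\<Sum>k<m. free_poly a k (\<gamma> z))) < e" if z: "cmod z \<le> r" for z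
    proof -
      have "\<gamma> z \<in> op_ball" using \<gamma> z r by (auto simp: ball_curve_def)
      from free_poly_tail_bound[OF sums bound this s(3)[OF z] s(2)] show ?thesis
        using m order_le_less_trans by blast
    qed
    moreover have "hol_curve (\<lambda>z. \<Sum>k<m. free_poly a k (\<gamma> z))"
      using \<gamma> by (intro hol_curve_sum hol_curve_free_poly) (auto simp: ball_curve_def)
    ultimately show "\<exists>g. hol_curve g \<and> (\<forall>z. cmod z \<le> r \<longrightarrow> norm (f (\<gamma> z) - g z) < e)" by blast
  qed
qed

text \<open>The coefficients of a free series for a composition are awkward to write down, and over a
  finite-dimensional space the function need not even determine them. Holomorphy of compositions is therefore
  used only in the following form, which is closed under composition by its definition.\<close>

definition preserves_curves :: "(('h::complex_hilbert_space, 'n::finite) op_tuple \<Rightarrow> ('h, 'n) op_tuple) \<Rightarrow> bool" where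
  "preserves_curves f \<longleftrightarrow> (\<forall>\<gamma>. ball_curve \<gamma> \<longrightarrow> ball_curve (\<lambda>z. f (\<gamma> z)))"

lemma preserves_curves_free_holomorphic:
  fixes f :: "('h::complex_hilbert_space, 'n::finite) op_tuple \<Rightarrow> ('h, 'n) op_tuple"
  assumes f: "\<And>i. free_holomorphic (\<lambda>X. f X $ i)" and ball: "\<And>X. X \<in> op_ball \<Longrightarrow> f X \<in> op_ball"
  shows "preserves_curves f"
  unfolding preserves_curves_def
proof (intro allI impI)
  fix \<gamma> :: "complex \<Rightarrow> ('h, 'n) op_tuple" assume \<gamma>: "ball_curve \<gamma>"
  have "hol_curve (\<lambda>z. f (\<gamma> z) $ i)" for i
  proof (rule hol_curve_free_holomorphic[OF f _ \<gamma>])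
    fix X :: "('h, 'n) op_tuple" assume "X \<in> op_ball"
    then show "norm (f X $ i) \<le> 1"
      using row_norm_component[of "f X" i] op_ballD(2)[OF ball] by fastforce
  qed
  then show "ball_curve (\<lambda>z. f (\<gamma> z))" using \<gamma> ball by (auto simp: ball_curve_def)
qed

lemma preserves_curves_comp:
  "preserves_curves f \<Longrightarrow> preserves_curves g \<Longrightarrow> preserves_curves (\<lambda>X. f (g X))"
  by (simp add: preserves_curves_def)

lemma preserves_curves_lin_frac: "J_unitary M \<Longrightarrow> preserves_curves (lin_frac M)"
  by (intro preserves_curves_free_holomorphic free_holomorphic_lin_frac lin_frac_in_op_ball)

lemma ball_curve_line:
  assumes "\<And>i. X $ i \<in> bounded_ops" "row_norm X \<le> 1"
  shows "ball_curve (\<lambda>z. scale_tuple z X)"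
  unfolding ball_curve_def
proof (intro conjI allI impI)
  fix z :: complex assume "cmod z < 1"
  moreover have "cmod z * row_norm X \<le> cmod z * 1" using assms by (intro mult_left_mono) auto
  ultimately show "scale_tuple z X \<in> op_ball" using assms by (auto simp: op_ball_iff bounded_ops_scaleC row_norm_scale_tuple)
qed (auto intro: hol_curve_line assms)

lemma ball_curve_matrix_coeff:
  fixes \<gamma> :: "complex \<Rightarrow> ('h::complex_hilbert_space, 'n::finite) op_tuple"
  assumes \<gamma>: "ball_curve \<gamma>"
  shows "(\<lambda>z. cinner (blinfun_apply (row_op (\<gamma> z)) v) g) holomorphic_on ball 0 1"
    and "cmod z < 1 \<Longrightarrow> cmod (cinner (blinfun_apply (row_op (\<gamma> z)) v) g) \<le> norm v * norm g"
proof -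
  show "(\<lambda>z. cinner (blinfun_apply (row_op (\<gamma> z)) v) g) holomorphic_on ball 0 1"
    unfolding row_op_apply cinner_sum_left
    using \<gamma> by (intro holomorphic_on_sum hol_curve_holomorphic) (auto simp: ball_curve_def)
  assume "cmod z < 1"
  then have "row_norm (\<gamma> z) \<le> 1" using \<gamma> by (auto simp: ball_curve_def intro: less_imp_le op_ballD)
  then have "norm (blinfun_apply (row_op (\<gamma> z)) v) \<le> 1 * norm v"
    unfolding row_norm_def by (intro order_trans[OF norm_blinfun] mult_right_mono) auto
  then show "cmod (cinner (blinfun_apply (row_op (\<gamma> z)) v) g) \<le> norm v * norm g"
    using cinner_Cauchy_Schwarz order_trans mult_right_mono norm_ge_zero by (metis mult_1)
qed

text \<open>The scalar Schwarz lemma, applied to every matrix coefficient of the curve \<open>z \<mapsto> f (z Y)\<close> with \<open>Y\<close> the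
  normalized tuple of \<open>X\<close>.\<close>

lemma Schwarz_row_norm:
  fixes f :: "('h::complex_hilbert_space, 'n::finite) op_tuple \<Rightarrow> ('h, 'n) op_tuple"
  assumes f: "preserves_curves f" and f0: "f 0 = 0" and X: "X \<in> op_ball"
  shows "row_norm (f X) \<le> row_norm X"
proof (cases "X = 0")
  case True
  then show ?thesis by (simp add: f0)
next
  case False
  define s where "s = row_norm X"
  have s: "0 < s" "s < 1"
    using False row_norm_eq_zero_iff[of X] row_norm_nonneg[of X] op_ballD(2)[OF X] by (auto simp: s_def less_le)
  define Y where "Y = scale_tuple (complex_of_real (1 / s)) X"
  have XY: "X = scale_tuple (complex_of_real s) Y"
    using s by (simp add: Y_def scale_tuple_scale_tuple del: of_real_divide flip: of_real_mult)
  have "ball_curve (\<lambda>z. scale_tuple z Y)"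
    using s op_ballD(1)[OF X] by (intro ball_curve_line) (auto simp: Y_def bounded_ops_scaleC row_norm_scale_tuple norm_divide s_def[symmetric])
  then have \<gamma>: "ball_curve (\<lambda>z. f (scale_tuple z Y))" using f by (simp add: preserves_curves_def)
  have "row_norm (f X) \<le> s"
  proof (rule row_norm_leI)
    fix v :: "'h ^ 'n"
    define y where "y = blinfun_apply (row_op (f X)) v"
    have "cmod (cinner (blinfun_apply (row_op (f (scale_tuple (complex_of_real s) Y))) v) y)
      \<le> (norm v * norm y) * cmod (complex_of_real s)"
      by (rule Schwarz_bounded(1)[OF ball_curve_matrix_coeff[OF \<gamma>]]) (use s f0 in auto)
    then have "norm y * norm y \<le> (s * norm v) * norm y"
      using s by (simp add: XY[symmetric] y_def[symmetric] cinner_self norm_power power2_eq_square[symmetric] mult_ac)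
    then have "norm y \<le> s * norm v" by (cases "y = 0") (use s in auto)
    then show "norm (\<Sum>i\<in>UNIV. blinfun_apply (f X $ i) (v $ i)) \<le> s * norm v"
      by (simp add: y_def row_op_apply)
  qed (use s in simp)
  then show ?thesis by (simp add: s_def)
qed

section \<open>Scalar tuples, boosts and unitary matrices\<close>

definition scalar_tuple :: "complex ^ 'n \<Rightarrow> ('h::complex_hilbert_space, 'n::finite) op_tuple" where
  "scalar_tuple x = (\<chi> i. scaleC_op (x $ i) id_blinfun)"

lemma scalar_tuple_nth [simp]: "scalar_tuple x $ i = scaleC_op (x $ i) id_blinfun"
  by (simp add: scalar_tuple_def)

text \<open>The norm is attained on the column \<open>(\<lambda>\<^sub>i u)\<^sub>i\<close> with \<open>\<lambda>\<^sub>i\<close> the conjugate of \<open>x\<^sub>i\<close> and any nonzero vector \<open>u\<close>;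
  on the zero space every tuple has norm \<open>0\<close>.\<close>

lemma row_norm_scalar_tuple:
  fixes x :: "complex ^ 'n::finite"
  assumes nontrivial: "\<exists>u::'h::complex_hilbert_space. u \<noteq> 0"
  shows "row_norm (scalar_tuple x :: ('h, 'n) op_tuple) = norm x"
proof (rule antisym)
  show "row_norm (scalar_tuple x :: ('h, 'n) op_tuple) \<le> norm x"
  proof (rule row_norm_leI)
    fix h :: "'h ^ 'n"
    have "norm (\<Sum>i\<in>UNIV. blinfun_apply (scalar_tuple x $ i) (h $ i)) \<le> (\<Sum>i\<in>UNIV. cmod (x $ i) * norm (h $ i))"
      by (rule sum_norm_le) (simp add: norm_scaleC)
    also have "\<dots> \<le> norm x * norm h"
      unfolding norm_vec_def using L2_set_mult_ineq[of "\<lambda>i. cmod (x $ i)" "\<lambda>i. norm (h $ i)" UNIV] by simp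
    finally show "norm (\<Sum>i\<in>UNIV. blinfun_apply (scalar_tuple x $ i) (h $ i)) \<le> norm x * norm h" .
  qed simp
  obtain u :: 'h where u: "u \<noteq> 0" using nontrivial by blast
  define h :: "'h ^ 'n" where "h = (\<chi> i. scaleC (cnj (x $ i)) u)"
  have "(norm h)\<^sup>2 = (norm x * norm u)\<^sup>2"
    unfolding power_mult_distrib norm_vec_sq h_def by (simp add: norm_scaleC power_mult_distrib sum_distrib_right)
  then have h: "norm h = norm x * norm u" by (simp add: power2_eq_iff_nonneg)
  have "(\<Sum>i\<in>UNIV. blinfun_apply (scalar_tuple x $ i) (h $ i)) = scaleC (complex_of_real ((norm x)\<^sup>2)) u"
    by (simp add: h_def scaleC_scaleC scaleC_sum_left[symmetric] norm_vec_sq complex_norm_square del: of_real_power)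
  then have "(norm x)\<^sup>2 * norm u \<le> row_norm (scalar_tuple x :: ('h, 'n) op_tuple) * (norm x * norm u)"
    using norm_row_op_apply[of "scalar_tuple x" h] by (simp add: norm_scaleC h norm_power)
  then show "norm x \<le> row_norm (scalar_tuple x :: ('h, 'n) op_tuple)"
    using u by (cases "x = 0") (auto simp: power2_eq_square mult_ac)
qed

lemma scalar_tuple_in_op_ball:
  assumes "\<exists>u::'h::complex_hilbert_space. u \<noteq> 0"
  shows "(scalar_tuple x :: ('h, 'n::finite) op_tuple) \<in> op_ball \<longleftrightarrow> norm x < 1"
  by (simp add: op_ball_iff row_norm_scalar_tuple[OF assms] bounded_ops_scaleC)

lemma lin_form_scalar_tuple:
  "lin_form M (scalar_tuple x) b = scaleC_op (M $ None $ b + (\<Sum>i\<in>UNIV. M $ Some i $ b * x $ i)) id_blinfun"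
  by (simp add: lin_form_alt scaleC_op_add_left scaleC_op_sum_left scaleC_op_scaleC_op)

lemma op_inv_scalar: 
  assumes "c \<noteq> 0"
  shows "op_inv (scaleC_op c id_blinfun) = scaleC_op (1 / c) (id_blinfun :: 'h::complex_hilbert_space \<Rightarrow>\<^sub>L 'h)"
  by (rule op_inv_eqI) (use assms in \<open>simp_all add: bounded_ops_scaleC comp_scaleC_left scaleC_op_scaleC_op\<close>)

lemma lin_frac_at_zero:
  assumes "J_unitary M"
  shows "lin_frac M 0 = scalar_tuple (\<chi> j. M $ None $ Some j / M $ None $ None)"
proof -
  have "M $ None $ None \<noteq> 0" using J_unitary_corner_ge_1[OF assms] by auto
  then show ?thesis
    by (simp add: vec_eq_iff lin_frac_def lin_form_alt op_inv_scalar comp_scaleC_left scaleC_op_scaleC_op)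
qed

text \<open>The reflection of row vectors along \<open>w\<close> with respect to the indefinite form.\<close>

definition J_reflection :: "('n::finite option \<Rightarrow> complex) \<Rightarrow> 'n ext_matrix" where
  "J_reflection w = (\<chi> a b. (if a = b then 1 else 0) -
     2 / (\<Sum>c\<in>UNIV. sgnJ c * (w c * cnj (w c))) * (sgnJ a * cnj (w a) * w b))"

lemma J_unitary_reflection:
  fixes w :: "'n::finite option \<Rightarrow> complex"
  assumes q: "(\<Sum>c\<in>UNIV. sgnJ c * (w c * cnj (w c))) \<noteq> 0"
  shows "J_unitary (J_reflection w)"
proof -
  define k where "k = 2 / (\<Sum>c\<in>UNIV. sgnJ c * (w c * cnj (w c)))"
  have kq: "k * (\<Sum>c\<in>UNIV. sgnJ c * (w c * cnj (w c))) = 2" using q by (simp add: k_def)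
  have ck: "cnj k = k" by (simp add: k_def mult_ac)
  have M: "J_reflection w $ a $ b = (if a = b then 1 else 0) - k * (sgnJ a * cnj (w a) * w b)" for a b
    by (simp add: J_reflection_def k_def)
  have "(\<Sum>c\<in>UNIV. sgnJ c * cnj (J_reflection w $ c $ a) * J_reflection w $ c $ b) = (if a = b then sgnJ a else 0)" for a b
  proof -
    have "sgnJ c * cnj (J_reflection w $ c $ a) * J_reflection w $ c $ b =
       (if c = a then if a = b then sgnJ a else 0 else 0) - (if c = a then k * (cnj (w a) * w b) else 0)
       - (if c = b then k * (cnj (w a) * w b) else 0) + k * (cnj (w a) * w b) * (k * (sgnJ c * (w c * cnj (w c))))" for c
      by (cases c; cases a; cases b) (auto simp: M ck algebra_simps)
    then have "(\<Sum>c\<in>UNIV. sgnJ c * cnj (J_reflection w $ c $ a) * J_reflection w $ c $ b) =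
       (if a = b then sgnJ a else 0) - k * (cnj (w a) * w b) - k * (cnj (w a) * w b) + k * (cnj (w a) * w b) * 2"
      by (simp add: sum.distrib sum_subtractf kq flip: sum_distrib_left)
    then show ?thesis by simp
  qed
  then show ?thesis by (simp add: J_unitary_def)
qed

text \<open>A reflection along \<open>w = (\<alpha>, \<mu>)\<close> sends the row \<open>(1, 0)\<close>, the homogeneous coordinates of \<open>0\<close>, to a multiple of
  \<open>(1, \<mu>)\<close> precisely when \<open>\<alpha>\<^sup>2 - 2 \<alpha> + s = 0\<close>, where \<open>s\<close> is the square of the norm of \<open>\<mu>\<close>. The larger root is taken;
  it makes the reflection vector positive for the form.\<close>

lemma ball_transitive:
  fixes \<mu> :: "complex ^ 'n::finite"
  assumes \<mu>: "norm \<mu> < 1"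
  obtains M where "J_unitary M" "lin_frac M 0 = (scalar_tuple \<mu> :: ('h::complex_hilbert_space, 'n) op_tuple)"
proof -
  define s where "s = (norm \<mu>)\<^sup>2"
  define \<alpha> where "\<alpha> = 1 + sqrt (1 - s)"
  define w where "w a = (case a of None \<Rightarrow> complex_of_real \<alpha> | Some j \<Rightarrow> \<mu> $ j)" for a
  have s: "s < 1" using \<mu> by (simp add: s_def power_less_one_iff)
  have "(\<alpha> - 1)\<^sup>2 = 1 - s" using s by (simp add: \<alpha>_def)
  then have \<alpha>: "\<alpha>\<^sup>2 = 2 * \<alpha> - s" by (simp add: power2_eq_square algebra_simps)
  have "0 \<le> sqrt (1 - s)" using s by simp
  then have \<alpha>s: "s < \<alpha>" using s unfolding \<alpha>_def by linarith
  have q: "(\<Sum>c\<in>UNIV. sgnJ c * (w c * cnj (w c))) = complex_of_real (2 * (\<alpha> - s))"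
  proof -
    have "(\<Sum>i\<in>UNIV. \<mu> $ i * cnj (\<mu> $ i)) = complex_of_real s"
      by (simp add: s_def norm_vec_sq complex_norm_square del: of_real_power)
    then have "(\<Sum>c\<in>UNIV. sgnJ c * (w c * cnj (w c))) = complex_of_real (\<alpha>\<^sup>2 - s)"
      by (simp add: sum_option w_def sum_negf power2_eq_square)
    then show ?thesis unfolding \<alpha> by (simp add: algebra_simps)
  qed
  have q0: "(\<Sum>c\<in>UNIV. sgnJ c * (w c * cnj (w c))) \<noteq> 0"
    unfolding q using \<alpha>s by (simp del: of_real_mult of_real_diff)
  have J: "J_unitary (J_reflection w)" by (rule J_unitary_reflection[OF q0])
  have row: "J_reflection w $ None $ b = (if b = None then 1 else 0) - complex_of_real (\<alpha> / (\<alpha> - s)) * w b" for b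
  proof -
    have "complex_of_real (2 / (2 * (\<alpha> - s)) * \<alpha>) = complex_of_real (\<alpha> / (\<alpha> - s))"
      using mult_divide_mult_cancel_left[of 2 \<alpha> "\<alpha> - s"] by simp
    then have eq: "2 / complex_of_real (2 * (\<alpha> - s)) * cnj (w None) = complex_of_real (\<alpha> / (\<alpha> - s))"
      by (simp only: w_def option.case complex_cnj_complex_of_real of_real_mult of_real_divide of_real_numeral)
    have "J_reflection w $ None $ b = (if None = b then 1 else 0) -
        2 / (\<Sum>c\<in>UNIV. sgnJ c * (w c * cnj (w c))) * (cnj (w None) * w b)"
      by (simp only: J_reflection_def vec_lambda_beta sgnJ_simps mult_1)
    also have "\<dots> = (if None = b then 1 else 0) - (2 / complex_of_real (2 * (\<alpha> - s)) * cnj (w None)) * w b"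
      unfolding q by (simp only: mult.assoc)
    also have "\<dots> = (if None = b then 1 else 0) - complex_of_real (\<alpha> / (\<alpha> - s)) * w b"
      by (simp only: eq)
    finally show ?thesis by (cases b) simp_all
  qed
  define \<kappa> where "\<kappa> = \<alpha> / (\<alpha> - s)"
  have "1 - \<kappa> * \<alpha> = - \<kappa>"
    using \<alpha>s \<alpha> by (simp add: \<kappa>_def field_simps power2_eq_square)
  then have "complex_of_real (1 - \<kappa> * \<alpha>) = complex_of_real (- \<kappa>)" by (simp only:)
  then have corner: "J_reflection w $ None $ None = - complex_of_real \<kappa>"
    by (simp add: row[folded \<kappa>_def] w_def)
  have "\<kappa> \<noteq> 0" using J_unitary_corner_ge_1[OF J] by (auto simp: corner)
  moreover have "J_reflection w $ None $ Some j = - complex_of_real \<kappa> * \<mu> $ j" for j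
    by (simp add: row[folded \<kappa>_def] w_def)
  ultimately have "J_reflection w $ None $ Some j / J_reflection w $ None $ None = \<mu> $ j" for j
    by (simp add: corner)
  then have "lin_frac (J_reflection w) 0 = (scalar_tuple \<mu> :: ('h, 'n) op_tuple)"
    unfolding lin_frac_at_zero[OF J] by (intro arg_cong[of _ _ scalar_tuple]) (simp add: vec_eq_iff)
  with J show ?thesis by (rule that)
qed

definition block_unitary :: "complex ^ 'n ^ 'n \<Rightarrow> 'n::finite ext_matrix" where
  "block_unitary U = (\<chi> a b. case a of
      None \<Rightarrow> (case b of None \<Rightarrow> 1 | Some j \<Rightarrow> 0)
    | Some i \<Rightarrow> (case b of None \<Rightarrow> 0 | Some j \<Rightarrow> U $ i $ j))"

lemma cmod_add_sq: "(cmod (a + b))\<^sup>2 = (cmod a)\<^sup>2 + (cmod b)\<^sup>2 + 2 * Re (cnj b * a)"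
  unfolding cmod_power2 by (simp add: power2_eq_square algebra_simps)

text \<open>Polarization: the sum of one row and \<open>c\<close> times another is tested for \<open>c = 1\<close> and \<open>c = \<i>\<close>.\<close>

lemma isometric_rows_orthonormal:
  fixes U :: "complex ^ 'n::finite ^ 'n"
  assumes iso: "\<And>x. norm (\<chi> j. \<Sum>l\<in>UNIV. x $ l * U $ l $ j) = norm x"
  shows "(\<Sum>j\<in>UNIV. U $ l $ j * cnj (U $ k $ j)) = (if l = k then 1 else 0)"
proof -
  have diag: "(\<Sum>j\<in>UNIV. (cmod (U $ l $ j))\<^sup>2) = 1" for l
  proof -
    have "(\<Sum>m\<in>UNIV. axis l 1 $ m * U $ m $ j) = U $ l $ j" for j
      by (subst sum.remove[of _ l]) (auto simp: axis_def intro!: sum.neutral)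
    then show ?thesis
      using iso[of "axis l 1"] norm_vec_sq[of "\<chi> j. U $ l $ j"] by (simp add: norm_axis)
  qed
  show ?thesis
  proof (cases "l = k")
    case True
    then show ?thesis using arg_cong[OF diag[of k], of complex_of_real] by (simp add: complex_norm_square del: of_real_power)
  next
    case False
    define S where "S = (\<Sum>j\<in>UNIV. U $ l $ j * cnj (U $ k $ j))"
    have "Re (cnj c * S) = 0" for c
    proof -
      define x where "x = axis l 1 + axis k c"
      have "(\<Sum>m\<in>UNIV. x $ m * U $ m $ j) = U $ l $ j + c * U $ k $ j" for j
      proof -
        have "(\<Sum>m\<in>UNIV. x $ m * U $ m $ j) = (\<Sum>m\<in>UNIV. if m = l then U $ l $ j else 0) + (\<Sum>m\<in>UNIV. if m = k then c * U $ k $ j else 0)"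
          unfolding sum.distrib[symmetric] by (rule sum.cong) (use False in \<open>auto simp: x_def axis_def\<close>)
        then show ?thesis by simp
      qed
      then have "(\<Sum>j\<in>UNIV. (cmod (U $ l $ j + c * U $ k $ j))\<^sup>2) = (norm x)\<^sup>2"
        using arg_cong[OF iso[of x], of "\<lambda>t. t\<^sup>2"] norm_vec_sq[of "\<chi> j. U $ l $ j + c * U $ k $ j"] by simp
      also have "(norm x)\<^sup>2 = 1 + (cmod c)\<^sup>2"
      proof -
        have "(norm x)\<^sup>2 = (\<Sum>m\<in>UNIV. if m = l then 1 else 0) + (\<Sum>m\<in>UNIV. if m = k then (cmod c)\<^sup>2 else 0)"
          unfolding norm_vec_sq sum.distrib[symmetric] by (rule sum.cong) (use False in \<open>auto simp: x_def axis_def\<close>)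
        then show ?thesis by simp
      qed
      also have "(\<Sum>j\<in>UNIV. (cmod (U $ l $ j + c * U $ k $ j))\<^sup>2)
        = (\<Sum>j\<in>UNIV. (cmod (U $ l $ j))\<^sup>2 + (cmod c)\<^sup>2 * (cmod (U $ k $ j))\<^sup>2 + 2 * Re (cnj c * (U $ l $ j * cnj (U $ k $ j))))"
        by (rule sum.cong) (simp_all only: cmod_add_sq norm_mult power_mult_distrib complex_cnj_mult mult_ac)
      also have "\<dots> = 1 + (cmod c)\<^sup>2 + 2 * Re (cnj c * S)"
      proof -
        have "Re (cnj c * S) = (\<Sum>j\<in>UNIV. Re (cnj c * (U $ l $ j * cnj (U $ k $ j))))"
          unfolding S_def sum_distrib_left by (rule Re_sum)
        then show ?thesis by (simp only: sum.distrib diag sum_distrib_left[symmetric] mult_1_right)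
      qed
      finally show ?thesis by simp
    qed
    from this[of 1] this[of \<i>] have "S = 0" by (simp add: complex_eq_iff)
    then show ?thesis using False by (simp add: S_def)
  qed
qed

lemma block_unitary:
  fixes U :: "complex ^ 'n::finite ^ 'n"
  assumes iso: "\<And>x. norm (\<chi> j. \<Sum>l\<in>UNIV. x $ l * U $ l $ j) = norm x"
  shows "J_unitary (block_unitary U)"
    and "lin_frac (block_unitary U) X = (\<chi> j. \<Sum>l\<in>UNIV. scaleC_op (U $ l $ j) (X $ l))"
proof -
  have b: "block_unitary U $ None $ None = 1" "block_unitary U $ None $ Some j = 0"
    "block_unitary U $ Some i $ None = 0" "block_unitary U $ Some i $ Some j = U $ i $ j" for i j
    by (simp_all add: block_unitary_def)
  define V :: "complex ^ 'n ^ 'n" where "V = (\<chi> j k. cnj (U $ k $ j))"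
  have "U ** V = mat 1"
    by (simp add: vec_eq_iff matrix_matrix_mult_def V_def mat_def isometric_rows_orthonormal[OF iso])
  then have "V ** U = mat 1" by (simp add: matrix_left_right_inverse)
  then have "(V ** U) $ i $ j = (if i = j then 1 else 0)" for i j by (simp add: mat_def)
  then have cols: "(\<Sum>c\<in>UNIV. cnj (U $ c $ i) * U $ c $ j) = (if i = j then 1 else 0)" for i j
    by (simp add: matrix_matrix_mult_def V_def)
  have "(\<Sum>c\<in>UNIV. sgnJ c * cnj (block_unitary U $ c $ a) * block_unitary U $ c $ d) = (if a = d then sgnJ a else 0)" for a d
    by (cases a; cases d) (simp_all add: sum_option b cols sum_negf)
  then show "J_unitary (block_unitary U)" by (simp add: J_unitary_def)
  have "op_inv id_blinfun = (id_blinfun :: 'a \<Rightarrow>\<^sub>L 'a)" by (rule op_inv_eqI) auto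
  then show "lin_frac (block_unitary U) X = (\<chi> j. \<Sum>l\<in>UNIV. scaleC_op (U $ l $ j) (X $ l))"
    by (simp add: lin_frac_def lin_form_alt b)
qed

section \<open>Asymptotic expansions along curves through the centre\<close>

lemma tendsto_tuple_zeroI:
  assumes "((\<lambda>z. row_norm (f z)) \<longlongrightarrow> 0) F"
  shows "(f \<longlongrightarrow> 0) F"
proof (rule vec_tendstoI)
  fix i
  show "((\<lambda>z. f z $ i) \<longlongrightarrow> 0 $ i) F"
    unfolding zero_index by (rule Lim_null_comparison[OF _ assms]) (simp add: row_norm_component)
qed

lemma scale_tuple_tendsto:
  assumes "(c \<longlongrightarrow> d) F" "(f \<longlongrightarrow> X) F"
  shows "((\<lambda>z. scale_tuple (c z) (f z)) \<longlongrightarrow> scale_tuple d X) F"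
  by (rule vec_tendstoI) (simp add: tendsto_scaleC_op tendsto_vec_nth assms)

lemma tendsto_denominator_inverse:
  fixes u :: "complex \<Rightarrow> ('h::complex_hilbert_space, 'n::finite) op_tuple"
  assumes N: "J_unitary N" and u: "(u \<longlongrightarrow> u0) F" "eventually (\<lambda>z. u z \<in> op_ball) F" and u0: "u0 \<in> op_ball"
  shows "((\<lambda>z. op_inv (lin_form N (u z) None)) \<longlongrightarrow> op_inv (lin_form N u0 None)) F"
proof -
  define p where "p z = lin_form N (u z) None" for z
  define p0 where "p0 = lin_form N u0 None"
  note inv0 = op_inv[OF denominator_invertible(1)[OF N u0], folded p0_def]
  have p: "(p \<longlongrightarrow> p0) F"
    unfolding p_def p0_def lin_form_alt
    by (intro tendsto_add tendsto_const tendsto_sum tendsto_scaleC_op tendsto_vec_nth u)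
  have "((\<lambda>z. 2 * cmod (N $ None $ None) * norm (p0 - p z) * norm (op_inv p0)) \<longlongrightarrow> 2 * cmod (N $ None $ None) * norm (p0 - p0) * norm (op_inv p0)) F"
    by (intro tendsto_intros p)
  then have lim: "((\<lambda>z. 2 * cmod (N $ None $ None) * norm (p0 - p z) * norm (op_inv p0)) \<longlongrightarrow> 0) F" by simp
  have ev: "eventually (\<lambda>z. norm (op_inv (p z) - op_inv p0) \<le> 2 * cmod (N $ None $ None) * norm (p0 - p z) * norm (op_inv p0)) F"
    using u(2)
  proof eventually_elim
    case (elim z)
    note inv = op_inv[OF denominator_invertible(1)[OF N elim], folded p_def]
    have "(op_inv (p z) o\<^sub>L (p0 - p z)) o\<^sub>L op_inv p0 = (op_inv (p z) o\<^sub>L (p0 o\<^sub>L op_inv p0)) - ((op_inv (p z) o\<^sub>L p z) o\<^sub>L op_inv p0)"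
      by (simp only: comp_diff_left comp_diff_right comp_assoc)
    then have "(op_inv (p z) o\<^sub>L (p0 - p z)) o\<^sub>L op_inv p0 = op_inv (p z) - op_inv p0"
      by (simp only: inv0 inv comp_id)
    moreover have "norm ((op_inv (p z) o\<^sub>L (p0 - p z)) o\<^sub>L op_inv p0) \<le> norm (op_inv (p z)) * norm (p0 - p z) * norm (op_inv p0)"
      by (rule order_trans[OF norm_blinfun_compose mult_right_mono[OF norm_blinfun_compose norm_ge_zero]])
    ultimately have "norm (op_inv (p z) - op_inv p0) \<le> norm (op_inv (p z)) * norm (p0 - p z) * norm (op_inv p0)"
      by (simp only:)
    also have "\<dots> \<le> 2 * cmod (N $ None $ None) * norm (p0 - p z) * norm (op_inv p0)"
      unfolding p_def by (intro mult_right_mono denominator_invertible(2)[OF N elim] norm_ge_zero)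
    finally show ?case .
  qed
  have "((\<lambda>z. op_inv (p z) - op_inv p0) \<longlongrightarrow> 0) F" by (rule Lim_null_comparison[OF ev lim])
  then show ?thesis unfolding p_def p0_def by (simp add: LIM_zero_iff)
qed

text \<open>The derivative of a linear fractional map at \<open>u0\<close>. Because the value at \<open>v\<close> tends to \<open>0\<close>, the denominator
  contributes to the limit of the difference quotient only through its value at \<open>u0\<close>.\<close>

lemma lin_frac_difference_limit:
  fixes u v :: "complex \<Rightarrow> ('h::complex_hilbert_space, 'n::finite) op_tuple"
  assumes N: "J_unitary N" and u: "(u \<longlongrightarrow> u0) F" and u0: "u0 \<in> op_ball"
    and ball: "eventually (\<lambda>z. u z \<in> op_ball \<and> v z \<in> op_ball) F"
    and v: "((\<lambda>z. lin_frac N (v z)) \<longlongrightarrow> 0) F"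
    and R: "((\<lambda>z. scale_tuple (c z) (u z - v z)) \<longlongrightarrow> R) F"
  shows "((\<lambda>z. scale_tuple (c z) (lin_frac N (u z) - lin_frac N (v z))) \<longlongrightarrow>
     (\<chi> j. op_inv (lin_form N u0 None) o\<^sub>L (\<Sum>i\<in>UNIV. scaleC_op (N $ Some i $ Some j) (R $ i)))) F"
proof (rule vec_tendstoI)
  fix j
  define D where "D z = scale_tuple (c z) (u z - v z)" for z
  define S where "S b z = (\<Sum>i\<in>UNIV. scaleC_op (N $ Some i $ b) (D z $ i))" for b z
  have S: "(S b \<longlongrightarrow> (\<Sum>i\<in>UNIV. scaleC_op (N $ Some i $ b) (R $ i))) F" for b
    unfolding S_def D_def by (intro tendsto_sum tendsto_scaleC_op tendsto_const tendsto_vec_nth R)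
  have W: "((\<lambda>z. lin_frac N (v z) $ j) \<longlongrightarrow> 0) F"
    using tendsto_vec_nth[OF v, of j] by simp
  have lim: "((\<lambda>z. op_inv (lin_form N (u z) None) o\<^sub>L (S (Some j) z - (S None z o\<^sub>L lin_frac N (v z) $ j))) \<longlongrightarrow>
     (op_inv (lin_form N u0 None) o\<^sub>L ((\<Sum>i\<in>UNIV. scaleC_op (N $ Some i $ Some j) (R $ i)) - ((\<Sum>i\<in>UNIV. scaleC_op (N $ Some i $ None) (R $ i)) o\<^sub>L 0)))) F"
    using ball by (intro tendsto_comp tendsto_diff S W tendsto_denominator_inverse[OF N u _ u0]) (auto elim: eventually_mono)
  have "eventually (\<lambda>z. (op_inv (lin_form N (u z) None) o\<^sub>L (S (Some j) z - (S None z o\<^sub>L lin_frac N (v z) $ j)))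
     = scale_tuple (c z) (lin_frac N (u z) - lin_frac N (v z)) $ j) F"
    using ball
  proof eventually_elim
    case (elim z)
    then have uv: "u z \<in> op_ball" "v z \<in> op_ball" by auto
    have Sz: "S b z = scaleC_op (c z) (lin_form N (u z) b - lin_form N (v z) b)" for b
      unfolding S_def D_def lin_form_diff by (simp add: scaleC_op_sum_right scaleC_op_scaleC_op mult.commute)
    have "op_inv (lin_form N (u z) None) \<in> bounded_ops"
      by (rule op_inv_bounded_ops[OF denominator_invertible(1)[OF N uv(1)]])
    then show ?case
      unfolding Sz by (simp add: lin_frac_diff[OF N uv(1) N uv(2)] comp_scaleC_left comp_scaleC_right
          scaleC_op_diff_right[symmetric])
  qed
  from Lim_transform_eventually[OF lim this]
  show "((\<lambda>z. scale_tuple (c z) (lin_frac N (u z) - lin_frac N (v z)) $ j) \<longlongrightarrow>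
     (\<chi> j. op_inv (lin_form N u0 None) o\<^sub>L (\<Sum>i\<in>UNIV. scaleC_op (N $ Some i $ Some j) (R $ i))) $ j) F"
    by simp
qed

text \<open>The \<open>m\<close>-th homogeneous term is the leading term of what remains after removing the lower ones.\<close>

lemma free_poly_leading_term:
  fixes f :: "('h::complex_hilbert_space, 'n::finite) op_tuple \<Rightarrow> ('h \<Rightarrow>\<^sub>L 'h)"
  assumes sums: "\<And>X. X \<in> op_ball \<Longrightarrow> (\<lambda>k. free_poly a k X) sums f X"
    and bound: "\<And>X. X \<in> op_ball \<Longrightarrow> norm (f X) \<le> 1"
    and Y: "\<And>z. cmod z < 1 \<Longrightarrow> Y z \<in> op_ball" "((\<lambda>z. scale_tuple (1 / z) (Y z)) \<longlongrightarrow> X) (at 0)" and X: "X \<in> op_ball"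
  shows "((\<lambda>z. scaleC_op (1 / z ^ m) (f (Y z) - (\<Sum>k<m. free_poly a k (Y z)))) \<longlongrightarrow> free_poly a m X) (at 0)"
proof -
  define E where "E z = f (Y z) - (\<Sum>k<Suc m. free_poly a k (Y z))" for z
  have lim: "((\<lambda>z. free_poly a m (scale_tuple (1 / z) (Y z))) \<longlongrightarrow> free_poly a m X) (at 0)"
    by (rule free_poly_tendsto[OF Y(2)])
  have "((\<lambda>z. row_norm (scale_tuple (1 / z) (Y z))) \<longlongrightarrow> row_norm X) (at 0)"
    by (rule tendsto_row_norm[OF Y(2)])
  then have "eventually (\<lambda>z. row_norm (scale_tuple (1 / z) (Y z)) < 1) (at 0)"
    using op_ballD(2)[OF X] by (rule order_tendstoD)
  moreover have half: "eventually (\<lambda>z. z \<in> ball (0::complex) (1 / 2) \<and> z \<in> UNIV \<and> z \<noteq> 0) (at 0)"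
    using eventually_at_ball'[of "1/2" 0 UNIV] by (auto elim: eventually_mono)
  ultimately have "eventually (\<lambda>z. norm (scaleC_op (1 / z ^ m) (E z)) \<le> 2 * cmod z) (at 0)"
  proof eventually_elim
    case (elim z)
    then have z: "z \<noteq> 0" "0 < cmod z" "cmod z < 1 / 2" and rn: "row_norm (Y z) < cmod z"
      by (auto simp: row_norm_scale_tuple norm_divide field_simps)
    have "norm (E z) \<le> cmod z ^ Suc m / (1 - cmod z)"
      unfolding E_def by (rule free_poly_tail_bound[OF sums bound Y(1) rn]) (use z in auto)
    also have "\<dots> \<le> cmod z ^ Suc m / (1 / 2)" using z by (intro divide_left_mono) auto
    finally have "norm (E z) \<le> 2 * cmod z ^ Suc m" by simp
    then have "norm (E z) / cmod z ^ m \<le> 2 * cmod z ^ Suc m / cmod z ^ m" by (intro divide_right_mono) auto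
    then show ?case using z by (simp add: norm_scaleC_op norm_divide norm_power)
  qed
  moreover have "((\<lambda>z. 2 * cmod z) \<longlongrightarrow> 0) (at (0::complex))" by (auto intro!: tendsto_eq_intros)
  ultimately have "((\<lambda>z. scaleC_op (1 / z ^ m) (E z)) \<longlongrightarrow> 0) (at 0)" by (rule Lim_null_comparison)
  from tendsto_add[OF this lim]
  have lim': "((\<lambda>z. scaleC_op (1 / z ^ m) (E z) + free_poly a m (scale_tuple (1 / z) (Y z))) \<longlongrightarrow> free_poly a m X) (at 0)"
    by simp
  show ?thesis
  proof (rule Lim_transform_eventually[OF lim'])
    show "eventually (\<lambda>z. scaleC_op (1 / z ^ m) (E z) + free_poly a m (scale_tuple (1 / z) (Y z)) = 
       scaleC_op (1 / z ^ m) (f (Y z) - (\<Sum>k<m. free_poly a k (Y z)))) (at 0)"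
      using half
    proof eventually_elim
      case (elim z)
      then have "Y z \<in> op_ball" by (intro Y(1)) auto
      then have "free_poly a m (scale_tuple (1 / z) (Y z)) = scaleC_op (1 / z ^ m) (free_poly a m (Y z))"
        by (simp add: free_poly_scale op_ballD power_one_over)
      then show ?case by (simp add: E_def scaleC_op_add_right[symmetric])
    qed
  qed
qed

lemma eventually_in_ball_at_0: "(\<And>z. cmod z < 1 \<Longrightarrow> P z) \<Longrightarrow> eventually P (at (0::complex))"
  using eventually_at_ball[OF zero_less_one, of 0 UNIV] by (auto elim: eventually_mono)

lemma scale_tuple_lower_limit:
  assumes "((\<lambda>z. scale_tuple (1 / z ^ m) (D z)) \<longlongrightarrow> R) (at 0)" "k < m"
  shows "((\<lambda>z. scale_tuple (1 / z ^ k) (D z)) \<longlongrightarrow> 0) (at 0)"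
proof -
  have "((\<lambda>z. scale_tuple (z ^ (m - k)) (scale_tuple (1 / z ^ m) (D z))) \<longlongrightarrow> scale_tuple (0 ^ (m - k)) R) (at 0)"
    by (intro scale_tuple_tendsto tendsto_intros assms)
  then have lim: "((\<lambda>z. scale_tuple (z ^ (m - k)) (scale_tuple (1 / z ^ m) (D z))) \<longlongrightarrow> 0) (at 0)"
    using assms(2) by (simp add: power_0_left)
  show ?thesis
  proof (rule Lim_transform_eventually[OF lim])
    have "z ^ (m - k) * (1 / z ^ m) = 1 / z ^ k" if "z \<noteq> 0" for z :: complex
    proof -
      have "z ^ m = z ^ (m - k) * z ^ k" using assms(2) by (simp add: power_add[symmetric])
      then show ?thesis using that by simp
    qed
    then show "eventually (\<lambda>z. scale_tuple (z ^ (m - k)) (scale_tuple (1 / z ^ m) (D z)) = scale_tuple (1 / z ^ k) (D z)) (at 0)"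
      by (simp add: eventually_at_filter scale_tuple_scale_tuple)
  qed
qed

lemma lin_frac_Lipschitz_limit:
  fixes u v :: "complex \<Rightarrow> ('h::complex_hilbert_space, 'n::finite) op_tuple"
  assumes M: "J_unitary M" and ball: "eventually (\<lambda>z. u z \<in> op_ball \<and> v z \<in> op_ball) F"
    and lim: "((\<lambda>z. scale_tuple (c z) (u z - v z)) \<longlongrightarrow> 0) F"
  shows "((\<lambda>z. scale_tuple (c z) (lin_frac M (u z) - lin_frac M (v z))) \<longlongrightarrow> 0) F"
proof (rule tendsto_tuple_zeroI)
  obtain L where L: "L > 0" "\<And>X Y :: ('h, 'n) op_tuple. X \<in> op_ball \<Longrightarrow> Y \<in> op_ball \<Longrightarrow>
     row_norm (lin_frac M X - lin_frac M Y) \<le> L * row_norm (X - Y)"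
    using lin_frac_Lipschitz[OF M] by blast
  have "((\<lambda>z. L * row_norm (scale_tuple (c z) (u z - v z))) \<longlongrightarrow> L * row_norm (0 :: ('h, 'n) op_tuple)) F"
    by (intro tendsto_mult tendsto_const tendsto_row_norm lim)
  then have l0: "((\<lambda>z. L * row_norm (scale_tuple (c z) (u z - v z))) \<longlongrightarrow> 0) F" by simp
  show "((\<lambda>z. row_norm (scale_tuple (c z) (lin_frac M (u z) - lin_frac M (v z)))) \<longlongrightarrow> 0) F"
  proof (rule Lim_null_comparison[OF _ l0])
    show "eventually (\<lambda>z. norm (row_norm (scale_tuple (c z) (lin_frac M (u z) - lin_frac M (v z)))) \<le> L * row_norm (scale_tuple (c z) (u z - v z))) F"
      using ball
    proof eventually_elim
      case (elim z)
      then have "cmod (c z) * row_norm (lin_frac M (u z) - lin_frac M (v z)) \<le> cmod (c z) * (L * row_norm (u z - v z))"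
        by (intro mult_left_mono L(2)) auto
      then show ?case by (simp add: row_norm_scale_tuple mult_ac)
    qed
  qed
qed

section \<open>Free automorphisms are linear fractional\<close>

lemma tendsto_matrix_coeff:
  assumes "(f \<longlongrightarrow> R) F"
  shows "((\<lambda>z. cinner (blinfun_apply (row_op (f z)) v) g) \<longlongrightarrow> cinner (blinfun_apply (row_op R) v) g) F"
  unfolding row_op_apply cinner_sum_left
  by (intro tendsto_sum bounded_linear.tendsto[OF bounded_linear_cinner_apply] tendsto_vec_nth assms)

lemma row_op_scale_tuple: "blinfun_apply (row_op (scale_tuple c X)) v = scaleC c (blinfun_apply (row_op X) v)"
  by (simp add: row_op_apply scaleC_sum_right)

lemma tuple_eq_zeroI:
  assumes "\<And>v g. cinner (blinfun_apply (row_op Q) v) g = 0"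
  shows "Q = 0"
proof -
  have "row_op Q = 0" by (rule blinfun_eqI) (use assms in \<open>metis cinner_eq_zero_iff blinfun.zero_left\<close>)
  then have "row_norm Q = 0" by (simp add: row_norm_def)
  then show ?thesis by (simp add: row_norm_eq_zero_iff)
qed

lemma free_series_at_zero:
  assumes "(\<lambda>k. free_poly a k 0) sums y"
  shows "y = scaleC_op (a []) id_blinfun"
proof -
  have "(\<lambda>k. free_poly a k (0 :: ('a, 'b) op_tuple)) = (\<lambda>k. if k = 0 then scaleC_op (a []) id_blinfun else 0)"
    by (auto simp: free_poly_zero)
  then show ?thesis using assms sums_single[of 0 "\<lambda>_. scaleC_op (a []) id_blinfun"] sums_unique2 by metis
qed

lemma free_holomorphic_coefficients:
  fixes f :: "('h::complex_hilbert_space, 'n::finite) op_tuple \<Rightarrow> ('h, 'n) op_tuple"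
  assumes "\<And>i. free_holomorphic (\<lambda>X. f X $ i)"
  obtains a where "\<And>i X. X \<in> op_ball \<Longrightarrow> (\<lambda>k. free_poly (a i) k X) sums (f X $ i)"
proof -
  have "\<exists>a. \<forall>X\<in>op_ball. (\<lambda>k. free_poly a k X) sums (f X $ i)" for i
    using assms[of i] unfolding free_holomorphic_def free_poly_def .
  then obtain a where "\<forall>i. \<forall>X\<in>op_ball. (\<lambda>k. free_poly (a i) k X) sums (f X $ i)"
    by (metis (mono_tags))
  then show ?thesis by (intro that[of a]) blast
qed

lemma line_div_tendsto: "((\<lambda>z. scale_tuple (1 / z) (scale_tuple z X)) \<longlongrightarrow> X) (at 0)"
  by (rule Lim_transform_eventually[OF tendsto_const]) (simp add: eventually_at_filter scale_tuple_scale_tuple)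

lemma line_in_op_ball: "X \<in> op_ball \<Longrightarrow> cmod z < 1 \<Longrightarrow> scale_tuple z X \<in> op_ball"
  by (rule scale_tuple_in_op_ball) auto

lemma component_norm_le_1: "X \<in> op_ball \<Longrightarrow> norm (X $ i) \<le> 1"
  using row_norm_component[of X i] op_ballD(2)[of X] by linarith

text \<open>Let a self-map of the ball differ from the identity by \<open>z\<^sup>m Q + o(z\<^sup>m)\<close> along every curve of the form
  \<open>z X + o(z)\<close>, with the same \<open>Q\<close> for all of them. As \<open>m \<ge> 2\<close>, it maps such curves to such curves, and its \<open>n\<close>-th
  iterate differs from the identity by \<open>n z\<^sup>m Q + o(z\<^sup>m)\<close>. The iterates are uniformly bounded, so \<open>Q = 0\<close>.\<close>

lemma iteration_forces_zero:
  fixes F :: "('h::complex_hilbert_space, 'n::finite) op_tuple \<Rightarrow> ('h, 'n) op_tuple"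
  assumes F: "preserves_curves F" and X: "X \<in> op_ball" and m: "2 \<le> m"
    and step: "\<And>Y. ball_curve Y \<Longrightarrow> ((\<lambda>z. scale_tuple (1 / z) (Y z)) \<longlongrightarrow> X) (at 0) \<Longrightarrow>
       ((\<lambda>z. scale_tuple (1 / z ^ m) (F (Y z) - Y z)) \<longlongrightarrow> Q) (at 0)"
  shows "Q = 0"
proof -
  define Y where "Y n z = (F ^^ n) (scale_tuple z X)" for n z
  have line: "ball_curve (\<lambda>z. scale_tuple z X)"
    using X by (intro ball_curve_line) (auto simp: op_ball_iff)
  have curve: "ball_curve (Y n)" for n
  proof (induction n)
    case (Suc n)
    then show ?case using F by (simp add: Y_def preserves_curves_def)
  qed (simp add: Y_def line)
  have lim: "((\<lambda>z. scale_tuple (1 / z ^ m) (Y n z - scale_tuple z X)) \<longlongrightarrow> scale_tuple (of_nat n) Q) (at 0)" for n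
  proof (induction n)
    case 0
    then show ?case by (simp add: Y_def)
  next
    case (Suc n)
    have "((\<lambda>z. scale_tuple (1 / z ^ 1) (Y n z - scale_tuple z X)) \<longlongrightarrow> 0) (at 0)"
      using m by (intro scale_tuple_lower_limit[OF Suc]) simp
    from tendsto_add[OF this line_div_tendsto[of X]]
    have "((\<lambda>z. scale_tuple (1 / z) (Y n z)) \<longlongrightarrow> X) (at 0)"
      by (simp add: scale_tuple_diff)
    from tendsto_add[OF step[OF curve this] Suc]
    have "((\<lambda>z. scale_tuple (1 / z ^ m) (Y (Suc n) z - scale_tuple z X)) \<longlongrightarrow> Q + scale_tuple (of_nat n) Q) (at 0)"
      by (simp add: scale_tuple_diff Y_def)
    moreover have "Q + scale_tuple (of_nat n) Q = scale_tuple (of_nat (Suc n)) Q"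
      by (simp add: vec_eq_iff scaleC_op_add_left)
    ultimately show ?case by simp
  qed
  show ?thesis
  proof (rule tuple_eq_zeroI)
    fix v :: "'h ^ 'n" and g
    define q where "q = cinner (blinfun_apply (row_op Q) v) g"
    define B where "B = norm v * norm g + norm v * norm g"
    have "cmod (of_nat n * q) \<le> B" for n
    proof (rule bounded_holomorphic_leading_coeff)
      define w where "w z = cinner (blinfun_apply (row_op (Y n z)) v) g - cinner (blinfun_apply (row_op (scale_tuple z X)) v) g" for z
      show "w holomorphic_on ball 0 1"
        unfolding w_def by (intro holomorphic_on_diff ball_curve_matrix_coeff(1) curve line)
      show "cmod (w z) \<le> B" if "cmod z < 1" for z
        unfolding w_def B_def
        by (intro order_trans[OF norm_triangle_ineq4] add_mono ball_curve_matrix_coeff(2)[OF curve that] ball_curve_matrix_coeff(2)[OF line that])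
      have "((\<lambda>z. cinner (blinfun_apply (row_op (scale_tuple (1 / z ^ m) (Y n z - scale_tuple z X))) v) g) \<longlongrightarrow> of_nat n * q) (at 0)"
        using tendsto_matrix_coeff[OF lim, of n v g] by (simp add: row_op_scale_tuple cinner_scaleC_left q_def)
      moreover have "cinner (blinfun_apply (row_op (scale_tuple (1 / z ^ m) (Y n z - scale_tuple z X))) v) g = w z / z ^ m" for z
        unfolding w_def row_op_scale_tuple row_op_diff by (simp add: cinner_scaleC_left blinfun.bilinear_simps cinner_diff_left row_op_scale_tuple)
      ultimately show "((\<lambda>z. w z / z ^ m) \<longlongrightarrow> of_nat n * q) (at 0)" by simp
    qed
    then have "real n * cmod q \<le> B" for n by (simp add: norm_mult)
    then show "cinner (blinfun_apply (row_op Q) v) g = 0"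
      unfolding q_def[symmetric] using reals_Archimedean3[of "cmod q"] by (metis linorder_not_less zero_less_norm_iff)
  qed
qed

text \<open>The free form of Cartan's uniqueness theorem. If the two maps first differ in their homogeneous terms of
  degree \<open>m\<close>, then the inverse of the linear fractional map composed with \<open>\<phi>\<close> is a self-map of the ball which
  differs from the identity by a nonzero term of degree \<open>m\<close>, and its iterates would be unbounded.\<close>

lemma Cartan_uniqueness:
  fixes \<phi> :: "('h::complex_hilbert_space, 'n::finite) op_tuple \<Rightarrow> ('h, 'n) op_tuple"
  assumes L: "J_unitary L" and hol: "\<And>i. free_holomorphic (\<lambda>X. \<phi> X $ i)"
    and ball: "\<And>X. X \<in> op_ball \<Longrightarrow> \<phi> X \<in> op_ball"
    and zero: "\<phi> 0 = lin_frac L 0"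
    and first: "\<And>X. X \<in> op_ball \<Longrightarrow>
      ((\<lambda>z. scale_tuple (1 / z) (\<phi> (scale_tuple z X) - lin_frac L (scale_tuple z X))) \<longlongrightarrow> 0) (at 0)"
    and X: "X \<in> op_ball"
  shows "\<phi> X = lin_frac L X"
proof -
  obtain a where a: "\<And>i X. X \<in> op_ball \<Longrightarrow> (\<lambda>k. free_poly (a i) k X) sums (\<phi> X $ i)"
    using free_holomorphic_coefficients[OF hol] by blast
  obtain b where b: "\<And>i X. X \<in> (op_ball :: ('h, 'n) op_tuple set) \<Longrightarrow> (\<lambda>k. free_poly (b i) k X) sums (lin_frac L X $ i)"
    using free_holomorphic_coefficients[OF free_holomorphic_lin_frac[OF L]] by blast
  have an: "norm (\<phi> X $ i) \<le> 1" and bn: "norm (lin_frac L X $ i) \<le> 1" if "X \<in> op_ball" for X i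
    using that by (auto intro!: component_norm_le_1 ball lin_frac_in_op_ball L)
  define E where "E m \<longleftrightarrow> (\<forall>X\<in>(op_ball :: ('h, 'n) op_tuple set). \<forall>i. free_poly (a i) m X = free_poly (b i) m X)" for m
  define R where "R m X = (\<chi> i. free_poly (a i) m X - free_poly (b i) m X)" for m and X :: "('h, 'n) op_tuple"
  have diff: "((\<lambda>z. scale_tuple (1 / z ^ m) (\<phi> (Y z) - lin_frac L (Y z))) \<longlongrightarrow> R m X) (at 0)"
    if E: "\<And>k. k < m \<Longrightarrow> E k" and Y: "\<And>z. cmod z < 1 \<Longrightarrow> Y z \<in> op_ball"
      "((\<lambda>z. scale_tuple (1 / z) (Y z)) \<longlongrightarrow> X) (at 0)" and X: "X \<in> op_ball" for m Y X
  proof (rule vec_tendstoI)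
    fix i
    have lim: "((\<lambda>z. scaleC_op (1 / z ^ m) (\<phi> (Y z) $ i - (\<Sum>k<m. free_poly (a i) k (Y z))) -
       scaleC_op (1 / z ^ m) (lin_frac L (Y z) $ i - (\<Sum>k<m. free_poly (b i) k (Y z)))) \<longlongrightarrow> free_poly (a i) m X - free_poly (b i) m X) (at 0)"
      by (rule tendsto_diff[OF free_poly_leading_term[where f = "\<lambda>X. \<phi> X $ i", OF a an Y X]
            free_poly_leading_term[where f = "\<lambda>X. lin_frac L X $ i", OF b bn Y X]])
    show "((\<lambda>z. scale_tuple (1 / z ^ m) (\<phi> (Y z) - lin_frac L (Y z)) $ i) \<longlongrightarrow> R m X $ i) (at 0)"
      unfolding R_def vec_lambda_beta
    proof (rule Lim_transform_eventually[OF lim], rule eventually_in_ball_at_0)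
      fix z :: complex assume "cmod z < 1"
      then have "Y z \<in> op_ball" by (rule Y(1))
      then have "(\<Sum>k<m. free_poly (a i) k (Y z)) = (\<Sum>k<m. free_poly (b i) k (Y z))"
        by (intro sum.cong refl E[unfolded E_def, rule_format]) simp_all
      then show "scaleC_op (1 / z ^ m) (\<phi> (Y z) $ i - (\<Sum>k<m. free_poly (a i) k (Y z))) -
       scaleC_op (1 / z ^ m) (lin_frac L (Y z) $ i - (\<Sum>k<m. free_poly (b i) k (Y z))) =
       scale_tuple (1 / z ^ m) (\<phi> (Y z) - lin_frac L (Y z)) $ i"
        by (simp add: scaleC_op_diff_right)
    qed
  qed
  have concl: "E m" if E: "\<And>k. k < m \<Longrightarrow> E k"
    and lim: "\<And>X. X \<in> op_ball \<Longrightarrow> ((\<lambda>z. scale_tuple (1 / z ^ m) (\<phi> (scale_tuple z X) - lin_frac L (scale_tuple z X))) \<longlongrightarrow> 0) (at 0)" for m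
    unfolding E_def
  proof (intro ballI allI)
    fix X :: "('h, 'n) op_tuple" and i assume X: "X \<in> op_ball"
    have "((\<lambda>z. scale_tuple (1 / z ^ m) (\<phi> (scale_tuple z X) - lin_frac L (scale_tuple z X))) \<longlongrightarrow> R m X) (at 0)"
      by (rule diff[where Y = "\<lambda>z. scale_tuple z X", OF E line_in_op_ball[OF X] line_div_tendsto X])
    from tendsto_unique[OF at_neq_bot this lim[OF X]] have "R m X $ i = 0" by (simp only: zero_index)
    then show "free_poly (a i) m X = free_poly (b i) m X" by (simp only: R_def vec_lambda_beta right_minus_eq)
  qed
  have u0: "\<phi> 0 \<in> op_ball" by (rule ball) simp
  define N where "N = J_inv L"
  have N: "J_unitary N" unfolding N_def by (rule J_unitary_J_inv[OF L])
  define F where "F X = lin_frac N (\<phi> X)" for X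
  have F: "preserves_curves F"
    unfolding F_def
    by (rule preserves_curves_comp[OF preserves_curves_lin_frac[OF N] preserves_curves_free_holomorphic[OF hol ball]])
  have E: "E m" for m
  proof (induction m rule: less_induct)
    case (less m)
    consider "m = 0" | "m = 1" | "2 \<le> m" by linarith
    then show ?case
    proof cases
      case 1
      have "scaleC_op (a i []) id_blinfun = (scaleC_op (b i []) id_blinfun :: 'h \<Rightarrow>\<^sub>L 'h)" for i
        using free_series_at_zero[OF a[of 0 i]] free_series_at_zero[OF b[of 0 i]] by (simp add: zero)
      then show ?thesis by (simp add: E_def 1)
    next
      case 2
      show ?thesis
        by (rule concl[OF less]) (simp_all only: 2 power_one_right first)
    next
      case 3
      show ?thesis
      proof (rule concl[OF less])
        fix X :: "('h, 'n) op_tuple" assume X: "X \<in> op_ball"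
        define Q where "Q = (\<chi> j. op_inv (lin_form N (\<phi> 0) None) o\<^sub>L (\<Sum>i\<in>UNIV. scaleC_op (N $ Some i $ Some j) (R m X $ i)))"
        have step: "((\<lambda>z. scale_tuple (1 / z ^ m) (F (Y z) - Y z)) \<longlongrightarrow> Q) (at 0)"
          if Y: "ball_curve Y" "((\<lambda>z. scale_tuple (1 / z) (Y z)) \<longlongrightarrow> X) (at 0)" for Y
        proof -
          have Yb: "Y z \<in> op_ball" if "cmod z < 1" for z using Y(1) that by (simp add: ball_curve_def)
          have NL: "lin_frac N (lin_frac L (Y z)) = Y z" if "cmod z < 1" for z
            unfolding N_def by (rule lin_frac_J_inv(1)[OF L Yb[OF that]])
          have "((\<lambda>z. \<phi> (Y z)) \<longlongrightarrow> \<phi> 0) (at 0)"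
          proof (rule vec_tendstoI)
            fix i
            have "\<phi> 0 $ i = scaleC_op (a i []) id_blinfun" by (rule free_series_at_zero[OF a]) simp
            then show "((\<lambda>z. \<phi> (Y z) $ i) \<longlongrightarrow> \<phi> 0 $ i) (at 0)"
              using free_poly_leading_term[where f = "\<lambda>X. \<phi> X $ i" and m = 0, OF a an Yb Y(2) X] by simp
          qed
          moreover have "eventually (\<lambda>z. \<phi> (Y z) \<in> op_ball \<and> lin_frac L (Y z) \<in> op_ball) (at 0)"
            by (rule eventually_in_ball_at_0) (auto intro: ball lin_frac_in_op_ball[OF L] Yb)
          moreover have "((\<lambda>z. lin_frac N (lin_frac L (Y z))) \<longlongrightarrow> 0) (at 0)"
          proof (rule Lim_transform_eventually)
            show "(Y \<longlongrightarrow> 0) (at 0)"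
              using scale_tuple_lower_limit[of 1 Y X 0] Y(2) by simp
          qed (rule eventually_in_ball_at_0, simp add: NL)
          ultimately have "((\<lambda>z. scale_tuple (1 / z ^ m) (lin_frac N (\<phi> (Y z)) - lin_frac N (lin_frac L (Y z)))) \<longlongrightarrow> Q) (at 0)"
            unfolding Q_def by (intro lin_frac_difference_limit[OF N _ u0] diff[where Y = Y, OF less Yb Y(2) X])
          then show ?thesis
            by (rule Lim_transform_eventually) (rule eventually_in_ball_at_0, simp add: NL F_def)
        qed
        have "Q = 0" by (rule iteration_forces_zero[OF F X 3 step])
        then have "((\<lambda>z. scale_tuple (1 / z ^ m) (F (scale_tuple z X) - scale_tuple z X)) \<longlongrightarrow> 0) (at 0)"
          using step[OF ball_curve_line line_div_tendsto] X by (auto simp: op_ball_iff)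
        then have "((\<lambda>z. scale_tuple (1 / z ^ m) (lin_frac L (F (scale_tuple z X)) - lin_frac L (scale_tuple z X))) \<longlongrightarrow> 0) (at 0)"
          by (rule lin_frac_Lipschitz_limit[OF L eventually_in_ball_at_0, rotated])
             (auto intro: lin_frac_in_op_ball[OF N] ball line_in_op_ball[OF X] simp: F_def)
        then show "((\<lambda>z. scale_tuple (1 / z ^ m) (\<phi> (scale_tuple z X) - lin_frac L (scale_tuple z X))) \<longlongrightarrow> 0) (at 0)"
          by (rule Lim_transform_eventually)
             (rule eventually_in_ball_at_0, simp add: F_def N_def lin_frac_J_inv(2)[OF L] ball line_in_op_ball[OF X])
      qed
    qed
  qed
  show ?thesis
    unfolding vec_eq_iff
  proof
    fix i
    have "free_poly (a i) k X = free_poly (b i) k X" for k using E X by (simp add: E_def)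
    then have eq: "(\<lambda>k. free_poly (a i) k X) = (\<lambda>k. free_poly (b i) k X)" by blast
    show "\<phi> X $ i = lin_frac L X $ i" by (rule sums_unique2[OF a[OF X, of i, unfolded eq] b[OF X, of i]])
  qed
qed

text \<open>After composition with a linear fractional map the automorphism fixes \<open>0\<close>. The Schwarz lemma, applied to it and to its
  inverse, makes its derivative at \<open>0\<close> isometric. The derivative is a free polynomial of degree 1, that is,
  multiplication by a scalar matrix, and isometry on scalar tuples makes this matrix unitary.\<close>

lemma automorphism_is_lin_frac:
  fixes \<phi> \<psi> :: "('h::complex_hilbert_space, 'n::finite) op_tuple \<Rightarrow> ('h, 'n) op_tuple"
  assumes nontrivial: "\<exists>u::'h. u \<noteq> 0"
    and \<phi>: "\<And>i. free_holomorphic (\<lambda>X. \<phi> X $ i)" "\<And>X. X \<in> op_ball \<Longrightarrow> \<phi> X \<in> op_ball"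
    and \<psi>: "\<And>i. free_holomorphic (\<lambda>X. \<psi> X $ i)" "\<And>X. X \<in> op_ball \<Longrightarrow> \<psi> X \<in> op_ball"
    and inv: "\<And>X. X \<in> op_ball \<Longrightarrow> \<psi> (\<phi> X) = X"
  shows "\<exists>M. J_unitary M \<and> (\<forall>X\<in>op_ball. \<phi> X = lin_frac M X)"
proof -
  obtain a where a: "\<And>i X. X \<in> op_ball \<Longrightarrow> (\<lambda>k. free_poly (a i) k X) sums (\<phi> X $ i)"
    using free_holomorphic_coefficients[OF \<phi>(1)] by blast
  have an: "norm (\<phi> X $ i) \<le> 1" if "X \<in> op_ball" for X i
    using that by (auto intro!: component_norm_le_1 \<phi>(2))
  define \<mu> where "\<mu> = (\<chi> i. a i [])"
  have \<phi>0: "\<phi> 0 $ i = scaleC_op (a i []) id_blinfun" for i by (rule free_series_at_zero[OF a]) simp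
  have \<phi>\<mu>: "\<phi> 0 = scalar_tuple \<mu>" by (simp add: vec_eq_iff \<phi>0 \<mu>_def)
  have "(scalar_tuple \<mu> :: ('h, 'n) op_tuple) \<in> op_ball" unfolding \<phi>\<mu>[symmetric] by (rule \<phi>(2)) simp
  then have \<mu>: "norm \<mu> < 1" by (simp add: scalar_tuple_in_op_ball[OF nontrivial])
  obtain M0 where M0: "J_unitary M0" and "lin_frac M0 0 = (scalar_tuple \<mu> :: ('h, 'n) op_tuple)"
    by (rule ball_transitive[OF \<mu>])
  then have M00: "lin_frac M0 0 = \<phi> 0" by (simp add: \<phi>\<mu>)
  define N where "N = J_inv M0"
  have N: "J_unitary N" unfolding N_def by (rule J_unitary_J_inv[OF M0])
  have N\<phi>0: "lin_frac N (\<phi> 0) = 0" unfolding N_def M00[symmetric] by (rule lin_frac_J_inv(1)[OF M0]) simp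
  have \<phi>0b: "\<phi> 0 \<in> op_ball" by (rule \<phi>(2)) simp
  define F where "F X = lin_frac N (\<phi> X)" for X
  define G where "G X = \<psi> (lin_frac M0 X)" for X
  have Fb: "F X \<in> op_ball" if "X \<in> op_ball" for X unfolding F_def by (intro lin_frac_in_op_ball N \<phi>(2) that)
  have MF: "lin_frac M0 (F X) = \<phi> X" if "X \<in> op_ball" for X
    unfolding F_def N_def by (rule lin_frac_J_inv(2)[OF M0 \<phi>(2)[OF that]])
  have GF: "G (F X) = X" if "X \<in> op_ball" for X
    unfolding G_def using MF[OF that] inv[OF that] by simp
  have "preserves_curves F"
    unfolding F_def
    by (rule preserves_curves_comp[OF preserves_curves_lin_frac[OF N] preserves_curves_free_holomorphic[OF \<phi>]])
  moreover have "preserves_curves G"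
    unfolding G_def
    by (rule preserves_curves_comp[OF preserves_curves_free_holomorphic[OF \<psi>] preserves_curves_lin_frac[OF M0]])
  moreover have "F 0 = 0" by (simp add: F_def N\<phi>0)
  moreover have "G 0 = 0" using inv[of 0] by (simp add: G_def M00)
  ultimately have Schwarz: "row_norm (F X) \<le> row_norm X" "row_norm (G X) \<le> row_norm X" if "X \<in> op_ball" for X
    using Schwarz_row_norm that by blast+
  have Fiso: "row_norm (F X) = row_norm X" if "X \<in> op_ball" for X
    using Schwarz(1)[OF that] Schwarz(2)[OF Fb[OF that]] GF[OF that] by simp
  define s where "s = N $ None $ None + (\<Sum>i\<in>UNIV. N $ Some i $ None * \<mu> $ i)"
  have lfs: "lin_form N (\<phi> 0) None = scaleC_op s id_blinfun"
    unfolding \<phi>\<mu> lin_form_scalar_tuple s_def ..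
  have s: "s \<noteq> 0"
  proof
    assume "s = 0"
    then have "(id_blinfun :: 'h \<Rightarrow>\<^sub>L 'h) = 0"
      using op_inv(1)[OF denominator_invertible(1)[OF N \<phi>0b]] lfs by simp
    then show False using nontrivial by (metis blinfun.zero_left blinfun_apply_id_blinfun id_apply)
  qed
  define U :: "complex ^ 'n ^ 'n" where "U = (\<chi> l j. (1 / s) * (\<Sum>i\<in>UNIV. N $ Some i $ Some j * a i [l]))"
  define D where "D X = (\<chi> j. \<Sum>l\<in>UNIV. scaleC_op (U $ l $ j) (X $ l))" for X :: "('h, 'n) op_tuple"
  have lim: "((\<lambda>z. scale_tuple (1 / z) (F (scale_tuple z X))) \<longlongrightarrow> D X) (at 0)" if X: "X \<in> op_ball" for X
  proof -
    define R where "R = (\<chi> i. free_poly (a i) (Suc 0) X)"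
    have lin: "((\<lambda>z. scale_tuple (1 / z) (\<phi> (scale_tuple z X) - \<phi> 0)) \<longlongrightarrow> R) (at 0)"
    proof (rule vec_tendstoI)
      fix i
      show "((\<lambda>z. scale_tuple (1 / z) (\<phi> (scale_tuple z X) - \<phi> 0) $ i) \<longlongrightarrow> R $ i) (at 0)"
        using free_poly_leading_term[where f = "\<lambda>X. \<phi> X $ i" and m = "Suc 0", OF a an line_in_op_ball[OF X] line_div_tendsto X]
        by (simp add: R_def \<phi>0)
    qed
    have "((\<lambda>z. scale_tuple z (scale_tuple (1 / z) (\<phi> (scale_tuple z X) - \<phi> 0)) + \<phi> 0) \<longlongrightarrow> scale_tuple 0 R + \<phi> 0) (at 0)"
      by (intro tendsto_add tendsto_const scale_tuple_tendsto tendsto_ident_at lin)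
    then have "((\<lambda>z. scale_tuple z (scale_tuple (1 / z) (\<phi> (scale_tuple z X) - \<phi> 0)) + \<phi> 0) \<longlongrightarrow> \<phi> 0) (at 0)" by simp
    then have cont: "((\<lambda>z. \<phi> (scale_tuple z X)) \<longlongrightarrow> \<phi> 0) (at 0)"
      by (rule Lim_transform_eventually) (simp add: eventually_at_filter scale_tuple_scale_tuple)
    have "((\<lambda>z. scale_tuple (1 / z) (lin_frac N (\<phi> (scale_tuple z X)) - lin_frac N (\<phi> 0))) \<longlongrightarrow>
      (\<chi> j. op_inv (lin_form N (\<phi> 0) None) o\<^sub>L (\<Sum>i\<in>UNIV. scaleC_op (N $ Some i $ Some j) (R $ i)))) (at 0)"
      by (rule lin_frac_difference_limit[OF N cont \<phi>0b eventually_in_ball_at_0 _ lin])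
         (auto intro: \<phi>(2) line_in_op_ball[OF X] \<phi>0b simp: N\<phi>0)
    also have "(\<chi> j. op_inv (lin_form N (\<phi> 0) None) o\<^sub>L (\<Sum>i\<in>UNIV. scaleC_op (N $ Some i $ Some j) (R $ i))) = D X"
    proof -
      have "op_inv (lin_form N (\<phi> 0) None) o\<^sub>L (\<Sum>i\<in>UNIV. scaleC_op (N $ Some i $ Some j) (R $ i)) = D X $ j" for j
      proof -
        have "op_inv (lin_form N (\<phi> 0) None) o\<^sub>L (\<Sum>i\<in>UNIV. scaleC_op (N $ Some i $ Some j) (R $ i))
          = (\<Sum>i\<in>UNIV. \<Sum>l\<in>UNIV. scaleC_op ((1 / s) * (N $ Some i $ Some j * a i [l])) (X $ l))"
          by (simp add: lfs op_inv_scalar[OF s] comp_scaleC_left R_def free_poly_1 scaleC_op_sum_right scaleC_op_scaleC_op)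
        also have "\<dots> = D X $ j"
          by (subst sum.swap) (simp add: D_def U_def scaleC_op_sum_left sum_distrib_left)
        finally show ?thesis .
      qed
      then show ?thesis by (simp add: vec_eq_iff)
    qed
    finally show ?thesis by (simp add: F_def N\<phi>0)
  qed
  have Diso: "row_norm (D X) = row_norm X" if X: "X \<in> op_ball" for X
  proof -
    have ev: "eventually (\<lambda>z. row_norm X = row_norm (scale_tuple (1 / z) (F (scale_tuple z X)))) (at 0)"
      using eventually_at_ball'[OF zero_less_one, of 0 UNIV]
      by eventually_elim (auto simp: row_norm_scale_tuple Fiso line_in_op_ball[OF X] norm_divide)
    have "((\<lambda>z. row_norm (scale_tuple (1 / z) (F (scale_tuple z X)))) \<longlongrightarrow> row_norm X) (at 0)"
      by (rule Lim_transform_eventually[OF tendsto_const ev])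
    then show ?thesis using tendsto_row_norm[OF lim[OF X]] tendsto_unique trivial_limit_at by blast
  qed
  have Uiso: "norm (\<chi> j. \<Sum>l\<in>UNIV. x $ l * U $ l $ j) = norm x" for x
  proof -
    define c where "c = 1 / (1 + norm x)"
    have c: "0 < c" "c * norm x < 1" by (auto simp: c_def add_pos_nonneg divide_less_eq)
    have "D (scalar_tuple (c *\<^sub>R x)) = scalar_tuple (c *\<^sub>R (\<chi> j. \<Sum>l\<in>UNIV. x $ l * U $ l $ j))"
      by (simp add: D_def vec_eq_iff scaleC_op_scaleC_op scaleC_op_sum_left[symmetric] scaleR_sum_right mult.commute)
    moreover have "(scalar_tuple (c *\<^sub>R x) :: ('h, 'n) op_tuple) \<in> op_ball"
      using c by (simp add: scalar_tuple_in_op_ball[OF nontrivial])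
    ultimately have "norm (c *\<^sub>R (\<chi> j. \<Sum>l\<in>UNIV. x $ l * U $ l $ j)) = norm (c *\<^sub>R x)"
      using Diso by (metis row_norm_scalar_tuple[OF nontrivial])
    then show ?thesis using c by simp
  qed
  define M1 where "M1 = block_unitary U"
  have M1: "J_unitary M1" unfolding M1_def by (rule block_unitary(1)[OF Uiso])
  have M1D: "lin_frac M1 X = D X" for X :: "('h, 'n) op_tuple" unfolding M1_def D_def by (rule block_unitary(2)[OF Uiso])
  define L where "L = M1 ** M0"
  have L: "J_unitary L" unfolding L_def by (rule J_unitary_mult[OF M1 M0])
  have LD: "lin_frac L X = lin_frac M0 (D X)" if "X \<in> op_ball" for X
    unfolding L_def using lin_frac_lin_frac[OF M1 M0 that] by (simp add: M1D)
  have Db: "D X \<in> op_ball" if "X \<in> op_ball" for X using lin_frac_in_op_ball[OF M1 that] by (simp add: M1D)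
  have Dscale: "D (scale_tuple z X) = scale_tuple z (D X)" for z X
    by (simp add: D_def vec_eq_iff scaleC_op_sum_right scaleC_op_scaleC_op mult.commute)
  have "\<phi> X = lin_frac L X" if "X \<in> op_ball" for X
  proof (rule Cartan_uniqueness[OF L \<phi> _ _ that])
    have "D 0 = 0" by (simp add: D_def vec_eq_iff)
    then show "\<phi> 0 = lin_frac L 0" using LD[of 0] M00 by simp
    fix X :: "('h, 'n) op_tuple" assume X: "X \<in> op_ball"
    have "((\<lambda>z. scale_tuple (1 / z) (F (scale_tuple z X)) - scale_tuple (1 / z) (scale_tuple z (D X))) \<longlongrightarrow> D X - D X) (at 0)"
      by (intro tendsto_diff lim[OF X] line_div_tendsto)
    then have "((\<lambda>z. scale_tuple (1 / z) (F (scale_tuple z X) - D (scale_tuple z X))) \<longlongrightarrow> 0) (at 0)"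
      by (simp add: scale_tuple_diff Dscale)
    then have "((\<lambda>z. scale_tuple (1 / z) (lin_frac M0 (F (scale_tuple z X)) - lin_frac M0 (D (scale_tuple z X)))) \<longlongrightarrow> 0) (at 0)"
      by (rule lin_frac_Lipschitz_limit[OF M0 eventually_in_ball_at_0, rotated]) (auto intro: Fb Db line_in_op_ball[OF X])
    then show "((\<lambda>z. scale_tuple (1 / z) (\<phi> (scale_tuple z X) - lin_frac L (scale_tuple z X))) \<longlongrightarrow> 0) (at 0)"
      by (rule Lim_transform_eventually)
         (rule eventually_in_ball_at_0, simp add: MF LD line_in_op_ball[OF X])
  qed
  then show ?thesis using L by blast
qed

section \<open>The automorphism group\<close>

definition lin_frac_aut :: "'n::finite ext_matrix \<Rightarrow> (('h::complex_hilbert_space, 'n) op_tuple \<Rightarrow> ('h, 'n) op_tuple)" where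
  "lin_frac_aut M = restrict (lin_frac M) op_ball"

lemma lin_frac_aut_apply [simp]: "X \<in> op_ball \<Longrightarrow> lin_frac_aut M X = lin_frac M X"
  by (simp add: lin_frac_aut_def)

lemma lin_frac_aut_Bij: "J_unitary M \<Longrightarrow> lin_frac_aut M \<in> Bij op_ball"
  unfolding Bij_def lin_frac_aut_def using bij_betw_lin_frac by (auto simp: bij_betw_restrict_eq)

lemma inv_into_lin_frac_aut:
  assumes "J_unitary M" "X \<in> op_ball"
  shows "inv_into op_ball (lin_frac_aut M) X = lin_frac (J_inv M) X"
proof (rule inv_into_f_eq)
  show "inj_on (lin_frac_aut M) op_ball"
    using lin_frac_aut_Bij[OF assms(1)] by (auto simp: Bij_def bij_betw_def)
qed (use assms in \<open>simp_all add: lin_frac_in_op_ball J_unitary_J_inv lin_frac_J_inv\<close>)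

lemma free_holomorphic_cong: "free_holomorphic f \<Longrightarrow> (\<And>X. X \<in> op_ball \<Longrightarrow> f X = g X) \<Longrightarrow> free_holomorphic g"
  unfolding free_holomorphic_def by metis

lemma lin_frac_aut_in_free_aut: 
  assumes M: "J_unitary M"
  shows "lin_frac_aut M \<in> free_aut"
  unfolding free_aut_def
proof (intro CollectI conjI allI)
  show "lin_frac_aut M \<in> Bij op_ball" by (rule lin_frac_aut_Bij[OF M])
  fix i
  show "free_holomorphic (\<lambda>X. lin_frac_aut M X $ i)"
    by (rule free_holomorphic_cong[OF free_holomorphic_lin_frac[OF M]]) simp
  show "free_holomorphic (\<lambda>X. inv_into op_ball (lin_frac_aut M) X $ i)"
    by (rule free_holomorphic_cong[OF free_holomorphic_lin_frac[OF J_unitary_J_inv[OF M]]])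
       (simp add: inv_into_lin_frac_aut[OF M])
qed

lemma trivial_space_tuples_eq:
  assumes "\<not> (\<exists>u::'h::complex_hilbert_space. u \<noteq> 0)"
  shows "(X :: ('h, 'n::finite) op_tuple) = Y"
proof -
  have "blinfun_apply (X $ i) h = blinfun_apply (Y $ i) h" for i h using assms by metis
  then show ?thesis by (simp add: vec_eq_iff blinfun_eqI)
qed

text \<open>On the zero space all tuples coincide, and the identity matrix already gives every map.\<close>

theorem free_aut_eq: "(free_aut :: (('h::complex_hilbert_space, 'n::finite) op_tuple \<Rightarrow> ('h, 'n) op_tuple) set) = lin_frac_aut ` {M. J_unitary M}"
proof (intro equalityI subsetI)
  fix \<phi> :: "('h, 'n) op_tuple \<Rightarrow> ('h, 'n) op_tuple" assume \<phi>: "\<phi> \<in> free_aut"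
  then have B: "\<phi> \<in> Bij op_ball" by (simp add: free_aut_def)
  have ext: "\<phi> \<in> extensional op_ball" and bij: "bij_betw \<phi> op_ball op_ball" using B by (auto simp: Bij_def)
  have "\<exists>M. J_unitary M \<and> (\<forall>X\<in>op_ball. \<phi> X = lin_frac M X)"
  proof (cases "\<exists>u::'h. u \<noteq> 0")
    case True
    then show ?thesis
      by (rule automorphism_is_lin_frac[where \<psi> = "inv_into op_ball \<phi>"])
         (use \<phi> bij in \<open>auto simp: free_aut_def bij_betw_apply bij_betw_inv_into_left intro: Bij_inv_into_mem\<close>)
  next
    case False
    then show ?thesis using J_unitary_one trivial_space_tuples_eq by metis
  qed
  then obtain M where M: "J_unitary M" "\<And>X. X \<in> op_ball \<Longrightarrow> \<phi> X = lin_frac M X" by blast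
  have "\<phi> = lin_frac_aut M"
    by (rule extensionalityI[OF ext]) (auto simp: M lin_frac_aut_def)
  then show "\<phi> \<in> lin_frac_aut ` {M. J_unitary M}" using M(1) by blast
next
  fix \<phi> :: "('h, 'n) op_tuple \<Rightarrow> ('h, 'n) op_tuple" assume "\<phi> \<in> lin_frac_aut ` {M. J_unitary M}"
  then show "\<phi> \<in> free_aut" using lin_frac_aut_in_free_aut by blast
qed

lemma free_autE:
  assumes "\<phi> \<in> free_aut"
  obtains M where "J_unitary M" "\<phi> = lin_frac_aut M"
  using assms unfolding free_aut_eq by blast

lemma inv_into_free_aut:
  assumes "\<phi> \<in> free_aut" "X \<in> op_ball"
  shows "\<phi> X \<in> op_ball" "inv_into op_ball \<phi> X \<in> op_ball"
    "\<phi> (inv_into op_ball \<phi> X) = X" "inv_into op_ball \<phi> (\<phi> X) = X"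
proof -
  have "bij_betw \<phi> op_ball op_ball" using assms(1) by (simp add: free_aut_def Bij_def)
  then show "\<phi> X \<in> op_ball" "inv_into op_ball \<phi> X \<in> op_ball"
    "\<phi> (inv_into op_ball \<phi> X) = X" "inv_into op_ball \<phi> (\<phi> X) = X"
    using assms(2) by (auto simp: bij_betw_apply bij_betw_inv_into_left bij_betw_inv_into_right
        intro: bij_betw_apply[OF bij_betw_inv_into])
qed

lemma restrict_inv_in_free_aut:
  assumes "\<phi> \<in> free_aut"
  shows "restrict (inv_into op_ball \<phi>) op_ball \<in> free_aut"
proof -
  obtain M where M: "J_unitary M" "\<phi> = lin_frac_aut M" by (rule free_autE[OF assms])
  have "restrict (inv_into op_ball \<phi>) op_ball = lin_frac_aut (J_inv M)"
    unfolding lin_frac_aut_def[of "J_inv M"] M(2) by (rule restrict_ext) (rule inv_into_lin_frac_aut[OF M(1)])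
  then show ?thesis using lin_frac_aut_in_free_aut[OF J_unitary_J_inv[OF M(1)]] by simp
qed

lemma compose_in_free_aut:
  assumes "\<phi> \<in> free_aut" "\<psi> \<in> free_aut"
  shows "compose op_ball \<phi> \<psi> \<in> free_aut"
proof -
  obtain M where M: "J_unitary M" "\<phi> = lin_frac_aut M" by (rule free_autE[OF assms(1)])
  obtain N where N: "J_unitary N" "\<psi> = lin_frac_aut N" by (rule free_autE[OF assms(2)])
  have "compose op_ball \<phi> \<psi> = lin_frac_aut (N ** M)"
    unfolding compose_def lin_frac_aut_def[of "N ** M"] 
    by (rule restrict_ext) (simp add: M N lin_frac_in_op_ball lin_frac_lin_frac)
  then show ?thesis using lin_frac_aut_in_free_aut[OF J_unitary_mult[OF N(1) M(1)]] by simp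
qed

lemma subgroup_free_aut: "subgroup free_aut (BijGroup op_ball)"
proof (rule group.subgroupI[OF group_BijGroup])
  show "free_aut \<subseteq> carrier (BijGroup op_ball)" by (auto simp: BijGroup_def free_aut_def)
  show "free_aut \<noteq> {}" using lin_frac_aut_in_free_aut[OF J_unitary_one] by blast
  fix \<phi> \<psi> :: "('a, 'b) op_tuple \<Rightarrow> ('a, 'b) op_tuple" assume \<phi>: "\<phi> \<in> free_aut"
  then show "inv\<^bsub>BijGroup op_ball\<^esub> \<phi> \<in> free_aut"
    using restrict_inv_in_free_aut[OF \<phi>] by (simp add: inv_BijGroup free_aut_def[THEN eqset_imp_iff])
  assume \<psi>: "\<psi> \<in> free_aut"
  then show "\<phi> \<otimes>\<^bsub>BijGroup op_ball\<^esub> \<psi> \<in> free_aut"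
    using compose_in_free_aut[OF \<phi> \<psi>] \<phi> by (simp add: BijGroup_def free_aut_def[THEN eqset_imp_iff])
qed

lemma Aut_ball_simps:
  shows "carrier Aut_ball = free_aut" and "group Aut_ball"
    and "\<phi> \<in> free_aut \<Longrightarrow> \<psi> \<in> free_aut \<Longrightarrow> \<phi> \<otimes>\<^bsub>Aut_ball\<^esub> \<psi> = compose op_ball \<phi> \<psi>"
    and "\<phi> \<in> free_aut \<Longrightarrow> inv\<^bsub>Aut_ball\<^esub> \<phi> = restrict (inv_into op_ball \<phi>) op_ball"
proof -
  show "carrier Aut_ball = free_aut" by (simp add: Aut_ball_def)
  show "group Aut_ball" unfolding Aut_ball_def
    by (rule subgroup.subgroup_is_group[OF subgroup_free_aut group_BijGroup])
  show "\<phi> \<in> free_aut \<Longrightarrow> \<psi> \<in> free_aut \<Longrightarrow> \<phi> \<otimes>\<^bsub>Aut_ball\<^esub> \<psi> = compose op_ball \<phi> \<psi>"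
    by (simp add: Aut_ball_def BijGroup_def free_aut_def)
  show "inv\<^bsub>Aut_ball\<^esub> \<phi> = restrict (inv_into op_ball \<phi>) op_ball" if "\<phi> \<in> free_aut"
  proof -
    have "\<phi> \<in> Bij op_ball" using that by (simp add: free_aut_def)
    then show ?thesis unfolding Aut_ball_def
      using group.m_inv_consistent[OF group_BijGroup subgroup_free_aut that] by (simp add: inv_BijGroup)
  qed
qed

section \<open>The metric\<close>

definition sup_dist :: "(('h::complex_hilbert_space, 'n::finite) op_tuple \<Rightarrow> ('h, 'n) op_tuple) \<Rightarrow>
   (('h, 'n) op_tuple \<Rightarrow> ('h, 'n) op_tuple) \<Rightarrow> real" where
  "sup_dist \<phi> \<psi> = (SUP X\<in>op_ball. row_norm (\<phi> X - \<psi> X))"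

lemma dist_E_eq: "\<phi> \<in> free_aut \<Longrightarrow> \<psi> \<in> free_aut \<Longrightarrow>
   dist_E \<phi> \<psi> = sup_dist \<phi> \<psi> + row_norm (inv_into op_ball \<phi> 0 - inv_into op_ball \<psi> 0)"
  by (simp add: dist_E_def sup_dist_def)

lemma row_norm_le_sup_dist:
  assumes "\<phi> \<in> free_aut" "\<psi> \<in> free_aut" "X \<in> op_ball"
  shows "row_norm (\<phi> X - \<psi> X) \<le> sup_dist \<phi> \<psi>"
  unfolding sup_dist_def
proof (rule cSUP_upper[OF assms(3)], rule bdd_aboveI2)
  fix Y assume Y: "Y \<in> (op_ball :: ('a, 'b) op_tuple set)"
  have "row_norm (\<phi> Y - \<psi> Y) \<le> row_norm (\<phi> Y - 0) + row_norm (0 - \<psi> Y)" by (rule row_norm_triangle_diff)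
  also have "\<dots> \<le> 1 + 1"
    using op_ballD(2)[OF inv_into_free_aut(1)[OF assms(1) Y]] op_ballD(2)[OF inv_into_free_aut(1)[OF assms(2) Y]]
      row_norm_minus_commute[of 0 "\<psi> Y"] by simp
  finally show "row_norm (\<phi> Y - \<psi> Y) \<le> 1 + 1" .
qed

lemma sup_dist_least: 
  "(\<And>X. X \<in> op_ball \<Longrightarrow> row_norm (\<phi> X - \<psi> X) \<le> s) \<Longrightarrow> sup_dist \<phi> \<psi> \<le> s"
  unfolding sup_dist_def using zero_in_op_ball by (intro cSUP_least) blast+

lemma sup_dist_nonneg: 
  assumes "\<phi> \<in> free_aut" "\<psi> \<in> free_aut" shows "0 \<le> sup_dist \<phi> \<psi>"
  using row_norm_le_sup_dist[OF assms zero_in_op_ball] row_norm_nonneg order_trans by blast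

lemma sup_dist_le_dist_E: "\<phi> \<in> free_aut \<Longrightarrow> \<psi> \<in> free_aut \<Longrightarrow> sup_dist \<phi> \<psi> \<le> dist_E \<phi> \<psi>"
  by (simp add: dist_E_eq)

lemma Metric_space_dist_E:
  "Metric_space (free_aut :: (('h::complex_hilbert_space, 'n::finite) op_tuple \<Rightarrow> ('h, 'n) op_tuple) set) dist_E"
proof
  fix \<phi> \<psi> \<theta> :: "('h, 'n) op_tuple \<Rightarrow> ('h, 'n) op_tuple"
  show "0 \<le> dist_E \<phi> \<psi>"
  proof (cases "\<phi> \<in> free_aut \<and> \<psi> \<in> free_aut")
    case True
    then show ?thesis using sup_dist_nonneg[of \<phi> \<psi>] by (simp add: dist_E_eq)
  qed (auto simp: dist_E_def)
  show "dist_E \<phi> \<psi> = dist_E \<psi> \<phi>"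
    by (simp add: dist_E_def row_norm_minus_commute)
  assume \<phi>: "\<phi> \<in> free_aut" and \<psi>: "\<psi> \<in> free_aut"
  show "dist_E \<phi> \<psi> = 0 \<longleftrightarrow> \<phi> = \<psi>"
  proof
    assume "dist_E \<phi> \<psi> = 0"
    then have "sup_dist \<phi> \<psi> \<le> 0" using sup_dist_le_dist_E[OF \<phi> \<psi>] by simp
    then have eq: "\<phi> X = \<psi> X" if "X \<in> op_ball" for X
    proof -
      have "row_norm (\<phi> X - \<psi> X) = 0"
        using row_norm_le_sup_dist[OF \<phi> \<psi> that] row_norm_nonneg[of "\<phi> X - \<psi> X"] \<open>sup_dist \<phi> \<psi> \<le> 0\<close> by linarith
      then show ?thesis by (simp add: row_norm_eq_zero_iff)
    qed
    show "\<phi> = \<psi>"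
      using \<phi> \<psi> by (intro extensionalityI[of _ op_ball] eq) (auto simp: free_aut_def Bij_def)
  next
    assume "\<phi> = \<psi>"
    then show "dist_E \<phi> \<psi> = 0"
      using sup_dist_nonneg[OF \<psi> \<psi>] sup_dist_least[of \<psi> \<psi> 0] by (simp add: dist_E_eq \<psi>)
  qed
  assume \<theta>: "\<theta> \<in> free_aut"
  have "sup_dist \<phi> \<theta> \<le> sup_dist \<phi> \<psi> + sup_dist \<psi> \<theta>"
  proof (rule sup_dist_least)
    fix X :: "('h, 'n) op_tuple" assume "X \<in> op_ball"
    then show "row_norm (\<phi> X - \<theta> X) \<le> sup_dist \<phi> \<psi> + sup_dist \<psi> \<theta>"
      by (intro order_trans[OF row_norm_triangle_diff[of _ _ "\<psi> X"]] add_mono row_norm_le_sup_dist \<phi> \<psi> \<theta>)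
  qed
  then show "dist_E \<phi> \<theta> \<le> dist_E \<phi> \<psi> + dist_E \<psi> \<theta>"
    using row_norm_triangle_diff[of "inv_into op_ball \<phi> 0" "inv_into op_ball \<theta> 0" "inv_into op_ball \<psi> 0"]
    by (simp add: dist_E_eq \<phi> \<psi> \<theta>)
qed

lemma free_aut_Lipschitz:
  assumes "\<phi> \<in> free_aut"
  obtains L where "L > 0" "\<And>X Y. X \<in> op_ball \<Longrightarrow> Y \<in> op_ball \<Longrightarrow> row_norm (\<phi> X - \<phi> Y) \<le> L * row_norm (X - Y)"
proof -
  obtain M where M: "J_unitary M" "\<phi> = lin_frac_aut M" by (rule free_autE[OF assms])
  obtain L where "L > 0" "\<forall>X\<in>op_ball. \<forall>Y\<in>(op_ball :: ('a, 'b) op_tuple set). row_norm (lin_frac M X - lin_frac M Y) \<le> L * row_norm (X - Y)"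
    using lin_frac_Lipschitz[OF M(1)] by blast
  then show ?thesis by (intro that[of L]) (auto simp: M(2))
qed

text \<open>Writing \<open>X = \<psi> Y\<close>, the two inverses at \<open>X\<close> are the inverse of \<open>\<phi>\<close> at \<open>\<psi> Y\<close> and at \<open>\<phi> Y\<close>; the former
  inverse is a Lipschitz map.\<close>

lemma inverse_deviation:
  assumes \<phi>: "\<phi> \<in> free_aut"
  obtains L where "L > 0" "\<And>\<psi> X. \<psi> \<in> free_aut \<Longrightarrow> X \<in> op_ball \<Longrightarrow>
     row_norm (inv_into op_ball \<phi> X - inv_into op_ball \<psi> X) \<le> L * sup_dist \<phi> \<psi>"
proof -
  obtain L where L: "L > 0" "\<And>X Y. X \<in> op_ball \<Longrightarrow> Y \<in> op_ball \<Longrightarrow>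
     row_norm (restrict (inv_into op_ball \<phi>) op_ball X - restrict (inv_into op_ball \<phi>) op_ball Y) \<le> L * row_norm (X - Y)"
    by (rule free_aut_Lipschitz[OF restrict_inv_in_free_aut[OF \<phi>]]) blast
  have "row_norm (inv_into op_ball \<phi> X - inv_into op_ball \<psi> X) \<le> L * sup_dist \<phi> \<psi>"
    if \<psi>: "\<psi> \<in> free_aut" and X: "X \<in> op_ball" for \<psi> X
  proof -
    define Y where "Y = inv_into op_ball \<psi> X"
    have Y: "Y \<in> op_ball" "\<psi> Y = X" using inv_into_free_aut[OF \<psi> X] by (auto simp: Y_def)
    have \<phi>Y: "\<phi> Y \<in> op_ball" "inv_into op_ball \<phi> (\<phi> Y) = Y" using inv_into_free_aut[OF \<phi> Y(1)] by auto
    have "row_norm (inv_into op_ball \<phi> X - Y) \<le> L * row_norm (X - \<phi> Y)"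
      using L(2)[OF X \<phi>Y(1)] X \<phi>Y by simp
    also have "row_norm (X - \<phi> Y) = row_norm (\<phi> Y - \<psi> Y)" by (simp add: Y row_norm_minus_commute)
    also have "L * row_norm (\<phi> Y - \<psi> Y) \<le> L * sup_dist \<phi> \<psi>"
      using L(1) row_norm_le_sup_dist[OF \<phi> \<psi> Y(1)] by (intro mult_left_mono) auto
    finally show ?thesis by (simp add: Y_def)
  qed
  then show ?thesis using L(1) that by blast
qed

text \<open>The second summand of the metric is a deviation of inverses at \<open>0\<close>; so it does not change the topology,
  and continuity has to be checked for the supremum only.\<close>

lemma dist_E_le_sup_dist:
  assumes \<phi>: "\<phi> \<in> free_aut"
  obtains C where "C > 0" "\<And>\<psi>. \<psi> \<in> free_aut \<Longrightarrow> dist_E \<phi> \<psi> \<le> C * sup_dist \<phi> \<psi>"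
proof -
  obtain L where L: "L > 0" "\<And>\<psi> X. \<psi> \<in> free_aut \<Longrightarrow> X \<in> op_ball \<Longrightarrow>
     row_norm (inv_into op_ball \<phi> X - inv_into op_ball \<psi> X) \<le> L * sup_dist \<phi> \<psi>"
    by (rule inverse_deviation[OF \<phi>]) blast
  have "dist_E \<phi> \<psi> \<le> (1 + L) * sup_dist \<phi> \<psi>" if "\<psi> \<in> free_aut" for \<psi>
    using L(2)[OF that zero_in_op_ball] by (simp add: dist_E_eq \<phi> that distrib_right)
  then show ?thesis using L(1) by (intro that[of "1 + L"]) auto
qed

lemma topspace_Aut_topology: "topspace Aut_topology = free_aut"
  unfolding Aut_topology_def by (rule Metric_space.topspace_mtopology[OF Metric_space_dist_E])

lemma continuous_map_Aut_topologyI: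
  fixes f :: "'a \<Rightarrow> (('h::complex_hilbert_space, 'n::finite) op_tuple \<Rightarrow> ('h, 'n) op_tuple)"
  assumes mem: "\<And>x. x \<in> topspace T \<Longrightarrow> f x \<in> free_aut"
    and near: "\<And>x e. x \<in> topspace T \<Longrightarrow> 0 < e \<Longrightarrow> \<exists>U. openin T U \<and> x \<in> U \<and> (\<forall>y\<in>U. sup_dist (f x) (f y) < e)"
  shows "continuous_map T Aut_topology f"
  unfolding Aut_topology_def Metric_space.continuous_map_to_metric[OF Metric_space_dist_E]
proof (intro ballI allI impI)
  fix x and e :: real assume x: "x \<in> topspace T" and e: "0 < e"
  obtain C where C: "C > 0" "\<And>\<psi>. \<psi> \<in> free_aut \<Longrightarrow> dist_E (f x) \<psi> \<le> C * sup_dist (f x) \<psi>"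
    by (rule dist_E_le_sup_dist[OF mem[OF x]]) blast
  obtain U where U: "openin T U" "x \<in> U" "\<And>y. y \<in> U \<Longrightarrow> sup_dist (f x) (f y) < e / C"
    using near[OF x, of "e / C"] e C(1) by auto
  have "f y \<in> Metric_space.mball free_aut dist_E (f x) e" if "y \<in> U" for y
  proof -
    have fy: "f y \<in> free_aut" using mem that openin_subset[OF U(1)] by blast
    have "dist_E (f x) (f y) \<le> C * sup_dist (f x) (f y)" by (rule C(2)[OF fy])
    also have "\<dots> < C * (e / C)" using U(3)[OF that] C(1) by (intro mult_strict_left_mono)
    finally show ?thesis using mem[OF x] fy C(1) by (simp add: Metric_space.in_mball[OF Metric_space_dist_E])
  qed
  then show "\<exists>U. openin T U \<and> x \<in> U \<and> (\<forall>y\<in>U. f y \<in> Metric_space.mball free_aut dist_E (f x) e)"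
    using U(1,2) by blast
qed

lemma openin_dist_E_ball:
  assumes "\<phi> \<in> free_aut" "0 < e"
  shows "openin Aut_topology {\<psi> \<in> free_aut. dist_E \<phi> \<psi> < e}" "\<phi> \<in> {\<psi> \<in> free_aut. dist_E \<phi> \<psi> < e}"
proof -
  have eq: "{\<psi> \<in> free_aut. dist_E \<phi> \<psi> < e} = Metric_space.mball free_aut dist_E \<phi> e"
    using assms(1) by (auto simp: Metric_space.in_mball[OF Metric_space_dist_E])
  show "openin Aut_topology {\<psi> \<in> free_aut. dist_E \<phi> \<psi> < e}"
    unfolding eq Aut_topology_def by (rule Metric_space.openin_mball[OF Metric_space_dist_E])
  show "\<phi> \<in> {\<psi> \<in> free_aut. dist_E \<phi> \<psi> < e}"
    unfolding eq using assms by (simp add: Metric_space.centre_in_mball_iff[OF Metric_space_dist_E])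
qed

lemma topological_group_Aut:
  "topological_group (Aut_ball :: (('h::complex_hilbert_space, 'n::finite) op_tuple \<Rightarrow> ('h, 'n) op_tuple) monoid) Aut_topology"
  unfolding topological_group_def
proof (intro conjI)
  let ?G = "Aut_ball :: (('h, 'n) op_tuple \<Rightarrow> ('h, 'n) op_tuple) monoid"
  let ?T = "Aut_topology :: (('h, 'n) op_tuple \<Rightarrow> ('h, 'n) op_tuple) topology"
  show "group ?G" by (rule Aut_ball_simps)
  show "topspace ?T = carrier ?G" by (simp add: topspace_Aut_topology Aut_ball_simps)
  show "continuous_map (prod_topology ?T ?T) ?T (\<lambda>(x, y). x \<otimes>\<^bsub>?G\<^esub> y)"
  proof (rule continuous_map_Aut_topologyI)
    fix p assume "p \<in> topspace (prod_topology ?T ?T)"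
    then obtain \<phi> \<psi> where p: "p = (\<phi>, \<psi>)" and \<phi>: "\<phi> \<in> free_aut" and \<psi>: "\<psi> \<in> free_aut"
      by (auto simp: topspace_Aut_topology)
    show "(case p of (x, y) \<Rightarrow> x \<otimes>\<^bsub>?G\<^esub> y) \<in> free_aut"
      by (simp add: p Aut_ball_simps \<phi> \<psi> compose_in_free_aut)
    fix e :: real assume e: "0 < e"
    obtain L where L: "L > 0" "\<And>X Y. X \<in> op_ball \<Longrightarrow> Y \<in> op_ball \<Longrightarrow> row_norm (\<phi> X - \<phi> Y) \<le> L * row_norm (X - Y)"
      by (rule free_aut_Lipschitz[OF \<phi>]) blast
    define d where "d = e / (2 * (L + 1))"
    have d: "0 < d" using e L(1) by (simp add: d_def)
    have "L + 1 \<noteq> 0" using L(1) by simp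
    then have "(L + 1) * d = e / 2" unfolding d_def by (metis nonzero_mult_divide_mult_cancel_left times_divide_eq_right mult.commute)
    then have de: "(L + 1) * d < e" using e by simp
    define U where "U = {\<phi>' \<in> free_aut. dist_E \<phi> \<phi>' < d} \<times> {\<psi>' \<in> free_aut. dist_E \<psi> \<psi>' < d}"
    have "openin (prod_topology ?T ?T) U" "p \<in> U"
      unfolding U_def p using openin_dist_E_ball[OF \<phi> d] openin_dist_E_ball[OF \<psi> d]
      by (auto simp: openin_prod_Times_iff)
    moreover have "sup_dist (case p of (x, y) \<Rightarrow> x \<otimes>\<^bsub>?G\<^esub> y) (case q of (x, y) \<Rightarrow> x \<otimes>\<^bsub>?G\<^esub> y) < e" if qU: "q \<in> U" for q
    proof -
      obtain \<phi>' \<psi>' where q: "q = (\<phi>', \<psi>')" and \<phi>': "\<phi>' \<in> free_aut" "dist_E \<phi> \<phi>' < d"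
        and \<psi>': "\<psi>' \<in> free_aut" "dist_E \<psi> \<psi>' < d"
        using qU by (auto simp: U_def)
      have "sup_dist (compose op_ball \<phi> \<psi>) (compose op_ball \<phi>' \<psi>') \<le> (L + 1) * d"
      proof (rule sup_dist_least)
        fix X :: "('h, 'n) op_tuple" assume X: "X \<in> op_ball"
        have \<psi>X: "\<psi> X \<in> op_ball" "\<psi>' X \<in> op_ball" by (rule inv_into_free_aut(1)[OF _ X]; fact \<psi> \<psi>')+
        have "row_norm (\<phi> (\<psi> X) - \<phi>' (\<psi>' X)) \<le> row_norm (\<phi> (\<psi> X) - \<phi> (\<psi>' X)) + row_norm (\<phi> (\<psi>' X) - \<phi>' (\<psi>' X))"
          by (rule row_norm_triangle_diff)
        also have "row_norm (\<phi> (\<psi> X) - \<phi> (\<psi>' X)) \<le> L * row_norm (\<psi> X - \<psi>' X)" by (rule L(2)[OF \<psi>X])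
        also have "row_norm (\<psi> X - \<psi>' X) \<le> d"
          using row_norm_le_sup_dist[OF \<psi> \<psi>'(1) X] sup_dist_le_dist_E[OF \<psi> \<psi>'(1)] \<psi>'(2) by linarith
        also have "row_norm (\<phi> (\<psi>' X) - \<phi>' (\<psi>' X)) \<le> d"
          using row_norm_le_sup_dist[OF \<phi> \<phi>'(1) \<psi>X(2)] sup_dist_le_dist_E[OF \<phi> \<phi>'(1)] \<phi>'(2) by linarith
        finally show "row_norm (compose op_ball \<phi> \<psi> X - compose op_ball \<phi>' \<psi>' X) \<le> (L + 1) * d"
          using L(1) X by (simp add: compose_eq distrib_right)
      qed
      then show ?thesis using de by (simp add: p q Aut_ball_simps \<phi> \<psi> \<phi>' \<psi>')
    qed
    ultimately show "\<exists>U. openin (prod_topology ?T ?T) U \<and> p \<in> U \<and>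
      (\<forall>q\<in>U. sup_dist (case p of (x, y) \<Rightarrow> x \<otimes>\<^bsub>?G\<^esub> y) (case q of (x, y) \<Rightarrow> x \<otimes>\<^bsub>?G\<^esub> y) < e)"
      by blast
  qed
  show "continuous_map ?T ?T (\<lambda>x. inv\<^bsub>?G\<^esub> x)"
  proof (rule continuous_map_Aut_topologyI)
    fix \<phi> assume "\<phi> \<in> topspace ?T"
    then have \<phi>: "\<phi> \<in> free_aut" by (simp add: topspace_Aut_topology)
    show "inv\<^bsub>?G\<^esub> \<phi> \<in> free_aut" by (simp add: Aut_ball_simps \<phi> restrict_inv_in_free_aut)
    fix e :: real assume e: "0 < e"
    obtain L where L: "L > 0" "\<And>\<psi> X. \<psi> \<in> free_aut \<Longrightarrow> X \<in> op_ball \<Longrightarrow>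
       row_norm (inv_into op_ball \<phi> X - inv_into op_ball \<psi> X) \<le> L * sup_dist \<phi> \<psi>"
      by (rule inverse_deviation[OF \<phi>]) blast
    have e': "0 < e / (2 * L)" using e L(1) by simp
    have "sup_dist (inv\<^bsub>?G\<^esub> \<phi>) (inv\<^bsub>?G\<^esub> \<psi>) < e" if \<psi>: "\<psi> \<in> free_aut" and d: "dist_E \<phi> \<psi> < e / (2 * L)" for \<psi>
    proof -
      have "sup_dist (inv\<^bsub>?G\<^esub> \<phi>) (inv\<^bsub>?G\<^esub> \<psi>) \<le> L * sup_dist \<phi> \<psi>"
        unfolding Aut_ball_simps(4)[OF \<phi>] Aut_ball_simps(4)[OF \<psi>]
        by (rule sup_dist_least) (simp add: L(2)[OF \<psi>])
      also have "\<dots> \<le> L * (e / (2 * L))"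
        using sup_dist_le_dist_E[OF \<phi> \<psi>] d L(1) by (intro mult_left_mono) auto
      also have "\<dots> < e" using e L(1) by simp
      finally show ?thesis .
    qed
    then show "\<exists>U. openin ?T U \<and> \<phi> \<in> U \<and> (\<forall>\<psi>\<in>U. sup_dist (inv\<^bsub>?G\<^esub> \<phi>) (inv\<^bsub>?G\<^esub> \<psi>) < e)"
      using openin_dist_E_ball[OF \<phi> e'] by (intro exI[of _ "{\<psi> \<in> free_aut. dist_E \<phi> \<psi> < e / (2 * L)}"]) auto
  qed
qed

section \<open>Compactness\<close>

definition bounded_J_unitary :: "real \<Rightarrow> 'n::finite ext_matrix set" where
  "bounded_J_unitary R = {M. J_unitary M \<and> cmod (M $ None $ None) \<le> R}"

text \<open>Closed, because it is defined by polynomial equations and one weak inequality, and bounded by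
  \<open>J_unitary_entry_le\<close>.\<close>

lemma compact_bounded_J_unitary: "compact (bounded_J_unitary R :: 'n::finite ext_matrix set)"
proof -
  have "norm M \<le> real CARD('n option) * (real CARD('n option) * R)" if "M \<in> bounded_J_unitary R" for M :: "'n ext_matrix"
  proof -
    have entry: "cmod (M $ a $ b) \<le> R" for a b
      using that J_unitary_entry_le[of M a b] by (auto simp: bounded_J_unitary_def)
    have row: "norm (M $ a) \<le> real CARD('n option) * R" for a
    proof -
      have "norm (M $ a) \<le> (\<Sum>b\<in>UNIV. cmod (M $ a $ b))" unfolding norm_vec_def by (rule L2_set_le_sum) simp
      also have "\<dots> \<le> (\<Sum>b\<in>(UNIV::'n option set). R)" by (intro sum_mono entry)
      finally show ?thesis by (simp only: sum_constant)
    qed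
    have "norm M \<le> (\<Sum>a\<in>UNIV. norm (M $ a))" unfolding norm_vec_def by (rule L2_set_le_sum) simp
    also have "\<dots> \<le> (\<Sum>a\<in>(UNIV::'n option set). real CARD('n option) * R)" by (intro sum_mono row)
    finally show ?thesis by (simp only: sum_constant)
  qed
  then have "bounded (bounded_J_unitary R :: 'n ext_matrix set)" unfolding bounded_iff by blast
  moreover have "closed (bounded_J_unitary R :: 'n ext_matrix set)"
    unfolding bounded_J_unitary_def J_unitary_def
    by (intro closed_Collect_conj closed_Collect_all closed_Collect_eq closed_Collect_le continuous_intros)
  ultimately show ?thesis by (simp add: compact_eq_bounded_closed)
qed

lemma continuous_map_lin_frac_aut:
  "continuous_map (top_of_set {M. J_unitary M}) (Aut_topology :: (('h::complex_hilbert_space, 'n::finite) op_tuple \<Rightarrow> ('h, 'n) op_tuple) topology) lin_frac_aut"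
proof (rule continuous_map_Aut_topologyI)
  fix M :: "'n ext_matrix" and e :: real assume "M \<in> topspace (top_of_set {M. J_unitary M})"
  then have M: "J_unitary M" by simp
  show "(lin_frac_aut M :: ('h, 'n) op_tuple \<Rightarrow> ('h, 'n) op_tuple) \<in> free_aut" by (rule lin_frac_aut_in_free_aut[OF M])
  assume e: "0 < e"
  define K where "K = real CARD('n) * (2 * cmod (M $ None $ None) * (2 * real CARD('n option)))"
  have K0: "0 \<le> K" by (simp add: K_def)
  define U where "U = {M. J_unitary M} \<inter> ball M (e / (K + 1))"
  have "sup_dist (lin_frac_aut M :: ('h, 'n) op_tuple \<Rightarrow> ('h, 'n) op_tuple) (lin_frac_aut N) < e" if "N \<in> U" for N
  proof -
    have N: "J_unitary N" "norm (M - N) < e / (K + 1)" using that by (auto simp: U_def dist_norm)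
    have "sup_dist (lin_frac_aut M :: ('h, 'n) op_tuple \<Rightarrow> ('h, 'n) op_tuple) (lin_frac_aut N) \<le> K * norm (M - N)"
    proof (rule sup_dist_least)
      fix X :: "('h, 'n) op_tuple" assume "X \<in> op_ball"
      then show "row_norm (lin_frac_aut M X - lin_frac_aut N X) \<le> K * norm (M - N)"
        using lin_frac_Lipschitz_in_matrix[OF M N(1)] by (simp add: K_def algebra_simps)
    qed
    also have "\<dots> \<le> K * (e / (K + 1))" using N(2) K0 by (intro mult_left_mono) auto
    also have "\<dots> < e" using K0 e by (simp add: field_simps)
    finally show ?thesis .
  qed
  moreover have "openin (top_of_set {M. J_unitary M}) U" unfolding U_def by (rule openin_open_Int) simp
  moreover have "M \<in> U" using M e K0 by (simp add: U_def)
  ultimately show "\<exists>U. openin (top_of_set {M. J_unitary M}) U \<and> M \<in> U \<and>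
    (\<forall>N\<in>U. sup_dist (lin_frac_aut M :: ('h, 'n) op_tuple \<Rightarrow> ('h, 'n) op_tuple) (lin_frac_aut N) < e)"
    by blast
qed

lemma compactin_bounded_automorphisms: "compactin Aut_topology (lin_frac_aut ` bounded_J_unitary R)"
proof (rule image_compactin[OF _ continuous_map_lin_frac_aut])
  show "compactin (top_of_set {M. J_unitary M}) (bounded_J_unitary R)"
    using compact_bounded_J_unitary by (auto simp: compactin_subtopology bounded_J_unitary_def)
qed

lemma sigma_compact_Aut: "sigma_compact_space Aut_topology"
  unfolding sigma_compact_space_def
proof (intro exI conjI allI)
  fix i :: nat
  show "compactin Aut_topology (lin_frac_aut ` bounded_J_unitary (real i))" by (rule compactin_bounded_automorphisms)
next
  show "(\<Union>i. lin_frac_aut ` bounded_J_unitary (real i)) = topspace Aut_topology"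
    unfolding topspace_Aut_topology free_aut_eq using real_arch_simple
    by (fastforce simp: bounded_J_unitary_def)
qed

text \<open>The point that is mapped to \<open>0\<close> determines the modulus of the corner entry, and with it a bound for the
  whole matrix. Here the second summand of the metric enters: it keeps this point away from the boundary.\<close>

lemma row_norm_inverse_zero:
  assumes nontrivial: "\<exists>u::'h::complex_hilbert_space. u \<noteq> 0" and M: "J_unitary M"
  shows "(row_norm (inv_into op_ball (lin_frac_aut M :: ('h, 'n::finite) op_tuple \<Rightarrow> ('h, 'n) op_tuple) 0))\<^sup>2 =
     1 - 1 / (cmod (M $ None $ None))\<^sup>2"
proof -
  define m where "m = cmod (M $ None $ None)"
  have m: "0 < m\<^sup>2" using J_unitary_corner_ge_1[OF M] by (auto simp: m_def)
  define x :: "complex ^ 'n" where "x = (\<chi> j. J_inv M $ None $ Some j / J_inv M $ None $ None)"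
  have "inv_into op_ball (lin_frac_aut M :: ('h, 'n) op_tuple \<Rightarrow> ('h, 'n) op_tuple) 0 = scalar_tuple x"
    by (simp add: inv_into_lin_frac_aut[OF M] lin_frac_at_zero[OF J_unitary_J_inv[OF M]] x_def)
  then have "(row_norm (inv_into op_ball (lin_frac_aut M :: ('h, 'n) op_tuple \<Rightarrow> ('h, 'n) op_tuple) 0))\<^sup>2 = (norm x)\<^sup>2"
    by (simp add: row_norm_scalar_tuple[OF nontrivial])
  also have "\<dots> = (\<Sum>j\<in>UNIV. (cmod (M $ Some j $ None))\<^sup>2 / m\<^sup>2)"
    unfolding norm_vec_sq by (simp add: x_def J_inv_def norm_divide power_divide m_def)
  also have "\<dots> = (\<Sum>j\<in>UNIV. (cmod (M $ Some j $ None))\<^sup>2) / m\<^sup>2" by (simp add: sum_divide_distrib)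
  also have "(\<Sum>j\<in>UNIV. (cmod (M $ Some j $ None))\<^sup>2) = m\<^sup>2 - 1"
    using J_unitary_column_None[OF M] by (simp add: m_def)
  also have "(m\<^sup>2 - 1) / m\<^sup>2 = 1 - 1 / m\<^sup>2" using m by (simp add: diff_divide_distrib)
  finally show ?thesis by (simp add: m_def)
qed

text \<open>On a small metric ball about \<open>\<phi>\<close> the point mapped to \<open>0\<close> has norm at most some \<open>t < 1\<close>, hence the corner entry of
  the matrix is at most \<open>1 / (1 - t\<^sup>2)\<close>, and the ball lies in a compact set of the previous kind.\<close>

lemma locally_compact_Aut:
  "locally_compact_space (Aut_topology :: (('h::complex_hilbert_space, 'n::finite) op_tuple \<Rightarrow> ('h, 'n) op_tuple) topology)"
  unfolding locally_compact_space_def topspace_Aut_topology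
proof
  fix \<phi> :: "('h, 'n) op_tuple \<Rightarrow> ('h, 'n) op_tuple" assume \<phi>: "\<phi> \<in> free_aut"
  show "\<exists>U K. openin Aut_topology U \<and> compactin Aut_topology K \<and> \<phi> \<in> U \<and> U \<subseteq> K"
  proof (cases "\<exists>u::'h. u \<noteq> 0")
    case True
    define r where "r = row_norm (inv_into op_ball \<phi> 0)"
    define t where "t = (r + 1) / 2"
    define e where "e = (1 - r) / 2"
    have r: "0 \<le> r" "r < 1" using op_ballD(2)[OF inv_into_free_aut(2)[OF \<phi> zero_in_op_ball]] by (auto simp: r_def)
    then have t: "0 \<le> t" "t < 1" "0 < e" "r + e = t" by (auto simp: t_def e_def field_simps)
    have t2: "t\<^sup>2 < 1" using t by (simp add: power_less_one_iff)
    define R where "R = 1 / (1 - t\<^sup>2)"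
    have "\<psi> \<in> lin_frac_aut ` bounded_J_unitary R" if \<psi>: "\<psi> \<in> free_aut" and d: "dist_E \<phi> \<psi> < e" for \<psi>
    proof -
      obtain M where M: "J_unitary M" "\<psi> = lin_frac_aut M" by (rule free_autE[OF \<psi>])
      have "row_norm (inv_into op_ball \<psi> 0) \<le> row_norm (inv_into op_ball \<psi> 0 - inv_into op_ball \<phi> 0) + r"
        using row_norm_triangle[of "inv_into op_ball \<psi> 0 - inv_into op_ball \<phi> 0" "inv_into op_ball \<phi> 0"] by (simp add: r_def)
      also have "row_norm (inv_into op_ball \<psi> 0 - inv_into op_ball \<phi> 0) \<le> e"
        using d sup_dist_nonneg[OF \<phi> \<psi>] row_norm_minus_commute[of "inv_into op_ball \<psi> 0" "inv_into op_ball \<phi> 0"]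
        by (simp add: dist_E_eq[OF \<phi> \<psi>])
      finally have "row_norm (inv_into op_ball \<psi> 0) \<le> t" using t(4) by simp
      then have "(row_norm (inv_into op_ball \<psi> 0))\<^sup>2 \<le> t\<^sup>2" by (intro power_mono) auto
      then have le: "1 - t\<^sup>2 \<le> 1 / (cmod (M $ None $ None))\<^sup>2"
        using row_norm_inverse_zero[OF True M(1)] by (simp add: M(2))
      have m1: "1 \<le> cmod (M $ None $ None)" by (rule J_unitary_corner_ge_1[OF M(1)])
      have "cmod (M $ None $ None) \<le> (cmod (M $ None $ None))\<^sup>2" using m1 by (rule self_le_power) simp
      also have "\<dots> \<le> R"
      proof -
        have "0 < (cmod (M $ None $ None))\<^sup>2" using m1 by (intro zero_less_power) linarith
        then show ?thesis using le t2 by (simp add: R_def field_simps)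
      qed
      finally show ?thesis using M by (auto simp: bounded_J_unitary_def)
    qed
    then have "{\<psi> \<in> free_aut. dist_E \<phi> \<psi> < e} \<subseteq> lin_frac_aut ` bounded_J_unitary R" by blast
    then show ?thesis
      using openin_dist_E_ball[OF \<phi> t(3)] compactin_bounded_automorphisms by blast
  next
    case False
    have "lin_frac_aut M = (lin_frac_aut (mat 1) :: ('h, 'n) op_tuple \<Rightarrow> ('h, 'n) op_tuple)" for M
      unfolding lin_frac_aut_def by (rule restrict_ext) (rule trivial_space_tuples_eq[OF False])
    moreover have "(mat 1 :: 'n ext_matrix) \<in> bounded_J_unitary 1"
      unfolding bounded_J_unitary_def using J_unitary_one by (auto simp: mat_def)
    ultimately have "(free_aut :: (('h, 'n) op_tuple \<Rightarrow> ('h, 'n) op_tuple) set) \<subseteq> lin_frac_aut ` bounded_J_unitary 1"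
      unfolding free_aut_eq by (metis image_eqI image_subsetI)
    then show ?thesis
      using \<phi> compactin_bounded_automorphisms openin_topspace[of "Aut_topology :: (('h, 'n) op_tuple \<Rightarrow> ('h, 'n) op_tuple) topology"]
      unfolding topspace_Aut_topology by blast
  qed
qed

theorem theorem3p4:
  shows "let G = (Aut_ball :: (('h::complex_hilbert_space, 'n::finite) op_tuple \<Rightarrow> ('h, 'n) op_tuple) monoid);
             T = Aut_topology
         in Metric_space (carrier G) dist_E \<and>
            topological_group G T \<and>
            sigma_compact_space T \<and>
            locally_compact_space T"
  by (simp add: Aut_ball_simps(1) Metric_space_dist_E topological_group_Aut sigma_compact_Aut locally_compact_Aut)

end
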